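(* Let $\Gamma^{(1)},\dots,\Gamma^{(k)}$ be pairwise isomorphic finite undirected simple graphs, each with at least $2$ vertices, none of which can be written as a simplicial join of two graphs with nonempty vertex sets. Then \[\mathrm{Spec}_R\big(G_{\ast_{i=1}^k\Gamma^{(i)}}\big)=\mathrm{Spec}_R\Big(\prod_{i=1}^k G_{\Gamma^{(i)}}\Big)=\bigcup_{i=1}^k\Big\{\prod_{m=1}^i R_m\ :\ R_1,\dots,R_i\in\mathrm{Spec}_R(G_{\Gamma^{(1)}})\Big\}.\]
   Context: For a finite undirected simple graph $\Gamma$ with vertex set $\{x_1,\dots,x_n\}$ and edge set $E$, the group $G_\Gamma$ is defined by the presentation with generators $x_1,\dots,x_n$ and $y_{i,j}$ for each pair $i<j$ with $x_ix_j\notin E$, and relations $[x_j,x_i]=1$ if $x_ix_j\in E$; $[x_j,x_i]=y_{i,j}$ if $x_ix_j\notin E$ and $i<j$; and $[x_l,y_{i,j}]=1$ for all $l$ and all such $y_{i,j}$. The simplicial join $\ast_{i=1}^k\Gamma_i$ of graphs $\Gamma_i(V_i,E_i)$ has vertex set $\bigsqcup_i V_i$ and edge set $\bigsqcup_i E_i\cup\{vw: v\in V_i, w\in V_j, i<j\}$. For a group $G$ and $\varphi\in\mathrm{Aut}(G)$, $R(\varphi)\in\mathbb{N}_0\cup\{\infty\}$ is the number of classes of $a\sim b\iff a=cb\varphi(c)^{-1}$ for some $c\in G$, and $\mathrm{Spec}_R(G)=\{R(\varphi):\varphi\in\mathrm{Aut}(G)\}$ ($\mathbb{N}_0$ = positive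 integers). Products involving $\infty$ equal $\infty$. *)

theory Defs
  imports "HOL-Algebra.Algebra" "HOL-Library.Extended_Nat"
begin

text \<open>A word over generators of type 'g: list of (generator, inverted?) letters.\<close>
type_synonym 'g word = "('g \<times> bool) list"

definition words :: "'g set \<Rightarrow> 'g word set" where
  "words S = lists (S \<times> UNIV)"

inductive_set pres_eqv :: "'g set \<Rightarrow> 'g word set \<Rightarrow> ('g word \<times> 'g word) set"
  for S :: "'g set" and R :: "'g word set" where
  refl: "w \<in> words S \<Longrightarrow> (w, w) \<in> pres_eqv S R"
| sym: "(w, w') \<in> pres_eqv S R \<Longrightarrow> (w', w) \<in> pres_eqv S R"
| trans: "(u, v) \<in> pres_eqv S R \<Longrightarrow> (v, w) \<in> pres_eqv S R \<Longrightarrow> (u, w) \<in> pres_eqv S R"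
| ctx: "(w, w') \<in> pres_eqv S R \<Longrightarrow> u \<in> words S \<Longrightarrow> v \<in> words S
        \<Longrightarrow> (u @ w @ v, u @ w' @ v) \<in> pres_eqv S R"
| cancel: "s \<in> S \<Longrightarrow> ([(s, b), (s, \<not> b)], []) \<in> pres_eqv S R"
| rel: "r \<in> R \<Longrightarrow> r \<in> words S \<Longrightarrow> (r, []) \<in> pres_eqv S R"

definition presented_group :: "'g set \<Rightarrow> 'g word set \<Rightarrow> 'g word set monoid" where
  "presented_group S R =
     \<lparr>carrier = words S // pres_eqv S R,
      monoid.mult = (\<lambda>A B. \<Union>a\<in>A. \<Union>b\<in>B. pres_eqv S R `` {a @ b}),
      one = pres_eqv S R `` {[]}\<rparr>"

text \<open>A finite simple graph on vertex set {0..<n} (vertex x_(i+1) of the paper is i),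
  given by a symmetric irreflexive adjacency predicate supported on {0..<n}.\<close>
type_synonym graph = "nat \<times> (nat \<Rightarrow> nat \<Rightarrow> bool)"

definition simple_graph :: "graph \<Rightarrow> bool" where
  "simple_graph \<Gamma> \<longleftrightarrow> (\<forall>i j. snd \<Gamma> i j \<longrightarrow> i < fst \<Gamma> \<and> j < fst \<Gamma> \<and> i \<noteq> j \<and> snd \<Gamma> j i)"

datatype gen = GX nat | GY nat nat

definition letter :: "gen \<Rightarrow> gen word" where "letter g = [(g, False)]"
definition inv_letter :: "gen \<Rightarrow> gen word" where "inv_letter g = [(g, True)]"

definition comm_word :: "gen \<Rightarrow> gen \<Rightarrow> gen word" where
  "comm_word a b = inv_letter a @ inv_letter b @ letter a @ letter b"

definition gamma_gens :: "graph \<Rightarrow> gen set" where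
  "gamma_gens \<Gamma> = {GX p | p. p < fst \<Gamma>} \<union>
                   {GY i j | i j. i < j \<and> j < fst \<Gamma> \<and> \<not> snd \<Gamma> i j}"

definition gamma_rels :: "graph \<Rightarrow> gen word set" where
  "gamma_rels \<Gamma> =
     {comm_word (GX j) (GX i) | i j. i < j \<and> j < fst \<Gamma> \<and> snd \<Gamma> i j}
   \<union> {comm_word (GX j) (GX i) @ inv_letter (GY i j) | i j. i < j \<and> j < fst \<Gamma> \<and> \<not> snd \<Gamma> i j}
   \<union> {comm_word (GX p) (GY i j) | p i j. p < fst \<Gamma> \<and> i < j \<and> j < fst \<Gamma> \<and> \<not> snd \<Gamma> i j}"

definition G_graph :: "graph \<Rightarrow> gen word set monoid" where
  "G_graph \<Gamma> = presented_group (gamma_gens \<Gamma>) (gamma_rels \<Gamma>)"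

definition join :: "graph \<Rightarrow> graph \<Rightarrow> graph" where
  "join \<Gamma>1 \<Gamma>2 = (let n1 = fst \<Gamma>1; n2 = fst \<Gamma>2 in
     (n1 + n2, \<lambda>i j. (i < n1 \<and> j < n1 \<and> snd \<Gamma>1 i j)
                  \<or> (n1 \<le> i \<and> n1 \<le> j \<and> i < n1 + n2 \<and> j < n1 + n2 \<and> snd \<Gamma>2 (i - n1) (j - n1))
                  \<or> (i < n1 \<and> n1 \<le> j \<and> j < n1 + n2)
                  \<or> (j < n1 \<and> n1 \<le> i \<and> i < n1 + n2)))"

fun join_list :: "graph list \<Rightarrow> graph" where
  "join_list [] = (0, \<lambda>_ _. False)"
| "join_list (\<Gamma> # \<Gamma>s) = join \<Gamma> (join_list \<Gamma>s)"

definition graph_iso :: "graph \<Rightarrow> graph \<Rightarrow> bool" where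
  "graph_iso \<Gamma>1 \<Gamma>2 \<longleftrightarrow> (\<exists>f. bij_betw f {0..<fst \<Gamma>1} {0..<fst \<Gamma>2} \<and>
      (\<forall>i<fst \<Gamma>1. \<forall>j<fst \<Gamma>1. snd \<Gamma>1 i j \<longleftrightarrow> snd \<Gamma>2 (f i) (f j)))"

definition join_decomposable :: "graph \<Rightarrow> bool" where
  "join_decomposable \<Gamma> \<longleftrightarrow> (\<exists>\<Gamma>1 \<Gamma>2. simple_graph \<Gamma>1 \<and> simple_graph \<Gamma>2 \<and>
      fst \<Gamma>1 > 0 \<and> fst \<Gamma>2 > 0 \<and> graph_iso \<Gamma> (join \<Gamma>1 \<Gamma>2))"

definition twisted_conj :: "('a, 'b) monoid_scheme \<Rightarrow> ('a \<Rightarrow> 'a) \<Rightarrow> ('a \<times> 'a) set" where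
  "twisted_conj G \<phi> = {(a, b). a \<in> carrier G \<and> b \<in> carrier G \<and>
      (\<exists>c\<in>carrier G. a = c \<otimes>\<^bsub>G\<^esub> b \<otimes>\<^bsub>G\<^esub> inv\<^bsub>G\<^esub> (\<phi> c))}"

definition reidemeister :: "('a, 'b) monoid_scheme \<Rightarrow> ('a \<Rightarrow> 'a) \<Rightarrow> enat" where
  "reidemeister G \<phi> = (let C = carrier G // twisted_conj G \<phi> in
      if finite C then enat (card C) else \<infinity>)"

definition spec_R :: "('a, 'b) monoid_scheme \<Rightarrow> enat set" where
  "spec_R G = reidemeister G ` auto G"

end

theory Submission
  imports Defs
begin

text \<open>Write \<open>\<Delta>\<close> for the complement of a join-indecomposable graph \<open>\<Gamma>\<close>; it is connected with at least two
  vertices, and the group of a join is the product of the groups. Modulo its centre, which is its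
  derived group, \<open>G\<^sub>\<Gamma>\<close> is free abelian on the vertices, and elements with exponent vectors \<open>v\<close>, \<open>w\<close>
  commute iff \<open>v\<^sub>a w\<^sub>b = v\<^sub>b w\<^sub>a\<close> for all edges \<open>ab\<close> of \<open>\<Delta>\<close>. The images of the factors under an automorphism
  \<open>\<phi>\<close> of \<open>G\<^sub>\<Gamma>\<^sup>k\<close> commute, so if two of them had a nonzero exponent at the two ends of such an edge, all images
  would be proportional there, contradicting surjectivity. As \<open>\<Delta>\<close> is connected, each block of exponents
  receives exactly one factor: modulo the centre \<open>\<phi>\<close> permutes the factors, and the resulting honest
  permutation-type automorphism \<open>\<phi>'\<close> also agrees with \<open>\<phi>\<close> on the centre. Hence \<open>R(\<phi>) = R(\<phi>')\<close>: both are
  infinite if \<open>\<phi>\<close> has a nontrivial fixed vector modulo the centre, and otherwise conjugators between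
  suitable representatives are central. Finally \<open>R(\<phi>')\<close> is the product, over the cycles of
  the permutation, of the Reidemeister numbers of the return maps, and every such product occurs.\<close>

section \<open>Reidemeister numbers\<close>

text \<open>The obstacle is that an automorphism of the power need not permute the factors: it can
  be altered by homomorphisms into the centre. Such an alteration is harmless for counting. A
  homomorphism with central values kills the derived group, and the derived group is the whole
  centre because every vertex has a neighbour in \<Delta>; so the alteration is invisible on the
  centre. Finiteness of a Reidemeister number enters only to exclude nonzero fixed vectors modulo
  the centre, which is what forces the relevant conjugators to be central.

  A permutation with i cycles produces a product of i numbers, and every i from 1 to k is the number
  of cycles of some permutation of k indices: hence the union over i.

  The presentation alone does not show that different collected words are different elements. A
  concrete group of truncated Magnus series settles this; in it exponents, commutation and the
  derived group can be computed, and joins and graph isomorphisms are visible.\<close>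

definition ecard :: "'a set \<Rightarrow> enat" where
  "ecard S = (if finite S then enat (card S) else \<infinity>)"

lemma reidemeister_ecard: "reidemeister G \<phi> = ecard (carrier G // twisted_conj G \<phi>)"
  by (simp add: reidemeister_def ecard_def Let_def)

lemma ecard_bij_betw: "bij_betw f A B \<Longrightarrow> ecard A = ecard B"
  by (auto simp: ecard_def bij_betw_finite bij_betw_same_card)

text \<open>Two quotients can be compared on a set \<open>T\<close> that meets every class on both
  sides; it may meet a class several times, so no transversal has to be chosen. Later
  \<open>f\<close> is an isomorphism, a restriction to fewer coordinates, or the identity.\<close>

lemma ecard_quotient_eq:
  assumes r: "equiv A r" and s: "equiv B s" and TA: "T \<subseteq> A" and fB: "f ` T \<subseteq> B"
    and covA: "\<And>a. a \<in> A \<Longrightarrow> \<exists>t\<in>T. (a, t) \<in> r"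
    and covB: "\<And>b. b \<in> B \<Longrightarrow> \<exists>t\<in>T. (b, f t) \<in> s"
    and rel: "\<And>t u. t \<in> T \<Longrightarrow> u \<in> T \<Longrightarrow> (t, u) \<in> r \<longleftrightarrow> (f t, f u) \<in> s"
  shows "ecard (A // r) = ecard (B // s)"
proof -
  \<comment> \<open>All representatives in \<open>C \<inter> T\<close> have equivalent images, so
    for a class \<open>C\<close> this union is a single class of \<open>s\<close>.\<close>
  define h where "h = (\<lambda>C. s `` (f ` (C \<inter> T)))"
  have h: "h (r `` {t}) = s `` {f t}" if t: "t \<in> T" for t
  proof -
    have "t \<in> r `` {t}" using r t TA by (meson equiv_class_self subsetD)
    moreover have "s `` {f u} = s `` {f t}" if "u \<in> r `` {t} \<inter> T" for u
      using that rel[OF t, of u] equiv_class_eq[OF s] by blast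
    ultimately show ?thesis unfolding h_def using t by blast
  qed
  have repA: "\<exists>t\<in>T. C = r `` {t}" if "C \<in> A // r" for C
    using that covA equiv_class_eq[OF r] by (metis quotientE)
  have repB: "\<exists>t\<in>T. C = s `` {f t}" if "C \<in> B // s" for C
    using that covB equiv_class_eq[OF s] by (metis quotientE)
  have "bij_betw h (A // r) (B // s)"
  proof (intro bij_betw_imageI inj_onI)
    fix C C' assume "C \<in> A // r" "C' \<in> A // r" and e: "h C = h C'"
    then obtain t u where tu: "t \<in> T" "C = r `` {t}" "u \<in> T" "C' = r `` {u}" using repA by metis
    with e h have "s `` {f t} = s `` {f u}" by simp
    moreover have "f t \<in> B" "f u \<in> B" using tu fB by auto
    ultimately have "(f t, f u) \<in> s" using eq_equiv_class_iff[OF s] by blast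
    then show "C = C'" using tu rel equiv_class_eq[OF r] by metis
  next
    show "h ` (A // r) = B // s"
    proof
      show "h ` (A // r) \<subseteq> B // s"
        using repA h fB by (force intro: quotientI)
      show "B // s \<subseteq> h ` (A // r)"
      proof
        fix C assume "C \<in> B // s"
        then obtain t where "t \<in> T" "C = s `` {f t}" using repB by metis
        then have "C = h (r `` {t})" "r `` {t} \<in> A // r" using h TA by (auto intro: quotientI)
        then show "C \<in> h ` (A // r)" by blast
      qed
    qed
  qed
  then show ?thesis by (rule ecard_bij_betw)
qed

lemma ecard_PiE:
  assumes "finite K" and ne: "\<And>i. i \<in> K \<Longrightarrow> S i \<noteq> {}"
  shows "ecard (Pi\<^sub>E K S) = (\<Prod>i\<in>K. ecard (S i))"
proof (cases "\<forall>i\<in>K. finite (S i)")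
  case True
  then have "(\<Prod>i\<in>K. ecard (S i)) = (\<Prod>i\<in>K. enat (card (S i)))"
    by (intro prod.cong) (auto simp: ecard_def)
  also have "\<dots> = enat (\<Prod>i\<in>K. card (S i))"
    using \<open>finite K\<close> by (induction K) (auto simp: one_enat_def)
  also have "\<dots> = ecard (Pi\<^sub>E K S)"
    using True assms by (simp add: ecard_def card_PiE finite_PiE)
  finally show ?thesis by simp
next
  case False
  then obtain i where i: "i \<in> K" "infinite (S i)" by blast
  have inf: "infinite (Pi\<^sub>E K S)"
    using i assms by (auto simp: finite_PiE_iff PiE_eq_empty_iff)
  \<comment> \<open>In \<open>enat\<close>, zero times infinity is zero, so the infinite factor
    decides the product only once the remaining factors are known to be nonzero.\<close>
  have nz: "ecard (S j) \<noteq> 0" if "j \<in> K" for j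
    using ne[OF that] by (auto simp: ecard_def zero_enat_def)
  have "(\<Prod>j\<in>F. ecard (S j)) \<noteq> 0" if "F \<subseteq> K" for F
    using finite_subset[OF that assms(1)] that nz by (induction F rule: finite_induct) auto
  from this[of "K - {i}"] have "(\<Prod>j\<in>K - {i}. ecard (S j)) \<noteq> 0" by blast
  then have "(\<Prod>j\<in>K. ecard (S j)) = \<infinity>"
    using i assms(1) by (simp add: prod.remove ecard_def imult_is_infinity)
  then show ?thesis using inf by (simp add: ecard_def)
qed

context group begin

lemma twisted_conj_equiv:
  assumes "\<phi> \<in> hom G G" shows "equiv (carrier G) (twisted_conj G \<phi>)"
proof (rule equivI)
  interpret p: group_hom G G \<phi> using assms by (simp add: group_hom_def group_hom_axioms_def)
  show "twisted_conj G \<phi> \<subseteq> carrier G \<times> carrier G" by (auto simp: twisted_conj_def)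
  show "refl_on (carrier G) (twisted_conj G \<phi>)"
    unfolding refl_on_def twisted_conj_def by (auto intro!: bexI[of _ \<one>])
  show "sym_on UNIV (twisted_conj G \<phi>)"
  proof (rule symI)
    fix a b assume "(a, b) \<in> twisted_conj G \<phi>"
    then obtain c where c: "a \<in> carrier G" "b \<in> carrier G" "c \<in> carrier G" "a = c \<otimes> b \<otimes> inv \<phi> c"
      by (auto simp: twisted_conj_def)
    have "b = inv c \<otimes> a \<otimes> inv \<phi> (inv c)"
      using c by (simp add: m_assoc inv_solve_left)
    then show "(b, a) \<in> twisted_conj G \<phi>" using c unfolding twisted_conj_def by blast
  qed
  show "trans_on UNIV (twisted_conj G \<phi>)"
  proof (rule transI)
    fix a b d assume "(a, b) \<in> twisted_conj G \<phi>" "(b, d) \<in> twisted_conj G \<phi>"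
    then obtain c e where c: "a \<in> carrier G" "b \<in> carrier G" "c \<in> carrier G" "a = c \<otimes> b \<otimes> inv \<phi> c"
      "d \<in> carrier G" "e \<in> carrier G" "b = e \<otimes> d \<otimes> inv \<phi> e"
      by (auto simp: twisted_conj_def)
    have "a = (c \<otimes> e) \<otimes> d \<otimes> inv \<phi> (c \<otimes> e)"
      using c by (simp add: m_assoc inv_mult_group)
    then show "(a, d) \<in> twisted_conj G \<phi>" using c unfolding twisted_conj_def by blast
  qed
qed

lemma auto_hom: "\<phi> \<in> auto G \<Longrightarrow> \<phi> \<in> hom G G"
  by (simp add: auto_def)

text \<open>\<open>auto G\<close> admits only maps that are \<open>undefined\<close> off the
  carrier, which is why constructed automorphisms are wrapped in restrictions.\<close>

lemma auto_iff:
  "\<phi> \<in> auto G \<longleftrightarrow> \<phi> \<in> hom G G \<and> bij_betw \<phi> (carrier G) (carrier G) \<and> \<phi> \<in> extensional (carrier G)"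
  by (auto simp: auto_def Bij_def)

end

text \<open>Conjugating an automorphism of \<open>H\<close> by \<open>f\<close> gives one of
  \<open>G\<close> whose twisted classes correspond under \<open>f\<close>. The reverse inclusion
  will come from the inverse isomorphism.\<close>

lemma spec_R_cong_subset:
  assumes G: "group G" and H: "group H" and iso: "f \<in> iso G H"
  shows "spec_R H \<subseteq> spec_R G"
proof
  interpret G: group G by fact
  interpret H: group H by fact
  interpret f: group_hom G H f using G H iso by (simp add: group_hom_def group_hom_axioms_def iso_def)
  have bij: "bij_betw f (carrier G) (carrier H)" using iso by (simp add: iso_def)
  define g where "g = inv_into (carrier G) f"
  have g_iso: "g \<in> iso H G" unfolding g_def using G.iso_set_sym iso by blast
  have gf: "g (f x) = x" if "x \<in> carrier G" for x
    using that bij by (simp add: g_def bij_betw_inv_into_left)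
  have fg: "f (g x) = x" if "x \<in> carrier H" for x
    using that bij by (simp add: g_def bij_betw_inv_into_right)
  have gc: "g x \<in> carrier G" if "x \<in> carrier H" for x
    using that g_iso by (auto simp: iso_def hom_def)
  have gm: "g (x \<otimes>\<^bsub>H\<^esub> y) = g x \<otimes>\<^bsub>G\<^esub> g y" if "x \<in> carrier H" "y \<in> carrier H" for x y
    using that g_iso by (auto simp: iso_def hom_def)
  fix n assume "n \<in> spec_R H"
  then obtain \<phi> where \<phi>: "\<phi> \<in> auto H" "n = reidemeister H \<phi>" by (auto simp: spec_R_def)
  interpret p: group_hom H H \<phi> using H.auto_hom[OF \<phi>(1)] H by (simp add: group_hom_def group_hom_axioms_def)
  define \<psi> where "\<psi> = restrict (\<lambda>x. g (\<phi> (f x))) (carrier G)"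
  have psi_hom: "\<psi> \<in> hom G G" unfolding \<psi>_def hom_def by (auto simp: gc gm)
  have "bij_betw (\<lambda>x. g (\<phi> (f x))) (carrier G) (carrier G)"
    using bij_betw_trans[OF bij bij_betw_trans[of \<phi> "carrier H" "carrier H" g "carrier G"]] \<phi>(1) g_iso
    by (auto simp: H.auto_iff iso_def o_def)
  then have "bij_betw \<psi> (carrier G) (carrier G)"
    by (rule iffD1[OF bij_betw_cong, rotated]) (simp add: \<psi>_def)
  then have psi: "\<psi> \<in> auto G" using psi_hom by (simp add: G.auto_iff \<psi>_def)
  have "reidemeister G \<psi> = reidemeister H \<phi>"
    unfolding reidemeister_ecard
  proof (rule ecard_quotient_eq[where T = "carrier G" and f = f])
    show "equiv (carrier G) (twisted_conj G \<psi>)" using G.twisted_conj_equiv psi_hom .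
    show eqH: "equiv (carrier H) (twisted_conj H \<phi>)" using H.twisted_conj_equiv[OF H.auto_hom[OF \<phi>(1)]] .
    show "carrier G \<subseteq> carrier G" by simp
    show "f ` carrier G \<subseteq> carrier H" by auto
    show "\<exists>t\<in>carrier G. (a, t) \<in> twisted_conj G \<psi>" if "a \<in> carrier G" for a
      using that G.twisted_conj_equiv[OF psi_hom] by (meson equiv_class_self Image_singleton_iff)
    show "\<exists>t\<in>carrier G. (b, f t) \<in> twisted_conj H \<phi>" if "b \<in> carrier H" for b
      using that fg gc eqH by (metis equiv_class_self Image_singleton_iff)
    fix t u assume t: "t \<in> carrier G" and u: "u \<in> carrier G"
    have "(t = c \<otimes>\<^bsub>G\<^esub> u \<otimes>\<^bsub>G\<^esub> inv\<^bsub>G\<^esub> (\<psi> c)) \<longleftrightarrow> f t = f c \<otimes>\<^bsub>H\<^esub> f u \<otimes>\<^bsub>H\<^esub> inv\<^bsub>H\<^esub> (\<phi> (f c))"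
      if c: "c \<in> carrier G" for c
    proof -
      have "\<psi> c \<in> carrier G" using c by (simp add: \<psi>_def gc)
      then have "f (c \<otimes>\<^bsub>G\<^esub> u \<otimes>\<^bsub>G\<^esub> inv\<^bsub>G\<^esub> (\<psi> c)) = f c \<otimes>\<^bsub>H\<^esub> f u \<otimes>\<^bsub>H\<^esub> inv\<^bsub>H\<^esub> (\<phi> (f c))"
        using c u by (simp add: \<psi>_def fg)
      then show ?thesis using t c u \<open>\<psi> c \<in> carrier G\<close> gf
        by (metis G.inv_closed G.m_closed)
    qed
    moreover have "(\<exists>c\<in>carrier H. P c) \<longleftrightarrow> (\<exists>c\<in>carrier G. P (f c))" for P
      using fg gc by (metis f.hom_closed)
    ultimately show "((t, u) \<in> twisted_conj G \<psi>) = ((f t, f u) \<in> twisted_conj H \<phi>)"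
      using t u by (auto simp: twisted_conj_def)
  qed
  then show "n \<in> spec_R G" using \<phi>(2) psi unfolding spec_R_def by (metis image_eqI)
qed

lemma spec_R_iso:
  assumes "group G" "group H" "G \<cong> H" shows "spec_R G = spec_R H"
proof -
  obtain f where f: "f \<in> iso G H" using assms by (auto simp: is_iso_def)
  then have "inv_into (carrier G) f \<in> iso H G" using group.iso_set_sym[OF assms(1)] by blast
  then show ?thesis
    using spec_R_cong_subset[OF assms(1,2) f] spec_R_cong_subset[OF assms(2,1)] by blast
qed

section \<open>Automorphisms permuting the factors of a power\<close>

text \<open>Coordinate \<open>j\<close> of the image reads coordinate \<open>\<rho> j\<close>. In
  this form any self-map \<open>\<rho>\<close> of \<open>K\<close> is admissible and an index can be
  deleted; return maps along a cycle are compositions of the \<open>\<psi> j\<close>.\<close>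

definition wreath :: "('a, 'b) monoid_scheme \<Rightarrow> 'i set \<Rightarrow> ('i \<Rightarrow> 'i) \<Rightarrow> ('i \<Rightarrow> 'a \<Rightarrow> 'a) \<Rightarrow> ('i \<Rightarrow> 'a) \<Rightarrow> 'i \<Rightarrow> 'a"
  where "wreath G K \<rho> \<psi> = (\<lambda>g\<in>carrier (product_group K (\<lambda>_. G)). \<lambda>j\<in>K. \<psi> j (g (\<rho> j)))"

text \<open>For \<open>1 \<le> i \<le> k\<close> this permutation of \<open>{1..k}\<close> has
  exactly \<open>i\<close> cycles: the fixed points below \<open>i\<close> and one cycle through all
  of \<open>i, ..., k\<close>. Deleting \<open>k > i\<close> leaves
  \<open>tail_cycle i (k - 1)\<close>, which suits an induction on \<open>k\<close>.\<close>

definition tail_cycle :: "nat \<Rightarrow> nat \<Rightarrow> nat \<Rightarrow> nat" where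
  "tail_cycle i k l = (if l < i then l else if l = i then k else l - 1)"

lemma tail_cycle_bij:
  assumes "1 \<le> i" "i \<le> k" shows "bij_betw (tail_cycle i k) {1..k} {1..k}"
proof (rule bij_betw_imageI)
  show inj: "inj_on (tail_cycle i k) {1..k}"
    using assms by (auto simp: inj_on_def tail_cycle_def split: if_splits)
  have "tail_cycle i k ` {1..k} \<subseteq> {1..k}" using assms by (auto simp: tail_cycle_def)
  then show "tail_cycle i k ` {1..k} = {1..k}"
    using inj by (simp add: card_image card_subset_eq)
qed

context group begin

abbreviation pow_group :: "'i set \<Rightarrow> ('i \<Rightarrow> 'a) monoid" where
  "pow_group K \<equiv> product_group K (\<lambda>_. G)"

lemma group_pow_group [simp]: "group (pow_group K)"
  by (simp add: group_axioms)

lemma wreath_hom: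
  assumes "\<rho> ` K \<subseteq> K" "\<And>j. j \<in> K \<Longrightarrow> \<psi> j \<in> hom G G"
  shows "wreath G K \<rho> \<psi> \<in> hom (pow_group K) (pow_group K)"
proof (rule homI)
  have r: "\<rho> j \<in> K" if "j \<in> K" for j using assms that by auto
  have c: "\<psi> j x \<in> carrier G" if "j \<in> K" "x \<in> carrier G" for j x
    using assms(2)[OF that(1)] that by (auto simp: hom_def)
  fix g assume g: "g \<in> carrier (pow_group K)"
  then show "wreath G K \<rho> \<psi> g \<in> carrier (pow_group K)"
    using r c by (auto simp: wreath_def PiE_iff)
  fix h assume h: "h \<in> carrier (pow_group K)"
  have "g \<otimes>\<^bsub>pow_group K\<^esub> h \<in> carrier (pow_group K)"
    using g h by (intro monoid.m_closed group.is_monoid) auto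
  then show "wreath G K \<rho> \<psi> (g \<otimes>\<^bsub>pow_group K\<^esub> h) =
      wreath G K \<rho> \<psi> g \<otimes>\<^bsub>pow_group K\<^esub> wreath G K \<rho> \<psi> h"
    using g h r c assms(2) by (auto simp: wreath_def PiE_iff hom_mult intro!: restrict_ext)
qed

lemma wreath_auto:
  assumes \<rho>: "bij_betw \<rho> K K" and \<psi>: "\<And>j. j \<in> K \<Longrightarrow> \<psi> j \<in> iso G G"
  shows "wreath G K \<rho> \<psi> \<in> auto (pow_group K)"
proof -
  have hom: "wreath G K \<rho> \<psi> \<in> hom (pow_group K) (pow_group K)"
    using assms by (intro wreath_hom) (auto simp: bij_betw_def iso_def)
  have r: "\<rho> j \<in> K" if "j \<in> K" for j using \<rho> that by (auto simp: bij_betw_def)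
  have bij: "bij_betw (\<psi> j) (carrier G) (carrier G)" if "j \<in> K" for j using \<psi>[OF that] by (simp add: iso_def)
  have "inj_on (wreath G K \<rho> \<psi>) (carrier (pow_group K))"
  proof (rule inj_onI)
    fix g h assume g: "g \<in> carrier (pow_group K)" and h: "h \<in> carrier (pow_group K)"
      and e: "wreath G K \<rho> \<psi> g = wreath G K \<rho> \<psi> h"
    have "g i = h i" if "i \<in> K" for i
    proof -
      have "i \<in> \<rho> ` K" using \<rho> that by (simp add: bij_betw_def)
      then obtain j where j: "j \<in> K" "i = \<rho> j" by blast
      have "wreath G K \<rho> \<psi> g j = wreath G K \<rho> \<psi> h j" by (simp only: e)
      then have "\<psi> j (g i) = \<psi> j (h i)" using j g h by (simp add: wreath_def)
      then show ?thesis using bij[OF j(1)] g h that by (auto simp: bij_betw_def inj_on_def PiE_iff)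
    qed
    moreover have "g \<in> (\<Pi>\<^sub>E i\<in>K. carrier G)" "h \<in> (\<Pi>\<^sub>E i\<in>K. carrier G)" using g h by simp_all
    ultimately show "g = h" by (intro PiE_ext)
  qed
  moreover have "\<exists>g\<in>carrier (pow_group K). wreath G K \<rho> \<psi> g = h" if h: "h \<in> carrier (pow_group K)" for h
  proof -
    define \<sigma> where "\<sigma> = inv_into K \<rho>"
    have s: "\<sigma> i \<in> K" if "i \<in> K" for i using \<rho> that unfolding \<sigma>_def by (metis bij_betw_def inv_into_into)
    have sr: "\<sigma> (\<rho> j) = j" if "j \<in> K" for j using \<rho> that by (simp add: \<sigma>_def bij_betw_inv_into_left)
    \<comment> \<open>Coordinate \<open>i\<close> of \<open>g\<close> is read only by coordinate
      \<open>\<sigma> i\<close> of the image, so \<open>h (\<sigma> i)\<close> determines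
      it.\<close>
    define g where "g = (\<lambda>i\<in>K. inv_into (carrier G) (\<psi> (\<sigma> i)) (h (\<sigma> i)))"
    have g: "g \<in> carrier (pow_group K)"
      using s bij h unfolding g_def
      by (auto simp: bij_betw_def PiE_iff intro!: inv_into_into)
    moreover have "wreath G K \<rho> \<psi> g = h"
    proof
      fix x
      show "wreath G K \<rho> \<psi> g x = h x"
      proof (cases "x \<in> K")
        case True
        then have "h x \<in> carrier G" using h by auto
        then have "\<psi> x (inv_into (carrier G) (\<psi> x) (h x)) = h x"
          using bij_betw_inv_into_right[OF bij[OF True]] by simp
        then show ?thesis using True g r[OF True] sr[OF True] by (simp add: wreath_def g_def)
      next
        case False
        then show ?thesis using g h by (simp add: wreath_def PiE_iff extensional_def)
      qed
    qed
    ultimately show ?thesis by blast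
  qed
  then have "carrier (pow_group K) \<subseteq> wreath G K \<rho> \<psi> ` carrier (pow_group K)" by blast
  moreover have "wreath G K \<rho> \<psi> ` carrier (pow_group K) \<subseteq> carrier (pow_group K)"
    using hom by (auto simp: hom_def)
  ultimately have "bij_betw (wreath G K \<rho> \<psi>) (carrier (pow_group K)) (carrier (pow_group K))"
    by (intro bij_betw_imageI) blast+
  moreover have "wreath G K \<rho> \<psi> \<in> extensional (carrier (pow_group K))"
    unfolding wreath_def by (rule restrict_extensional)
  ultimately show ?thesis
    using hom by (simp only: group.auto_iff[OF group_pow_group])
qed

lemma twisted_conj_wreath:
  assumes "\<rho> ` K \<subseteq> K" "\<And>j. j \<in> K \<Longrightarrow> \<psi> j \<in> hom G G"
  shows "(a, b) \<in> twisted_conj (pow_group K) (wreath G K \<rho> \<psi>) \<longleftrightarrow>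
    a \<in> carrier (pow_group K) \<and> b \<in> carrier (pow_group K) \<and>
    (\<exists>c\<in>carrier (pow_group K). \<forall>j\<in>K. a j = c j \<otimes> b j \<otimes> inv (\<psi> j (c (\<rho> j))))"
proof -
  have "a = c \<otimes>\<^bsub>pow_group K\<^esub> b \<otimes>\<^bsub>pow_group K\<^esub> inv\<^bsub>pow_group K\<^esub> (wreath G K \<rho> \<psi> c)
     \<longleftrightarrow> (\<forall>j\<in>K. a j = c j \<otimes> b j \<otimes> inv (\<psi> j (c (\<rho> j))))"
    if "a \<in> carrier (pow_group K)" "b \<in> carrier (pow_group K)" "c \<in> carrier (pow_group K)"
  for c
  proof -
    have w: "wreath G K \<rho> \<psi> c \<in> carrier (pow_group K)"
      using hom_carrier[OF wreath_hom[OF assms(1), where \<psi> = \<psi>]] assms(2) that by blast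
    then have i: "inv\<^bsub>pow_group K\<^esub> (wreath G K \<rho> \<psi> c) = (\<lambda>j\<in>K. inv (\<psi> j (c (\<rho> j))))"
      using that by (subst inv_product_group) (auto simp: group_axioms wreath_def intro!: restrict_ext)
    have "a \<in> extensional K" using that by (simp add: PiE_iff)
    then show ?thesis unfolding i
      by (auto simp: fun_eq_iff extensional_def)
  qed
  then show ?thesis unfolding twisted_conj_def by blast
qed

text \<open>Contracting an index \<open>j\<close> with \<open>\<rho> j \<noteq> j\<close>: every class has a representative that is trivial
  at \<open>j\<close>, and keeping it trivial ties the conjugator at \<open>j\<close> to the one at \<open>\<rho> j\<close>.\<close>

lemma reidemeister_wreath_contract:
  assumes \<rho>: "\<rho> ` K \<subseteq> K" and \<psi>: "\<And>i. i \<in> K \<Longrightarrow> \<psi> i \<in> hom G G" and j: "j \<in> K" "\<rho> j \<noteq> j"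
  shows "reidemeister (pow_group K) (wreath G K \<rho> \<psi>) =
    reidemeister (pow_group (K - {j}))
      (wreath G (K - {j}) (\<lambda>i. if \<rho> i = j then \<rho> j else \<rho> i)
         (\<lambda>i. if \<rho> i = j then \<psi> i \<circ> \<psi> j else \<psi> i))"
proof -
  define K' where "K' = K - {j}"
  define \<rho>' where "\<rho>' = (\<lambda>i. if \<rho> i = j then \<rho> j else \<rho> i)"
  define \<psi>' where "\<psi>' = (\<lambda>i. if \<rho> i = j then \<psi> i \<circ> \<psi> j else \<psi> i)"
  have \<rho>': "\<rho>' ` K' \<subseteq> K'" using \<rho> j by (auto simp: \<rho>'_def K'_def)
  have \<psi>': "\<psi>' i \<in> hom G G" if "i \<in> K'" for i
    using that \<psi> j Group.hom_compose[where f = "\<psi> j" and G = G and H = G and I = G] by (simp add: \<psi>'_def K'_def)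
  have \<psi>c: "\<psi> i x \<in> carrier G" if "i \<in> K" "x \<in> carrier G" for i x
    using \<psi>[OF that(1)] that by (auto simp: hom_def)
  have rc: "\<rho> i \<in> K" if "i \<in> K" for i using \<rho> that by auto
  define T where "T = {a \<in> carrier (pow_group K). a j = \<one>}"
  let ?r = "twisted_conj (pow_group K) (wreath G K \<rho> \<psi>)"
  let ?s = "twisted_conj (pow_group K') (wreath G K' \<rho>' \<psi>')"
  have tw: "(a, b) \<in> ?r \<longleftrightarrow> a \<in> carrier (pow_group K) \<and> b \<in> carrier (pow_group K) \<and>
      (\<exists>c\<in>carrier (pow_group K). \<forall>j\<in>K. a j = c j \<otimes> b j \<otimes> inv (\<psi> j (c (\<rho> j))))" for a b
    by (rule twisted_conj_wreath) (use \<rho> \<psi> in auto)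
  have tw': "(a, b) \<in> ?s \<longleftrightarrow> a \<in> carrier (pow_group K') \<and> b \<in> carrier (pow_group K') \<and>
      (\<exists>c\<in>carrier (pow_group K'). \<forall>j\<in>K'. a j = c j \<otimes> b j \<otimes> inv (\<psi>' j (c (\<rho>' j))))" for a b
    by (rule twisted_conj_wreath) (use \<rho>' \<psi>' in auto)
  have one: "\<psi> i \<one> = \<one>" if "i \<in> K" for i using hom_one[OF \<psi>[OF that]] group_axioms by blast
  have "ecard (carrier (pow_group K) // ?r) = ecard (carrier (pow_group K') // ?s)"
  proof (rule ecard_quotient_eq[where T = T and f = "\<lambda>a. restrict a K'"])
    show "equiv (carrier (pow_group K)) ?r"
      by (rule group.twisted_conj_equiv[OF group_pow_group wreath_hom[OF \<rho> \<psi>]])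
    show s: "equiv (carrier (pow_group K')) ?s"
      by (rule group.twisted_conj_equiv[OF group_pow_group wreath_hom[OF \<rho>' \<psi>']])
    show "T \<subseteq> carrier (pow_group K)" by (auto simp: T_def)
    show "(\<lambda>a. restrict a K') ` T \<subseteq> carrier (pow_group K')"
      unfolding T_def K'_def by (intro image_subsetI) (simp add: PiE_def Pi_def)
    show "\<exists>t\<in>T. (a, t) \<in> ?r" if a: "a \<in> carrier (pow_group K)" for a
    proof -
      \<comment> \<open>Conjugating by \<open>a j\<close> at the single index \<open>j\<close>
        clears coordinate \<open>j\<close>: since \<open>\<rho> j \<noteq> j\<close>, the twisting
        term there is \<open>\<psi> j \<one> = \<one>\<close>.\<close>
      define c where "c = (\<lambda>i\<in>K. if i = j then a j else \<one>)"
      define t where "t = (\<lambda>i\<in>K. inv (c i) \<otimes> a i \<otimes> \<psi> i (c (\<rho> i)))"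
      have ac: "a i \<in> carrier G" if "i \<in> K" for i using a that by auto
      have c: "c i \<in> carrier G" if "i \<in> K" for i using ac that by (auto simp: c_def)
      have t: "t \<in> T" using c ac rc \<psi>c j one by (auto simp: T_def t_def c_def)
      moreover have "a i = c i \<otimes> t i \<otimes> inv (\<psi> i (c (\<rho> i)))" if "i \<in> K" for i
        using that c ac rc \<psi>c by (simp add: t_def m_assoc inv_solve_left')
          (simp add: m_assoc[symmetric])
      moreover have "c \<in> carrier (pow_group K)" using c by (auto simp: c_def)
      moreover have "t \<in> carrier (pow_group K)" using t by (simp add: T_def)
      ultimately show ?thesis
        using a tw[of a t] by blast
    qed
    show "\<exists>t\<in>T. (b, restrict t K') \<in> ?s" if b: "b \<in> carrier (pow_group K')" for b
    proof -
      define t where "t = (\<lambda>i\<in>K. if i = j then \<one> else b i)"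
      have "b i \<in> carrier G" if "i \<in> K" "i \<noteq> j" for i using b that by (auto simp: K'_def)
      then have "t \<in> T" using j by (simp add: T_def t_def)
      moreover have "restrict t K' = b" using b by (auto simp: t_def K'_def PiE_iff extensional_def)
      ultimately show ?thesis using s b by (metis equiv_class_self Image_singleton_iff)
    qed
    fix t u assume t: "t \<in> T" and u: "u \<in> T"
    have tc: "t i \<in> carrier G" "u i \<in> carrier G" if "i \<in> K" for i using t u that by (auto simp: T_def)
    show "(t, u) \<in> ?r \<longleftrightarrow> (restrict t K', restrict u K') \<in> ?s"
    proof
      assume tu: "(t, u) \<in> ?r"
      obtain c where c: "c \<in> carrier (pow_group K)"
        "\<And>i. i \<in> K \<Longrightarrow> t i = c i \<otimes> u i \<otimes> inv (\<psi> i (c (\<rho> i)))"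
        using tw[THEN iffD1, OF tu] by blast
      have cc: "c i \<in> carrier G" if "i \<in> K" for i using c(1) that by auto
      have "\<one> = c j \<otimes> \<one> \<otimes> inv (\<psi> j (c (\<rho> j)))" using c(2)[OF j(1)] t u by (simp add: T_def)
      \<comment> \<open>An index \<open>i\<close> with \<open>\<rho> i = j\<close> now reads
        \<open>\<psi> j (c (\<rho> j))\<close>, which is the origin of the composition in
        \<open>\<psi>'\<close>.\<close>
      then have cj: "c j = \<psi> j (c (\<rho> j))"
        using cc j rc \<psi>c by (metis inv_closed inv_equality inv_inv r_one)
      have "t i = c i \<otimes> u i \<otimes> inv (\<psi>' i (c (\<rho>' i)))" if "i \<in> K'" for i
      proof (cases "\<rho> i = j")
        case True
        have "t i = c i \<otimes> u i \<otimes> inv (\<psi> i (c j))" using c(2)[of i] that True by (simp add: K'_def)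
        also note cj
        finally show ?thesis using True by (simp add: \<psi>'_def \<rho>'_def)
      next
        case False
        then show ?thesis using c(2)[of i] that by (simp add: \<psi>'_def \<rho>'_def K'_def)
      qed
      moreover have "restrict c K' \<in> carrier (pow_group K')" using cc by (auto simp: K'_def)
      ultimately show "(restrict t K', restrict u K') \<in> ?s"
        using tc \<rho>' unfolding tw'
        by (intro conjI bexI[of _ "restrict c K'"]) (auto simp: image_subset_iff K'_def)
    next
      assume tu: "(restrict t K', restrict u K') \<in> ?s"
      obtain d where d: "d \<in> carrier (pow_group K')"
        "\<And>i. i \<in> K' \<Longrightarrow> restrict t K' i = d i \<otimes> restrict u K' i \<otimes> inv (\<psi>' i (d (\<rho>' i)))"
        using tw'[THEN iffD1, OF tu] by blast
      have dc: "d i \<in> carrier G" if "i \<in> K'" for i using d(1) that by auto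
      \<comment> \<open>The only extension of \<open>d\<close> that keeps coordinate
        \<open>j\<close> trivial.\<close>
      define c where "c = (\<lambda>i\<in>K. if i = j then \<psi> j (d (\<rho> j)) else d i)"
      have rj: "\<rho> j \<in> K'" using rc j by (auto simp: K'_def)
      have cc: "c i \<in> carrier G" if "i \<in> K" for i using that dc \<psi>c j rj by (auto simp: c_def K'_def)
      have "t i = c i \<otimes> u i \<otimes> inv (\<psi> i (c (\<rho> i)))" if i: "i \<in> K" for i
      proof (cases "i = j")
        case True
        then show ?thesis using t u cc[OF j(1)] j rc by (auto simp: T_def c_def)
      next
        case False
        then have "i \<in> K'" using i by (simp add: K'_def)
        then show ?thesis using d(2)[of i] i False rc j by (auto simp: c_def \<psi>'_def \<rho>'_def)
      qed
      moreover have "c \<in> carrier (pow_group K)" using cc by (auto simp: c_def)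
      ultimately show "(t, u) \<in> ?r" using t u unfolding tw T_def by blast
    qed
  qed
  then show ?thesis by (simp add: reidemeister_ecard K'_def \<rho>'_def \<psi>'_def)
qed

text \<open>Twisted conjugacy is tested coordinate by coordinate, so a class of the power is a tuple
  of classes. Contraction controls \<open>\<rho>\<close> on \<open>K\<close> only, hence the
  pointwise hypothesis.\<close>

lemma reidemeister_wreath_diagonal:
  assumes K: "finite K" and \<psi>: "\<And>i. i \<in> K \<Longrightarrow> \<psi> i \<in> hom G G" and \<rho>: "\<And>i. i \<in> K \<Longrightarrow> \<rho> i = i"
  shows "reidemeister (pow_group K) (wreath G K \<rho> \<psi>) = (\<Prod>i\<in>K. reidemeister G (\<psi> i))"
proof -
  let ?r = "twisted_conj (pow_group K) (wreath G K \<rho> \<psi>)"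
  let ?s = "\<lambda>i. twisted_conj G (\<psi> i)"
  define h where "h g = (\<lambda>i\<in>K. ?s i `` {g i})" for g
  have \<rho>K: "\<rho> ` K \<subseteq> K" using \<rho> by auto
  have eqr: "equiv (carrier (pow_group K)) ?r"
    by (rule group.twisted_conj_equiv[OF group_pow_group wreath_hom[OF \<rho>K \<psi>]])
  have eqs: "equiv (carrier G) (?s i)" if "i \<in> K" for i
    using twisted_conj_equiv \<psi> that by blast
  have rel: "(a, b) \<in> ?r \<longleftrightarrow> h a = h b" if ab: "a \<in> carrier (pow_group K)" "b \<in> carrier (pow_group K)" for a b
  proof -
    have abc: "a i \<in> carrier G" "b i \<in> carrier G" if "i \<in> K" for i using ab that by auto
    have "(a, b) \<in> ?r \<longleftrightarrow> (\<exists>c\<in>carrier (pow_group K). \<forall>i\<in>K. a i = c i \<otimes> b i \<otimes> inv (\<psi> i (c i)))"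
      using twisted_conj_wreath[of \<rho> K \<psi> a b] \<rho>K \<psi> ab \<rho> by simp
    also have "\<dots> \<longleftrightarrow> (\<forall>i\<in>K. \<exists>c\<in>carrier G. a i = c \<otimes> b i \<otimes> inv (\<psi> i c))"
    proof
      assume "\<forall>i\<in>K. \<exists>c\<in>carrier G. a i = c \<otimes> b i \<otimes> inv (\<psi> i c)"
      then obtain c where "\<forall>i\<in>K. c i \<in> carrier G \<and> a i = c i \<otimes> b i \<otimes> inv (\<psi> i (c i))" by metis
      then show "\<exists>c\<in>carrier (pow_group K). \<forall>i\<in>K. a i = c i \<otimes> b i \<otimes> inv (\<psi> i (c i))"
        by (intro bexI[of _ "restrict c K"]) auto
    qed auto
    also have "\<dots> \<longleftrightarrow> (\<forall>i\<in>K. (a i, b i) \<in> ?s i)" using abc by (auto simp: twisted_conj_def)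
    also have "\<dots> \<longleftrightarrow> (\<forall>i\<in>K. ?s i `` {a i} = ?s i `` {b i})"
      using eq_equiv_class_iff[OF eqs] abc by (simp cong: ball_cong_simp)
    also have "\<dots> \<longleftrightarrow> h a = h b" by (auto simp: h_def fun_eq_iff)
    finally show ?thesis .
  qed
  have him: "h ` carrier (pow_group K) = (\<Pi>\<^sub>E i\<in>K. carrier G // ?s i)"
  proof
    show "h ` carrier (pow_group K) \<subseteq> (\<Pi>\<^sub>E i\<in>K. carrier G // ?s i)"
      by (auto simp: h_def intro!: quotientI)
    show "(\<Pi>\<^sub>E i\<in>K. carrier G // ?s i) \<subseteq> h ` carrier (pow_group K)"
    proof
      fix f assume f: "f \<in> (\<Pi>\<^sub>E i\<in>K. carrier G // ?s i)"
      then have "\<forall>i\<in>K. \<exists>x\<in>carrier G. f i = ?s i `` {x}" by (auto simp: PiE_iff quotient_def)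
      then obtain x where x: "\<forall>i\<in>K. x i \<in> carrier G \<and> f i = ?s i `` {x i}" by metis
      then have "f = h (restrict x K)" using f by (intro ext) (auto simp: h_def PiE_iff extensional_def)
      then show "f \<in> h ` carrier (pow_group K)" using x by (auto intro!: image_eqI[of _ _ "restrict x K"])
    qed
  qed
  \<comment> \<open>\<open>h\<close> is constant on classes, so the described value exists and is
    unique.\<close>
  define F where "F = (\<lambda>C. THE y. \<exists>a\<in>C. y = h a)"
  have F: "F (?r `` {a}) = h a" if a: "a \<in> carrier (pow_group K)" for a
    unfolding F_def
  proof (rule the_equality)
    show "\<exists>b\<in>?r `` {a}. h a = h b" using equiv_class_self[OF eqr a] by blast
    fix y assume "\<exists>b\<in>?r `` {a}. y = h b"
    then obtain b where "(a, b) \<in> ?r" "y = h b" by blast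
    moreover have "b \<in> carrier (pow_group K)" using calculation by (auto simp: twisted_conj_def)
    ultimately show "y = h a" using rel a by metis
  qed
  have "bij_betw F (carrier (pow_group K) // ?r) (\<Pi>\<^sub>E i\<in>K. carrier G // ?s i)"
  proof (rule bij_betw_imageI)
    show "inj_on F (carrier (pow_group K) // ?r)"
    proof (rule inj_onI)
      fix C D assume "C \<in> carrier (pow_group K) // ?r" "D \<in> carrier (pow_group K) // ?r" "F C = F D"
      then obtain a b where "a \<in> carrier (pow_group K)" "b \<in> carrier (pow_group K)"
        "C = ?r `` {a}" "D = ?r `` {b}" by (metis quotientE)
      then show "C = D" using F rel equiv_class_eq[OF eqr] \<open>F C = F D\<close> by metis
    qed
    have "F ` (carrier (pow_group K) // ?r) = h ` carrier (pow_group K)"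
      unfolding quotient_def using F by (auto simp: image_iff)
    then show "F ` (carrier (pow_group K) // ?r) = (\<Pi>\<^sub>E i\<in>K. carrier G // ?s i)" using him by simp
  qed
  then have "ecard (carrier (pow_group K) // ?r) = ecard (\<Pi>\<^sub>E i\<in>K. carrier G // ?s i)"
    by (rule ecard_bij_betw)
  also have "\<dots> = (\<Prod>i\<in>K. ecard (carrier G // ?s i))"
    by (rule ecard_PiE[OF K]) (auto simp: quotient_def)
  finally show ?thesis by (simp add: reidemeister_ecard)
qed

lemma reidemeister_cong:
  assumes "\<And>x. x \<in> carrier G \<Longrightarrow> \<phi> x = \<psi> x"
  shows "reidemeister G \<phi> = reidemeister G \<psi>"
  using assms unfolding reidemeister_def twisted_conj_def by (simp cong: bex_cong_simp)

text \<open>Contraction composes the \<open>\<psi> i\<close> and so leaves the extensional maps;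
  restricting to the carrier returns to \<open>auto G\<close> without changing the classes.\<close>

lemma reidemeister_in_spec_R:
  assumes "\<phi> \<in> iso G G" shows "reidemeister G \<phi> \<in> spec_R G"
proof -
  have "restrict \<phi> (carrier G) \<in> auto G"
    using assms by (auto simp: auto_iff iso_def hom_def cong: bij_betw_cong)
  moreover have "reidemeister G \<phi> = reidemeister G (restrict \<phi> (carrier G))"
    by (rule reidemeister_cong) simp
  ultimately show ?thesis unfolding spec_R_def by blast
qed

lemma wreath_cong:
  assumes "\<And>j. j \<in> K \<Longrightarrow> \<rho> j = \<rho>' j" "\<rho> ` K \<subseteq> K"
    "\<And>j x. j \<in> K \<Longrightarrow> x \<in> carrier G \<Longrightarrow> \<psi> j x = \<psi>' j x"
  shows "wreath G K \<rho> \<psi> = wreath G K \<rho>' \<psi>'"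
proof -
  have "\<psi> j (g (\<rho> j)) = \<psi>' j (g (\<rho>' j))" if "g \<in> carrier (pow_group K)" "j \<in> K" for g j
    using that assms(1,3)[OF that(2)] assms(2) by (metis PiE_mem carrier_product_group image_subset_iff)
  then show ?thesis unfolding wreath_def by (auto intro!: restrict_ext)
qed

text \<open>Contraction is repeated until \<open>\<rho>\<close> fixes every remaining index. For a
  permutation, \<open>L\<close> retains one index of each cycle and \<open>R i\<close> belongs to
  the return map there. Nonemptiness of \<open>L\<close> will give the lower bound 1 for the number
  of factors.\<close>

lemma reidemeister_wreath_prod:
  assumes "finite K" "K \<noteq> {}" "\<rho> ` K \<subseteq> K" "\<And>i. i \<in> K \<Longrightarrow> \<psi> i \<in> iso G G"
  shows "\<exists>L R. L \<subseteq> K \<and> L \<noteq> {} \<and> (\<forall>i\<in>L. R i \<in> spec_R G) \<and>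
    reidemeister (pow_group K) (wreath G K \<rho> \<psi>) = (\<Prod>i\<in>L. R i)"
  using assms
proof (induction "card K" arbitrary: K \<rho> \<psi> rule: less_induct)
  case less
  have hom: "\<psi> i \<in> hom G G" if "i \<in> K" for i using less.prems(4)[OF that] by (simp add: iso_def)
  show ?case
  proof (cases "\<forall>i\<in>K. \<rho> i = i")
    case True
    then have "reidemeister (pow_group K) (wreath G K \<rho> \<psi>) = (\<Prod>i\<in>K. reidemeister G (\<psi> i))"
      using reidemeister_wreath_diagonal[OF \<open>finite K\<close> hom] by auto
    moreover have "\<forall>i\<in>K. reidemeister G (\<psi> i) \<in> spec_R G"
      using reidemeister_in_spec_R less.prems by auto
    ultimately show ?thesis using less.prems(2)
      by (intro exI[of _ K] exI[of _ "\<lambda>i. reidemeister G (\<psi> i)"]) auto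
  next
    case False
    then obtain j where j: "j \<in> K" "\<rho> j \<noteq> j" by blast
    define K' where "K' = K - {j}"
    define \<rho>' where "\<rho>' = (\<lambda>i. if \<rho> i = j then \<rho> j else \<rho> i)"
    define \<psi>' where "\<psi>' = (\<lambda>i. if \<rho> i = j then \<psi> i \<circ> \<psi> j else \<psi> i)"
    have "card K' < card K" unfolding K'_def using j less.prems(1) by (metis card_Diff1_less)
    moreover have "\<rho> j \<in> K'" using j less.prems(3) by (auto simp: K'_def)
    moreover have "\<rho>' ` K' \<subseteq> K'" using less.prems(3) j by (auto simp: \<rho>'_def K'_def)
    moreover have "\<psi>' i \<in> iso G G" if "i \<in> K'" for i
      using that less.prems(4) j iso_set_trans[of _ G G _ G] by (simp add: \<psi>'_def K'_def)
    moreover have "finite K'" using less.prems(1) by (simp add: K'_def)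
    ultimately obtain L R where LR: "L \<subseteq> K'" "L \<noteq> {}" "\<forall>i\<in>L. R i \<in> spec_R G"
      "reidemeister (pow_group K') (wreath G K' \<rho>' \<psi>') = (\<Prod>i\<in>L. R i)"
      using less.hyps[of K' \<rho>' \<psi>'] by blast
    moreover have "reidemeister (pow_group K) (wreath G K \<rho> \<psi>) =
        reidemeister (pow_group K') (wreath G K' \<rho>' \<psi>')"
      unfolding K'_def \<rho>'_def \<psi>'_def
      by (rule reidemeister_wreath_contract[OF less.prems(3) hom j])
    ultimately show ?thesis by (intro exI[of _ L] exI[of _ R]) (auto simp: K'_def)
  qed
qed

lemma reidemeister_wreath_prod_interval:
  assumes "\<rho> ` {1..k} \<subseteq> {1..k}" "\<And>i. i \<in> {1..k} \<Longrightarrow> \<psi> i \<in> iso G G" "k \<ge> 1"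
  shows "reidemeister (pow_group {1..k}) (wreath G {1..k::nat} \<rho> \<psi>) \<in>
    (\<Union>i\<in>{1..k}. {(\<Prod>m\<in>{1..i}. R m) | R. \<forall>m\<in>{1..i}. R m \<in> spec_R G})"
proof -
  obtain L R where L: "L \<subseteq> {1..k}" "L \<noteq> {}" "\<forall>i\<in>L. R i \<in> spec_R G"
    and e: "reidemeister (pow_group {1..k}) (wreath G {1..k} \<rho> \<psi>) = (\<Prod>i\<in>L. R i)"
    using reidemeister_wreath_prod[of "{1..k}" \<rho> \<psi>] assms by auto
  have fin: "finite L" using L finite_subset by blast
  obtain f where f: "bij_betw f {1..card L} L"
    using ex_bij_betw_nat_finite_1[OF fin] by blast
  have "(\<Prod>i\<in>L. R i) = (\<Prod>m\<in>{1..card L}. R (f m))"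
    using prod.reindex_bij_betw[OF f, of R] by simp
  moreover have "card L \<in> {1..k}"
    using L fin card_mono[of "{1..k}" L] by (auto simp: Suc_le_eq card_gt_0_iff)
  moreover have "\<forall>m\<in>{1..card L}. R (f m) \<in> spec_R G" using L(3) f by (auto simp: bij_betw_def)
  ultimately show ?thesis unfolding e by (intro UN_I[of "card L"]) auto
qed

text \<open>Contracting the indices from \<open>k\<close> down to \<open>i + 1\<close> composes only
  with identities; at \<open>k = i\<close> the permutation is the identity on
  \<open>{1..i}\<close>.\<close>

lemma reidemeister_tail_cycle:
  assumes i: "1 \<le> i" "i \<le> k" and "\<And>m. m \<in> {1..i} \<Longrightarrow> \<psi> m \<in> hom G G"
    and "\<And>m. m > i \<Longrightarrow> \<psi> m = id"
  shows "reidemeister (pow_group {1..k}) (wreath G {1..k} (tail_cycle i k) \<psi>) =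
    (\<Prod>m\<in>{1..i}. reidemeister G (\<psi> m))"
  using i(2)
proof (induction k rule: dec_induct)
  case base
  show ?case
    by (rule reidemeister_wreath_diagonal) (use assms in \<open>auto simp: tail_cycle_def\<close>)
next
  case (step k)
  have hom: "\<psi> m \<in> hom G G" if "m \<in> {1..Suc k}" for m
    using assms(3)[of m] assms(4)[of m] that by (cases "m \<le> i") (auto simp: hom_def)
  have K: "{1..Suc k} - {Suc k} = {1..k}" by auto
  have "reidemeister (pow_group {1..Suc k}) (wreath G {1..Suc k} (tail_cycle i (Suc k)) \<psi>) =
      reidemeister (pow_group {1..k}) (wreath G {1..k}
        (\<lambda>l. if tail_cycle i (Suc k) l = Suc k then tail_cycle i (Suc k) (Suc k) else tail_cycle i (Suc k) l)
        (\<lambda>l. if tail_cycle i (Suc k) l = Suc k then \<psi> l \<circ> \<psi> (Suc k) else \<psi> l))"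
    using reidemeister_wreath_contract[of "tail_cycle i (Suc k)" "{1..Suc k}" \<psi> "Suc k"]
      tail_cycle_bij[of i "Suc k"] hom step i unfolding K
    by (simp add: bij_betw_def) (simp add: tail_cycle_def)
  also have "wreath G {1..k}
        (\<lambda>l. if tail_cycle i (Suc k) l = Suc k then tail_cycle i (Suc k) (Suc k) else tail_cycle i (Suc k) l)
        (\<lambda>l. if tail_cycle i (Suc k) l = Suc k then \<psi> l \<circ> \<psi> (Suc k) else \<psi> l) =
      wreath G {1..k} (tail_cycle i k) \<psi>"
    using step i assms(4)[of "Suc k"] by (intro wreath_cong) (auto simp: tail_cycle_def)
  finally show ?case using step by simp
qed

lemma prod_in_spec_R_pow_group:
  fixes i k :: nat
  assumes "1 \<le> i" "i \<le> k" "\<forall>m\<in>{1..i}. R m \<in> spec_R G"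
  shows "(\<Prod>m\<in>{1..i}. R m) \<in> spec_R (pow_group {1..k})"
proof -
  have "\<forall>m\<in>{1..i}. \<exists>\<phi>. \<phi> \<in> auto G \<and> R m = reidemeister G \<phi>"
    using assms(3) by (auto simp: spec_R_def)
  then obtain \<phi> where \<phi>: "\<forall>m\<in>{1..i}. \<phi> m \<in> auto G \<and> R m = reidemeister G (\<phi> m)" by metis
  \<comment> \<open>The cycle through \<open>i\<close> carries \<open>\<phi> i\<close> once and
    identities elsewhere, so its return map is \<open>\<phi> i\<close>.\<close>
  define \<psi> where "\<psi> m = (if m \<le> i then \<phi> m else id)" for m
  have iso: "\<psi> m \<in> iso G G" if "m \<in> {1..k}" for m
    using \<phi> that id_iso by (auto simp: \<psi>_def auto_iff iso_def id_def)
  have "wreath G {1..k} (tail_cycle i k) \<psi> \<in> auto (pow_group {1..k})"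
    using wreath_auto[OF tail_cycle_bij[OF assms(1,2)] iso] .
  moreover have "reidemeister (pow_group {1..k}) (wreath G {1..k} (tail_cycle i k) \<psi>) =
      (\<Prod>m\<in>{1..i}. reidemeister G (\<psi> m))"
  proof (rule reidemeister_tail_cycle[OF assms(1,2)])
    show "\<psi> m \<in> hom G G" if "m \<in> {1..i}" for m
      using iso[of m] that assms(2) by (simp add: iso_def)
  qed (simp add: \<psi>_def)
  moreover have "\<dots> = (\<Prod>m\<in>{1..i}. R m)"
    using \<phi> by (intro prod.cong) (auto simp: \<psi>_def)
  ultimately show ?thesis unfolding spec_R_def by (metis image_eqI)
qed

end

section \<open>Endomorphisms of free abelian groups with finite cokernel\<close>

text \<open>Finite cokernel makes \<open>L\<close> surjective, hence injective, modulo any \<open>p\<close> prime to the index;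
  a kernel vector is then divisible by \<open>p\<close>, and \<open>p\<close> is chosen larger than its entries.\<close>

lemma int_endomorphism_injective:
  fixes L :: "('j \<Rightarrow> int) \<Rightarrow> 'j \<Rightarrow> int"
  assumes J: "finite J"
    and add: "\<And>u v j. j \<in> J \<Longrightarrow> L (\<lambda>i. u i + v i) j = L u j + L v j"
    and cong: "\<And>u v j. j \<in> J \<Longrightarrow> (\<And>i. i \<in> J \<Longrightarrow> u i = v i) \<Longrightarrow> L u j = L v j"
    and tors: "\<And>j. j \<in> J \<Longrightarrow> \<exists>m u. m \<noteq> 0 \<and> (\<forall>i\<in>J. L u i = (if i = j then m else 0))"
    and ker: "\<And>j. j \<in> J \<Longrightarrow> L w j = 0" and j: "j \<in> J"
  shows "w j = 0"
proof -
  have L0: "L (\<lambda>_. 0) j = 0" if "j \<in> J" for j using add[OF that, of "\<lambda>_. 0" "\<lambda>_. 0"] by simp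
  have Lneg: "L (\<lambda>i. - u i) j = - L u j" if "j \<in> J" for u j
    using add[OF that, of u "\<lambda>i. - u i"] L0[OF that] by simp
  have Lnat: "L (\<lambda>i. int n * u i) j = int n * L u j" if "j \<in> J" for u n j
    by (induction n) (simp_all add: L0[OF that] add[OF that] ring_distribs)
  have Lmult: "L (\<lambda>i. c * u i) j = c * L u j" if "j \<in> J" for c u j
    using Lnat[OF that, of "nat \<bar>c\<bar>" u] Lneg[OF that, of "\<lambda>i. int (nat \<bar>c\<bar>) * u i"]
    by (cases "c \<ge> 0") auto
  have Lsum: "L (\<lambda>i. \<Sum>k\<in>F. u k i) j = (\<Sum>k\<in>F. L (u k) j)" if "j \<in> J" "finite F" for u j and F :: "'j set"
    using that(2) by (induction F rule: finite_induct) (simp_all add: L0[OF that(1)] add[OF that(1)])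
  obtain m u where mu: "\<And>j. j \<in> J \<Longrightarrow> m j \<noteq> 0"
    "\<And>j i. j \<in> J \<Longrightarrow> i \<in> J \<Longrightarrow> L (u j) i = (if i = j then m j else 0)"
    using tors by metis
  \<comment> \<open>\<open>P\<close> annihilates the cokernel, since every \<open>m j\<close>
    divides it, and \<open>B\<close> exceeds every \<open>\<bar>w j\<bar>\<close>. With
    \<open>p = 1 + P * P * B\<close> the number \<open>- P * B\<close> is inverse to
    \<open>P\<close> modulo \<open>p\<close>; the square makes \<open>p > B\<close> for either sign
    of \<open>P\<close>.\<close>
  define P where "P = (\<Prod>j\<in>J. m j)"
  define B where "B = 1 + (\<Sum>j\<in>J. \<bar>w j\<bar>)"
  define p where "p = 1 + P * P * B"
  have P0: "P \<noteq> 0" using mu J by (simp add: P_def)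
  have B: "\<bar>w j\<bar> < B" if "j \<in> J" for j
    using member_le_sum[OF that, of "\<lambda>j. \<bar>w j\<bar>"] J by (simp add: B_def)
  have "B \<ge> 1" by (simp add: B_def sum_nonneg)
  moreover have "P * P \<ge> 1" using P0 by (metis linorder_not_less not_square_less_zero int_one_le_iff_zero_less mult_eq_0_iff order_le_less)
  ultimately have "1 * B \<le> P * P * B" by (intro mult_right_mono) auto
  then have pB: "p > B" unfolding p_def by simp
  have p0: "p > 0" using pB \<open>B \<ge> 1\<close> by simp
  define A where "A = (\<Pi>\<^sub>E i\<in>J. {0..<p})"
  define f where "f v = (\<lambda>i\<in>J. L v i mod p)" for v
  \<comment> \<open>\<open>L\<close> respects congruence modulo \<open>p\<close>, so
    \<open>f\<close> is its reduction to a self-map of the finite set \<open>A\<close> of residue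
    vectors. There, surjective implies injective.\<close>
  have red: "L (\<lambda>i\<in>J. v i mod p) i mod p = L v i mod p" if i: "i \<in> J" for v i
  proof -
    have "L v i = L (\<lambda>k. (\<lambda>i\<in>J. v i mod p) k + p * (v k div p)) i"
      by (rule cong[OF i]) simp
    also have "\<dots> = L (\<lambda>i\<in>J. v i mod p) i + p * L (\<lambda>k. v k div p) i"
      by (simp only: add[OF i] Lmult[OF i])
    finally show ?thesis by simp
  qed
  have A: "(\<lambda>i\<in>J. v i mod p) \<in> A" for v using p0 by (auto simp: A_def)
  have "A \<subseteq> f ` A"
  proof
    fix t assume t: "t \<in> A"
    \<comment> \<open>\<open>L (u j)\<close> is \<open>m j\<close> times a unit vector, so this
      combination is sent to \<open>- P * P * B * t\<close>, which is
      \<open>t - p * t\<close>.\<close>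
    define v where "v k = (\<Sum>j\<in>J. (- (P div m j) * P * B * t j) * u j k)" for k
    have "L v i mod p = t i" if i: "i \<in> J" for i
    proof -
      have "L v i = (\<Sum>j\<in>J. (- (P div m j) * P * B * t j) * L (u j) i)"
        unfolding v_def by (simp only: Lsum[OF i J] Lmult[OF i])
      also have "\<dots> = (\<Sum>j\<in>J. if j = i then (- (P div m i) * P * B * t i) * m i else 0)"
        using mu(2) i by (intro sum.cong) auto
      also have "\<dots> = (- (P div m i) * P * B * t i) * m i" using i J by simp
      also have "\<dots> = - ((P div m i) * m i) * P * B * t i" by (simp add: algebra_simps)
      also have "(P div m i) * m i = P" using i J by (simp add: P_def dvd_prodI)
      also have "- P * P * B * t i = t i - p * t i" by (simp add: p_def algebra_simps)
      finally have "L v i mod p = t i mod p" by (simp add: mod_diff_right_eq[symmetric])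
      then show ?thesis using t i by (auto simp: A_def PiE_iff)
    qed
    then have "f (\<lambda>i\<in>J. v i mod p) = t"
      using t by (auto simp: f_def red A_def PiE_iff extensional_def fun_eq_iff)
    then show "t \<in> f ` A" using A by blast
  qed
  moreover have "f ` A \<subseteq> A" using p0 by (auto simp: f_def A_def)
  ultimately have "f ` A = A" by blast
  moreover have "finite A" using J by (simp add: A_def finite_PiE)
  ultimately have inj: "inj_on f A" by (simp add: eq_card_imp_inj_on)
  have "f (\<lambda>i\<in>J. w i mod p) = f (\<lambda>i\<in>J. (\<lambda>_. 0) i mod p)"
    unfolding f_def using ker L0 by (intro restrict_ext) (simp only: red)
  then have "(\<lambda>i\<in>J. w i mod p) = (\<lambda>i\<in>J. (\<lambda>_. 0) i mod p)"
    by (rule inj_onD[OF inj _ A A])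
  then have "w j mod p = 0" using j by (metis mod_0 restrict_apply')
  moreover have "\<bar>w j\<bar> < p" using B[OF j] pB by simp
  ultimately show ?thesis using zdvd_imp_le[of p "\<bar>w j\<bar>"] by (metis abs_ge_zero dvd_abs_iff
      dvd_imp_mod_0 mod_0_imp_dvd not_less order_le_less abs_eq_0_iff)
qed

section \<open>Automorphisms of powers of an indecomposable group\<close>

text \<open>What is needed of \<open>G\<^sub>\<Gamma>\<close> for an indecomposable \<open>\<Gamma>\<close>: the homomorphisms \<open>e a\<close>
  read off the exponent of the vertex \<open>a\<close>, and \<open>D\<close> is adjacency in the complement of \<open>\<Gamma>\<close>.\<close>

locale complement_connected_group = group G for G (structure) +
  fixes I :: "'v set" and D :: "'v \<Rightarrow> 'v \<Rightarrow> bool" and e :: "'v \<Rightarrow> 'a \<Rightarrow> int"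
  assumes finite_I: "finite I" and I_nonempty: "I \<noteq> {}"
    and D_irrefl: "\<not> D a a"
    and D_I: "D a b \<Longrightarrow> a \<in> I \<and> b \<in> I"
    and D_neighbour: "a \<in> I \<Longrightarrow> \<exists>b. D a b"
    and D_connected: "\<lbrakk>C \<subseteq> I; C \<noteq> {}; \<And>a b. D a b \<Longrightarrow> a \<in> C \<longleftrightarrow> b \<in> C\<rbrakk> \<Longrightarrow> C = I"
    and e_mult: "\<lbrakk>g \<in> carrier G; h \<in> carrier G\<rbrakk> \<Longrightarrow> e a (g \<otimes> h) = e a g + e a h"
    and e_surj: "\<exists>g\<in>carrier G. \<forall>a\<in>I. e a g = v a"
    and commute_iff: "\<lbrakk>g \<in> carrier G; h \<in> carrier G\<rbrakk> \<Longrightarrow>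
      g \<otimes> h = h \<otimes> g \<longleftrightarrow> (\<forall>a b. D a b \<longrightarrow> e a g * e b h = e b g * e a h)"
    and derivedI: "\<lbrakk>g \<in> carrier G; \<And>a. a \<in> I \<Longrightarrow> e a g = 0\<rbrakk> \<Longrightarrow> g \<in> derived G (carrier G)"
begin

lemma e_one: "e a \<one> = 0"
  using e_mult[of \<one> \<one> a] by simp

lemma e_inv: "g \<in> carrier G \<Longrightarrow> e a (inv g) = - e a g"
  using e_mult[of g "inv g" a] by (simp add: e_one)

text \<open>Elements with zero exponents commute with one another, so the image is abelian and every
  commutator dies. Together with \<open>derivedI\<close>, such a homomorphism kills all elements
  with zero exponents.\<close>

lemma hom_central_image_kills_derived:
  assumes f: "f \<in> hom G G" and cent: "\<And>g a. g \<in> carrier G \<Longrightarrow> a \<in> I \<Longrightarrow> e a (f g) = 0"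
    and z: "z \<in> derived G (carrier G)"
  shows "f z = \<one>"
proof -
  interpret f: group_hom G G f using f by (simp add: group_hom_def group_hom_axioms_def group_axioms)
  have comm: "f g \<otimes> f h = f h \<otimes> f g" if "g \<in> carrier G" "h \<in> carrier G" for g h
    using that cent D_I by (subst commute_iff) fastforce+
  have "z \<in> carrier G \<and> f z = \<one>"
    using z unfolding derived_def
  proof (induction rule: generate.induct)
    case (incl z)
    then obtain g h where gh: "g \<in> carrier G" "h \<in> carrier G" "z = g \<otimes> h \<otimes> inv g \<otimes> inv h" by blast
    then have "f z = f g \<otimes> f h \<otimes> inv f g \<otimes> inv f h" by simp
    also have "\<dots> = \<one>" using gh comm[of g h] by (simp add: m_assoc)
    finally show ?case using gh by simp
  next
    case (inv z)
    then obtain g h where gh: "g \<in> carrier G" "h \<in> carrier G" "z = g \<otimes> h \<otimes> inv g \<otimes> inv h" by blast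
    then have "f z = f g \<otimes> f h \<otimes> inv f g \<otimes> inv f h" by simp
    also have "\<dots> = \<one>" using gh comm[of g h] by (simp add: m_assoc)
    finally show ?case using gh by simp
  qed auto
  then show ?thesis by simp
qed

end

section \<open>The permutation of the factors that an automorphism induces modulo the centre\<close>

locale power_automorphism = complement_connected_group G I D e
  for G (structure) and I :: "'v set" and D e +
  fixes K :: "'i set" and \<phi> :: "('i \<Rightarrow> 'a) \<Rightarrow> 'i \<Rightarrow> 'a"
  assumes finite_K: "finite K"
    and iso: "\<phi> \<in> iso (product_group K (\<lambda>_. G)) (product_group K (\<lambda>_. G))"
begin

abbreviation N where "N \<equiv> pow_group K"

sublocale N: group N by simp

sublocale p: group_hom N N \<phi>
  using iso by (simp add: group_hom_def group_hom_axioms_def iso_def N.group_axioms)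

definition \<iota> :: "'i \<Rightarrow> 'a \<Rightarrow> 'i \<Rightarrow> 'a" where "\<iota> i x = (\<lambda>j\<in>K. if j = i then x else \<one>)"

text \<open>The centre of \<open>N\<close>, as \<open>central_iff_commute\<close> shows; the
  exponent form is the one used in computations.\<close>

definition central :: "('i \<Rightarrow> 'a) \<Rightarrow> bool" where
  "central g \<longleftrightarrow> g \<in> carrier N \<and> (\<forall>j\<in>K. \<forall>a\<in>I. e a (g j) = 0)"

lemma iota_carrier: "x \<in> carrier G \<Longrightarrow> \<iota> i x \<in> carrier N"
  by (simp add: \<iota>_def)

lemma comp_carrier: "g \<in> carrier N \<Longrightarrow> j \<in> K \<Longrightarrow> g j \<in> carrier G"
  by auto

lemma comp_mult: "j \<in> K \<Longrightarrow> (g \<otimes>\<^bsub>N\<^esub> h) j = g j \<otimes> h j"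
  by simp

lemma iota_mult: "\<iota> i (x \<otimes> y) = \<iota> i x \<otimes>\<^bsub>N\<^esub> \<iota> i y" if "x \<in> carrier G" "y \<in> carrier G"
  using that by (auto simp: \<iota>_def intro!: restrict_ext)

lemma iota_one: "\<iota> i \<one> = \<one>\<^bsub>N\<^esub>"
  by (auto simp: \<iota>_def intro!: restrict_ext)

text \<open>An element is the product of its coordinates, inserted one at a time. The set
  \<open>S\<close> limits the factors that occur: for a central element it can be the derived
  group.\<close>

lemma N_induct [consumes 3, case_names one mult]:
  assumes g: "g \<in> carrier N" and S: "\<And>i. i \<in> K \<Longrightarrow> g i \<in> S" "S \<subseteq> carrier G"
    and "P \<one>\<^bsub>N\<^esub>"
    and step: "\<And>i x h. \<lbrakk>i \<in> K; x \<in> S; h \<in> carrier N; P h\<rbrakk> \<Longrightarrow> P (\<iota> i x \<otimes>\<^bsub>N\<^esub> h)"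
  shows "P g"
proof -
  have "P (\<lambda>j\<in>K. if j \<in> F then g j else \<one>)" if "F \<subseteq> K" for F
    using finite_subset[OF that finite_K] that
  proof (induction F rule: finite_induct)
    case empty
    then show ?case using \<open>P \<one>\<^bsub>N\<^esub>\<close> by (simp add: restrict_def)
  next
    case (insert i F)
    let ?h = "\<lambda>j\<in>K. if j \<in> F then g j else \<one>"
    have gc: "g j \<in> carrier G" if "j \<in> K" for j using S that by auto
    have "?h \<in> carrier N" using gc by auto
    moreover have "P ?h" using insert.IH insert.prems by blast
    moreover have "i \<in> K" "g i \<in> S" using insert.prems S(1) by auto
    ultimately have "P (\<iota> i (g i) \<otimes>\<^bsub>N\<^esub> ?h)" by (intro step)
    also have "\<iota> i (g i) \<otimes>\<^bsub>N\<^esub> ?h = (\<lambda>j\<in>K. if j \<in> insert i F then g j else \<one>)"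
      using insert gc by (auto simp: \<iota>_def intro!: restrict_ext)
    finally show ?case .
  qed
  from this[OF subset_refl] have "P (\<lambda>j\<in>K. g j)" by (simp cong: restrict_cong)
  moreover have "(\<lambda>j\<in>K. g j) = g" using g by (auto simp: PiE_iff extensional_def fun_eq_iff)
  ultimately show ?thesis by simp
qed

lemma additive_zero:
  fixes l :: "('i \<Rightarrow> 'a) \<Rightarrow> int"
  assumes "\<And>g h. \<lbrakk>g \<in> carrier N; h \<in> carrier N\<rbrakk> \<Longrightarrow> l (g \<otimes>\<^bsub>N\<^esub> h) = l g + l h"
    and "\<And>i x. \<lbrakk>i \<in> K; x \<in> carrier G\<rbrakk> \<Longrightarrow> l (\<iota> i x) = 0"
    and g: "g \<in> carrier N"
  shows "l g = 0"
  using g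
proof (rule N_induct[where S = "carrier G"])
  show "g i \<in> carrier G" if "i \<in> K" for i using g that by auto
  show "l \<one>\<^bsub>N\<^esub> = 0" using assms(1)[of "\<one>\<^bsub>N\<^esub>" "\<one>\<^bsub>N\<^esub>"] by (metis N.one_closed N.l_one add_cancel_left_left)
  show "l (\<iota> i x \<otimes>\<^bsub>N\<^esub> h) = 0" if "i \<in> K" "x \<in> carrier G" "h \<in> carrier N" "l h = 0" for i x h
    using that assms(1,2) iota_carrier by simp
qed auto

lemma e_phi_mult:
  "\<lbrakk>g \<in> carrier N; h \<in> carrier N; j \<in> K\<rbrakk> \<Longrightarrow> e a (\<phi> (g \<otimes>\<^bsub>N\<^esub> h) j) = e a (\<phi> g j) + e a (\<phi> h j)"
  by (simp only: p.hom_mult comp_mult) (intro e_mult comp_carrier p.hom_closed)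

lemma phi_surj:
  assumes h: "h \<in> carrier N" shows "\<exists>g\<in>carrier N. \<phi> g = h"
proof -
  have "\<phi> ` carrier N = carrier N" using iso by (simp add: iso_def bij_betw_def del: carrier_product_group)
  then have "h \<in> \<phi> ` carrier N" using h by (simp only:)
  then obtain g where "h = \<phi> g" "g \<in> carrier N" by (rule imageE)
  then show ?thesis by (intro bexI[of _ g]) simp_all
qed

lemma phi_inj: "\<lbrakk>g \<in> carrier N; h \<in> carrier N; \<phi> g = \<phi> h\<rbrakk> \<Longrightarrow> g = h"
proof -
  have "inj_on \<phi> (carrier N)" using iso by (simp add: iso_def bij_betw_def del: carrier_product_group)
  then show "\<lbrakk>g \<in> carrier N; h \<in> carrier N; \<phi> g = \<phi> h\<rbrakk> \<Longrightarrow> g = h" by (rule inj_onD)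
qed

lemma N_section: "\<exists>g\<in>carrier N. \<forall>j\<in>K. \<forall>a\<in>I. e a (g j) = v (j, a)"
proof -
  have "\<forall>j. \<exists>g\<in>carrier G. \<forall>a\<in>I. e a g = v (j, a)" by (intro allI e_surj)
  then obtain g where "\<And>j. g j \<in> carrier G \<and> (\<forall>a\<in>I. e a (g j) = v (j, a))" by metis
  then show ?thesis by (intro bexI[of _ "restrict g K"]) auto
qed

text \<open>Commutation with all of \<open>N\<close> is visibly preserved by automorphisms,
  vanishing of exponents is not; the equivalence transfers the invariance.\<close>

lemma central_iff_commute:
  assumes g: "g \<in> carrier N"
  shows "central g \<longleftrightarrow> (\<forall>h\<in>carrier N. g \<otimes>\<^bsub>N\<^esub> h = h \<otimes>\<^bsub>N\<^esub> g)"
proof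
  assume c: "central g"
  show "\<forall>h\<in>carrier N. g \<otimes>\<^bsub>N\<^esub> h = h \<otimes>\<^bsub>N\<^esub> g"
  proof
    fix h assume h: "h \<in> carrier N"
    have "g j \<otimes> h j = h j \<otimes> g j" if "j \<in> K" for j
      using g h c that D_I by (subst commute_iff) (fastforce simp: central_def)+
    then show "g \<otimes>\<^bsub>N\<^esub> h = h \<otimes>\<^bsub>N\<^esub> g" by (auto intro!: restrict_ext)
  qed
next
  assume c: "\<forall>h\<in>carrier N. g \<otimes>\<^bsub>N\<^esub> h = h \<otimes>\<^bsub>N\<^esub> g"
  have "e a (g j) = 0" if j: "j \<in> K" and a: "a \<in> I" for j a
  proof -
    \<comment> \<open>Testing against exponent 1 at a neighbour \<open>b\<close> of \<open>a\<close>
      and 0 elsewhere isolates the exponent of \<open>g j\<close> at \<open>a\<close>.\<close>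
    obtain b where b: "D a b" using D_neighbour a by blast
    obtain x where x: "x \<in> carrier G" "\<forall>c\<in>I. e c x = (if c = b then 1 else 0)"
      using e_surj[of "\<lambda>c. if c = b then 1 else 0"] by auto
    have "(g \<otimes>\<^bsub>N\<^esub> \<iota> j x) j = (\<iota> j x \<otimes>\<^bsub>N\<^esub> g) j" using c iota_carrier[OF x(1)] by metis
    then have "g j \<otimes> x = x \<otimes> g j" using j by (simp add: \<iota>_def)
    then have "e a (g j) * e b x = e b (g j) * e a x"
      using commute_iff[OF comp_carrier[OF g j] x(1)] b by blast
    then show ?thesis using x b D_irrefl D_I[OF b] by auto
  qed
  then show "central g" using g by (simp add: central_def)
qed

lemma central_phi_iff:
  assumes g: "g \<in> carrier N" shows "central (\<phi> g) \<longleftrightarrow> central g"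
proof -
  have "(\<forall>h\<in>carrier N. \<phi> g \<otimes>\<^bsub>N\<^esub> h = h \<otimes>\<^bsub>N\<^esub> \<phi> g) \<longleftrightarrow>
        (\<forall>h\<in>carrier N. \<phi> g \<otimes>\<^bsub>N\<^esub> \<phi> h = \<phi> h \<otimes>\<^bsub>N\<^esub> \<phi> g)"
    using phi_surj p.hom_closed by blast
  also have "\<dots> \<longleftrightarrow> (\<forall>h\<in>carrier N. \<phi> (g \<otimes>\<^bsub>N\<^esub> h) = \<phi> (h \<otimes>\<^bsub>N\<^esub> g))"
  proof (rule ball_cong[OF HOL.refl])
    fix h assume h: "h \<in> carrier N"
    show "(\<phi> g \<otimes>\<^bsub>N\<^esub> \<phi> h = \<phi> h \<otimes>\<^bsub>N\<^esub> \<phi> g) = (\<phi> (g \<otimes>\<^bsub>N\<^esub> h) = \<phi> (h \<otimes>\<^bsub>N\<^esub> g))"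
      unfolding p.hom_mult[OF g h] p.hom_mult[OF h g] ..
  qed
  also have "\<dots> \<longleftrightarrow> (\<forall>h\<in>carrier N. g \<otimes>\<^bsub>N\<^esub> h = h \<otimes>\<^bsub>N\<^esub> g)"
  proof (rule ball_cong[OF HOL.refl])
    fix h assume h: "h \<in> carrier N"
    show "(\<phi> (g \<otimes>\<^bsub>N\<^esub> h) = \<phi> (h \<otimes>\<^bsub>N\<^esub> g)) = (g \<otimes>\<^bsub>N\<^esub> h = h \<otimes>\<^bsub>N\<^esub> g)"
    proof
      show "g \<otimes>\<^bsub>N\<^esub> h = h \<otimes>\<^bsub>N\<^esub> g" if "\<phi> (g \<otimes>\<^bsub>N\<^esub> h) = \<phi> (h \<otimes>\<^bsub>N\<^esub> g)"
        by (rule phi_inj[OF N.m_closed[OF g h] N.m_closed[OF h g] that])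
      show "\<phi> (g \<otimes>\<^bsub>N\<^esub> h) = \<phi> (h \<otimes>\<^bsub>N\<^esub> g)" if "g \<otimes>\<^bsub>N\<^esub> h = h \<otimes>\<^bsub>N\<^esub> g"
        unfolding that ..
    qed
  qed
  finally show ?thesis
    unfolding central_iff_commute[OF g] central_iff_commute[OF p.hom_closed[OF g]] .
qed

lemma comp_commute:
  assumes "i \<noteq> i'" "x \<in> carrier G" "y \<in> carrier G" "j \<in> K" "D a b"
  shows "e a (\<phi> (\<iota> i x) j) * e b (\<phi> (\<iota> i' y) j) = e b (\<phi> (\<iota> i x) j) * e a (\<phi> (\<iota> i' y) j)"
proof -
  have "\<iota> i x \<otimes>\<^bsub>N\<^esub> \<iota> i' y = \<iota> i' y \<otimes>\<^bsub>N\<^esub> \<iota> i x"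
    using assms by (auto simp: \<iota>_def intro!: restrict_ext)
  then have "\<phi> (\<iota> i x) \<otimes>\<^bsub>N\<^esub> \<phi> (\<iota> i' y) = \<phi> (\<iota> i' y) \<otimes>\<^bsub>N\<^esub> \<phi> (\<iota> i x)"
    by (simp only: p.hom_mult[OF iota_carrier[OF assms(2)] iota_carrier[OF assms(3)], symmetric]
        p.hom_mult[OF iota_carrier[OF assms(3)] iota_carrier[OF assms(2)], symmetric])
  then have "\<phi> (\<iota> i x) j \<otimes> \<phi> (\<iota> i' y) j = \<phi> (\<iota> i' y) j \<otimes> \<phi> (\<iota> i x) j"
    unfolding comp_mult[OF assms(4), symmetric] by (rule arg_cong)
  then show ?thesis
    using commute_iff[OF comp_carrier[OF p.hom_closed[OF iota_carrier[OF assms(2)]] assms(4)]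
        comp_carrier[OF p.hom_closed[OF iota_carrier[OF assms(3)]] assms(4)]] assms(5) by blast
qed

definition occurs :: "'i \<Rightarrow> 'i \<Rightarrow> 'v \<Rightarrow> bool" where
  "occurs i j a \<longleftrightarrow> (\<exists>x\<in>carrier G. e a (\<phi> (\<iota> i x) j) \<noteq> 0)"

lemma occurs_exists:
  assumes "j \<in> K" "a \<in> I" shows "\<exists>i\<in>K. occurs i j a"
proof (rule ccontr)
  assume none: "\<not> ?thesis"
  have 0: "e a (\<phi> g j) = 0" if g: "g \<in> carrier N" for g
  proof (rule additive_zero[where l = "\<lambda>g. e a (\<phi> g j)", OF _ _ g])
    show "e a (\<phi> (g \<otimes>\<^bsub>N\<^esub> h) j) = e a (\<phi> g j) + e a (\<phi> h j)"
      if "g \<in> carrier N" "h \<in> carrier N" for g h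
      by (rule e_phi_mult[OF that assms(1)])
    show "e a (\<phi> (\<iota> i x) j) = 0" if "i \<in> K" "x \<in> carrier G" for i x
      using none that unfolding occurs_def by blast
  qed
  obtain h where "h \<in> carrier N" "e a (h j) = 1" using N_section[of "\<lambda>_. 1"] assms by auto
  then show False using phi_surj 0 by (metis zero_neq_one)
qed

text \<open>If different factors occurred at the two ends of an edge of \<open>D\<close>, commutation would make all
  images proportional at these two coordinates, contradicting surjectivity.\<close>

lemma occurs_adjacent:
  assumes ii: "i \<in> K" "i' \<in> K" and j: "j \<in> K" and ab: "D a b" and "occurs i j a" "occurs i' j b"
  shows "i = i'"
proof (rule ccontr)
  assume ne: "i \<noteq> i'"
  define E where "E c g = e c (\<phi> g j)" for c g
  obtain x y where x: "x \<in> carrier G" "E a (\<iota> i x) \<noteq> 0" and y: "y \<in> carrier G" "E b (\<iota> i' y) \<noteq> 0"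
    using assms unfolding occurs_def E_def by blast
  have comm: "E a (\<iota> k z) * E b (\<iota> k' z') = E b (\<iota> k z) * E a (\<iota> k' z')"
    if "k \<noteq> k'" "z \<in> carrier G" "z' \<in> carrier G" for k k' z z'
    unfolding E_def using comp_commute that j ab by blast
  \<comment> \<open>The goal is that every image is proportional to that of
    \<open>\<iota> i x\<close> at the two coordinates \<open>a\<close> and \<open>b\<close>. A
    factor \<open>l \<noteq> i\<close> is compared with \<open>\<iota> i x\<close> directly; the
    factor \<open>i\<close> itself goes through \<open>\<iota> i' y\<close>, and
    \<open>?w' b \<noteq> 0\<close> is cancelled.\<close>
  let ?w = "\<lambda>c. E c (\<iota> i x)" and ?w' = "\<lambda>c. E c (\<iota> i' y)"
  have ww: "?w a * ?w' b = ?w b * ?w' a" using comm ne x y by blast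
  have "E a (\<iota> l z) * ?w b - E b (\<iota> l z) * ?w a = 0" if z: "z \<in> carrier G" for l z
  proof (cases "l = i")
    case False
    then show ?thesis using comm[OF False z x(1)] by simp
  next
    case True
    then have t: "E a (\<iota> l z) * ?w' b = E b (\<iota> l z) * ?w' a" using comm ne z y by blast
    have "?w' b * (E a (\<iota> l z) * ?w b) = (E a (\<iota> l z) * ?w' b) * ?w b" by (simp only: mult_ac)
    also have "\<dots> = E b (\<iota> l z) * (?w b * ?w' a)" unfolding t by (simp only: mult_ac)
    also have "\<dots> = ?w' b * (E b (\<iota> l z) * ?w a)" unfolding ww[symmetric] by (simp only: mult_ac)
    finally show ?thesis using y by simp
  qed
  note iota0 = this
  have 0: "E a g * ?w b - E b g * ?w a = 0" if g: "g \<in> carrier N" for g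
  proof (rule additive_zero[where l = "\<lambda>g. E a g * ?w b - E b g * ?w a", OF _ iota0 g])
    show "E a (g \<otimes>\<^bsub>N\<^esub> h) * ?w b - E b (g \<otimes>\<^bsub>N\<^esub> h) * ?w a =
        (E a g * ?w b - E b g * ?w a) + (E a h * ?w b - E b h * ?w a)"
      if "g \<in> carrier N" "h \<in> carrier N" for g h
      using e_phi_mult[OF that j] by (simp add: E_def algebra_simps del: mult_product_group)
  qed
  \<comment> \<open>Exponents 0 at \<open>a\<close> and 1 at \<open>b\<close> violate the
    proportionality, because \<open>?w a \<noteq> 0\<close>.\<close>
  obtain h where h: "h \<in> carrier N" "\<forall>c\<in>I. e c (h j) = (if c = b then 1 else 0)"
    using N_section[of "\<lambda>(k, c). if c = b then 1 else 0"] j by auto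
  obtain g where g: "g \<in> carrier N" "\<phi> g = h" using phi_surj h by blast
  have "E a g = 0" "E b g = 1" using h g D_I[OF ab] D_irrefl ab by (auto simp: E_def)
  then show False using 0[OF g(1)] x by simp
qed

text \<open>Some factor occurs at a neighbour \<open>b\<close> of \<open>a\<close>; by
  \<open>occurs_adjacent\<close> it equals both \<open>i\<close> and \<open>i'\<close>.\<close>

lemma occurs_unique:
  assumes "i \<in> K" "i' \<in> K" "j \<in> K" "a \<in> I" "occurs i j a" "occurs i' j a"
  shows "i = i'"
proof -
  obtain b where b: "D a b" using D_neighbour assms by blast
  then obtain l where "l \<in> K" "occurs l j b" using occurs_exists D_I assms by blast
  then show ?thesis using occurs_adjacent b assms by metis
qed

lemma occurs_block:
  assumes "j \<in> K" shows "\<exists>r\<in>K. \<forall>a\<in>I. \<forall>i\<in>K. occurs i j a \<longleftrightarrow> i = r"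
proof -
  obtain a where a: "a \<in> I" using I_nonempty by blast
  obtain r where r: "r \<in> K" "occurs r j a" using occurs_exists assms a by blast
  define C where "C = {b \<in> I. occurs r j b}"
  have "C = I"
  proof (rule D_connected)
    show "C \<subseteq> I" "C \<noteq> {}" using a r by (auto simp: C_def)
    fix b c assume bc: "D b c"
    obtain k where k: "k \<in> K" "occurs k j b" using occurs_exists assms D_I[OF bc] by blast
    obtain l where l: "l \<in> K" "occurs l j c" using occurs_exists assms D_I[OF bc] by blast
    have "k = l" using occurs_adjacent[OF k(1) l(1) assms bc k(2) l(2)] .
    then show "b \<in> C \<longleftrightarrow> c \<in> C"
      using occurs_unique k l r assms D_I[OF bc] unfolding C_def by blast
  qed
  then show ?thesis using occurs_unique r assms unfolding C_def by blast
qed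

definition \<rho> :: "'i \<Rightarrow> 'i" where
  "\<rho> j = (SOME r. r \<in> K \<and> (\<forall>a\<in>I. \<forall>i\<in>K. occurs i j a \<longleftrightarrow> i = r))"

lemma rho:
  assumes "j \<in> K"
  shows rho_K: "\<rho> j \<in> K" and occurs_iff: "\<And>a i. \<lbrakk>a \<in> I; i \<in> K\<rbrakk> \<Longrightarrow> occurs i j a \<longleftrightarrow> i = \<rho> j"
  using someI_ex[OF occurs_block[OF assms, unfolded Bex_def]] unfolding \<rho>_def by blast+

lemma e_phi_iota:
  "\<lbrakk>j \<in> K; i \<in> K; i \<noteq> \<rho> j; a \<in> I; x \<in> carrier G\<rbrakk> \<Longrightarrow> e a (\<phi> (\<iota> i x) j) = 0"
  using occurs_iff[of j a i] unfolding occurs_def by blast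

text \<open>A factor missed by \<open>\<rho>\<close> would be sent entirely into the centre,
  although it contains noncentral elements. As \<open>K\<close> is finite, surjectivity
  suffices.\<close>

lemma rho_bij: "bij_betw \<rho> K K"
proof -
  have "K \<subseteq> \<rho> ` K"
  proof
    fix i assume i: "i \<in> K"
    obtain x where x: "x \<in> carrier G" "\<forall>a\<in>I. e a x = 1" using e_surj[of "\<lambda>_. 1"] by auto
    have "\<not> central (\<iota> i x)" using x i I_nonempty by (auto simp: central_def \<iota>_def)
    then have "\<not> central (\<phi> (\<iota> i x))" using central_phi_iff iota_carrier x by blast
    then obtain j a where "j \<in> K" "a \<in> I" "e a (\<phi> (\<iota> i x) j) \<noteq> 0"
      using p.hom_closed[OF iota_carrier[OF x(1)]] by (auto simp: central_def)
    then show "i \<in> \<rho> ` K" using e_phi_iota i x by blast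
  qed
  moreover have "\<rho> ` K \<subseteq> K" using rho_K by blast
  ultimately have "\<rho> ` K = K" by blast
  then show ?thesis using finite_K by (simp add: bij_betw_def eq_card_imp_inj_on)
qed

section \<open>The permutation-type automorphism obtained by dropping central components\<close>

definition \<psi> :: "'i \<Rightarrow> 'a \<Rightarrow> 'a" where "\<psi> j x = \<phi> (\<iota> (\<rho> j) x) j"

text \<open>Of the components of \<open>\<phi>\<close> from factor \<open>i\<close> to block
  \<open>j\<close> only those with \<open>i = \<rho> j\<close> are kept; the values of the others
  have zero exponents on \<open>I\<close>.\<close>

definition \<phi>' where "\<phi>' = wreath G K \<rho> \<psi>"

lemma psi_hom: assumes "j \<in> K" shows "\<psi> j \<in> hom G G"
proof (rule homI)
  show "\<psi> j x \<in> carrier G" if "x \<in> carrier G" for x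
    unfolding \<psi>_def by (rule comp_carrier[OF p.hom_closed[OF iota_carrier[OF that]] assms])
  show "\<psi> j (x \<otimes> y) = \<psi> j x \<otimes> \<psi> j y" if "x \<in> carrier G" "y \<in> carrier G" for x y
    unfolding \<psi>_def using that assms
    by (simp only: iota_mult p.hom_mult iota_carrier comp_mult)
qed

lemma phi'_apply: "\<lbrakk>g \<in> carrier N; j \<in> K\<rbrakk> \<Longrightarrow> \<phi>' g j = \<phi> (\<iota> (\<rho> j) (g (\<rho> j))) j"
  by (simp add: \<phi>'_def wreath_def \<psi>_def)

lemma phi'_hom: "\<phi>' \<in> hom N N"
  unfolding \<phi>'_def using rho_K psi_hom by (intro wreath_hom) auto

lemma e_phi':
  assumes g: "g \<in> carrier N" and j: "j \<in> K" and a: "a \<in> I"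
  shows "e a (\<phi>' g j) = e a (\<phi> g j)"
proof -
  have rj: "\<rho> j \<in> K" using rho_K j by blast
  have "e a (\<phi> g j) - e a (\<phi> (\<iota> (\<rho> j) (g (\<rho> j))) j) = 0"
    using _ _ g
  proof (rule additive_zero)
    fix h k assume hk: "h \<in> carrier N" "k \<in> carrier N"
    have "\<iota> (\<rho> j) ((h \<otimes>\<^bsub>N\<^esub> k) (\<rho> j)) = \<iota> (\<rho> j) (h (\<rho> j)) \<otimes>\<^bsub>N\<^esub> \<iota> (\<rho> j) (k (\<rho> j))"
      using hk rj by (metis iota_mult comp_mult comp_carrier)
    then show "e a (\<phi> (h \<otimes>\<^bsub>N\<^esub> k) j) - e a (\<phi> (\<iota> (\<rho> j) ((h \<otimes>\<^bsub>N\<^esub> k) (\<rho> j))) j) =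
        (e a (\<phi> h j) - e a (\<phi> (\<iota> (\<rho> j) (h (\<rho> j))) j)) + (e a (\<phi> k j) - e a (\<phi> (\<iota> (\<rho> j) (k (\<rho> j))) j))"
      using hk rj j e_phi_mult iota_carrier comp_carrier by simp
  next
    fix i x assume i: "i \<in> K" and x: "x \<in> carrier G"
    show "e a (\<phi> (\<iota> i x) j) - e a (\<phi> (\<iota> (\<rho> j) (\<iota> i x (\<rho> j))) j) = 0"
    proof (cases "i = \<rho> j")
      case True
      then show ?thesis using rj by (simp add: \<iota>_def)
    next
      case False
      then have "\<iota> (\<rho> j) (\<iota> i x (\<rho> j)) = \<one>\<^bsub>N\<^esub>" using rj iota_one by (simp add: \<iota>_def)
      then show ?thesis using e_phi_iota[OF j i False a x] j by (simp add: e_one p.hom_one del: one_product_group) (simp add: e_one)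
    qed
  qed
  then show ?thesis using phi'_apply g j by simp
qed

text \<open>A dropped component is a homomorphism with central values and so kills the derived
  group. This is why \<open>\<phi>'\<close> agrees with \<open>\<phi>\<close> on the centre.\<close>

lemma phi_iota_derived:
  assumes "j \<in> K" "i \<in> K" "i \<noteq> \<rho> j" "z \<in> derived G (carrier G)"
  shows "\<phi> (\<iota> i z) j = \<one>"
proof (rule hom_central_image_kills_derived[OF _ _ assms(4), where f = "\<lambda>z. \<phi> (\<iota> i z) j"])
  show "(\<lambda>z. \<phi> (\<iota> i z) j) \<in> hom G G"
    using assms by (intro homI)
      (simp_all only: iota_mult p.hom_mult iota_carrier comp_mult comp_carrier p.hom_closed)
qed (use e_phi_iota assms in auto)

lemma phi'_central:
  assumes g: "central g" shows "\<phi>' g = \<phi> g"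
proof -
  have gN: "g \<in> carrier N" using g by (simp add: central_def)
  have Z: "g i \<in> derived G (carrier G)" if "i \<in> K" for i
    using g that derivedI by (auto simp: central_def)
  have dG: "derived G (carrier G) \<subseteq> carrier G" by (rule derived_in_carrier) simp
  have "\<phi> g j = \<phi>' g j" if j: "j \<in> K" for j
    using gN Z dG
  proof (rule N_induct)
    have "\<phi>' \<one>\<^bsub>N\<^esub> = \<one>\<^bsub>N\<^esub>" by (rule hom_one[OF phi'_hom N.group_axioms N.group_axioms])
    then show "\<phi> \<one>\<^bsub>N\<^esub> j = \<phi>' \<one>\<^bsub>N\<^esub> j" using p.hom_one by metis
    fix i x h assume i: "i \<in> K" and x: "x \<in> derived G (carrier G)" and h: "h \<in> carrier N" and IH: "\<phi> h j = \<phi>' h j"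
    have xG: "x \<in> carrier G" using x dG by blast
    have "\<phi> (\<iota> i x) j = \<phi>' (\<iota> i x) j"
    proof (cases "i = \<rho> j")
      case True
      have "\<iota> i x i = x" using i by (simp add: \<iota>_def)
      then show ?thesis using phi'_apply[OF iota_carrier[OF xG, of i] j] True by simp
    next
      case False
      then have "\<iota> (\<rho> j) (\<iota> i x (\<rho> j)) = \<one>\<^bsub>N\<^esub>" using rho_K[OF j] iota_one by (simp add: \<iota>_def)
      then show ?thesis
        using phi_iota_derived[OF j i False x] phi'_apply[OF iota_carrier[OF xG] j] j p.hom_one by simp
    qed
    then show "\<phi> (\<iota> i x \<otimes>\<^bsub>N\<^esub> h) j = \<phi>' (\<iota> i x \<otimes>\<^bsub>N\<^esub> h) j"
      using IH xG h j by (simp only: p.hom_mult hom_mult[OF phi'_hom] iota_carrier comp_mult)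
  qed
  moreover have "\<phi> g \<in> carrier N" "\<phi>' g \<in> carrier N"
    using gN p.hom_closed phi'_hom by (auto simp del: carrier_product_group dest: hom_carrier)
  ultimately show ?thesis by (intro PiE_ext[of _ K]) auto
qed

text \<open>\<open>\<phi>\<close> and \<open>\<phi>'\<close> differ by central elements and coincide
  on the centre, which \<open>\<phi>\<close> maps onto itself. So the kernel of
  \<open>\<phi>'\<close> is central, hence trivial, and a preimage under \<open>\<phi>\<close> can
  be corrected by a central factor.\<close>

lemma phi'_bij: "bij_betw \<phi>' (carrier N) (carrier N)"
proof (rule bij_betw_imageI)
  interpret p': group_hom N N \<phi>'
    using phi'_hom by (simp add: group_hom_def group_hom_axioms_def N.group_axioms)
  have diff: "central (inv\<^bsub>N\<^esub> (\<phi> g) \<otimes>\<^bsub>N\<^esub> \<phi>' g)" if g: "g \<in> carrier N" for g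
  proof -
    have c: "inv\<^bsub>N\<^esub> (\<phi> g) \<otimes>\<^bsub>N\<^esub> \<phi>' g \<in> carrier N"
      using g by (intro N.m_closed N.inv_closed p.hom_closed p'.hom_closed)
    have "e a ((inv\<^bsub>N\<^esub> (\<phi> g) \<otimes>\<^bsub>N\<^esub> \<phi>' g) j) = 0" if "j \<in> K" "a \<in> I" for j a
    proof -
      have "inv\<^bsub>N\<^esub> (\<phi> g) = (\<lambda>i\<in>K. inv (\<phi> g i))"
        using p.hom_closed[OF g] by (intro inv_product_group) (auto simp: group_axioms)
      then have "(inv\<^bsub>N\<^esub> (\<phi> g) \<otimes>\<^bsub>N\<^esub> \<phi>' g) j = inv (\<phi> g j) \<otimes> \<phi>' g j"
        using that by simp
      then show ?thesis
        using e_mult e_inv e_phi'[OF g that] comp_carrier p.hom_closed[OF g] p'.hom_closed[OF g] that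
        by simp
    qed
    then show ?thesis using c by (simp add: central_def)
  qed
  have inj1: "g = \<one>\<^bsub>N\<^esub>" if g: "g \<in> carrier N" "\<phi>' g = \<one>\<^bsub>N\<^esub>" for g
  proof -
    have "central (\<phi>' g)" using g by (simp add: central_def e_one group.is_monoid group_axioms)
    then have "central (\<phi> g)" using g(1) e_phi' p.hom_closed p'.hom_closed by (simp add: central_def)
    then have "central g" using central_phi_iff g by blast
    then have "\<phi> g = \<phi> \<one>\<^bsub>N\<^esub>" using phi'_central g p.hom_one by metis
    then show ?thesis using phi_inj g N.one_closed by blast
  qed
  then show "inj_on \<phi>' (carrier N)" using p'.inj_on_one_iff by blast
  show "\<phi>' ` carrier N = carrier N"
  proof
    show "\<phi>' ` carrier N \<subseteq> carrier N" using p'.hom_closed by blast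
    show "carrier N \<subseteq> \<phi>' ` carrier N"
    proof
      fix h assume h: "h \<in> carrier N"
      then obtain g where g: "g \<in> carrier N" "\<phi> g = h" using phi_surj by blast
      define z where "z = inv\<^bsub>N\<^esub> (\<phi> g) \<otimes>\<^bsub>N\<^esub> \<phi>' g"
      have z: "z \<in> carrier N" "central z" using diff[OF g(1)] by (auto simp: z_def central_def simp del: carrier_product_group)
      \<comment> \<open>The central error \<open>z\<close> is cancelled by a
        \<open>\<phi>\<close>-preimage of its inverse. The detour through the inverse of
        \<open>c\<close> uses centrality of \<open>z\<close> itself rather than of its
        inverse.\<close>
      obtain c where c: "c \<in> carrier N" "\<phi> c = inv\<^bsub>N\<^esub> z" using phi_surj z N.inv_closed by metis
      have "\<phi> (inv\<^bsub>N\<^esub> c) = z" using c z by (metis N.inv_inv p.hom_inv)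
      then have "central (inv\<^bsub>N\<^esub> c)" using z central_phi_iff c N.inv_closed by metis
      then have "\<phi>' (inv\<^bsub>N\<^esub> c) = z" using phi'_central \<open>\<phi> (inv\<^bsub>N\<^esub> c) = z\<close> by metis
      then have "\<phi>' c = inv\<^bsub>N\<^esub> z" using c by (metis N.inv_closed N.inv_inv p'.hom_inv)
      moreover have "\<phi>' g = h \<otimes>\<^bsub>N\<^esub> z"
        using g h p'.hom_closed[OF g(1)] by (simp only: z_def N.inv_closed N.m_assoc[symmetric] N.r_inv N.l_one)
      ultimately have "\<phi>' (g \<otimes>\<^bsub>N\<^esub> c) = h"
        using g c h z by (simp only: p'.hom_mult N.m_assoc N.r_inv N.r_one N.inv_closed)
      then show "h \<in> \<phi>' ` carrier N" using g c N.m_closed by blast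
    qed
  qed
qed

text \<open>Block \<open>i\<close> of \<open>\<phi>'\<close> reads only factor
  \<open>\<rho> i\<close>, and \<open>\<rho>\<close> is injective; so elements concentrated in one
  coordinate reduce bijectivity of \<open>\<psi> j\<close> to that of
  \<open>\<phi>'\<close>.\<close>

lemma psi_iso:
  assumes j: "j \<in> K" shows "\<psi> j \<in> iso G G"
proof -
  interpret h: group_hom G G "\<psi> j" using psi_hom[OF j] by (simp add: group_hom_def group_hom_axioms_def group_axioms)
  interpret p': group_hom N N \<phi>'
    using phi'_hom by (simp add: group_hom_def group_hom_axioms_def N.group_axioms)
  have rj: "\<rho> j \<in> K" using rho_K[OF j] .
  have "x = \<one>" if x: "x \<in> carrier G" "\<psi> j x = \<one>" for x
  proof -
    have "\<phi>' (\<iota> (\<rho> j) x) i = \<one>" if i: "i \<in> K" for i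
    proof (cases "i = j")
      case True
      then show ?thesis using x phi'_apply[OF iota_carrier[OF x(1)] j] rj by (simp add: \<iota>_def \<psi>_def)
    next
      case False
      then have "\<rho> i \<noteq> \<rho> j" using rho_bij i j by (auto simp: bij_betw_def inj_on_def)
      then have "\<iota> (\<rho> i) (\<iota> (\<rho> j) x (\<rho> i)) = \<one>\<^bsub>N\<^esub>"
        using rho_K[OF i] iota_one by (simp add: \<iota>_def)
      then show ?thesis using phi'_apply[OF iota_carrier[OF x(1)] i] i p.hom_one by simp
    qed
    then have "\<phi>' (\<iota> (\<rho> j) x) = \<one>\<^bsub>N\<^esub>"
      using p'.hom_closed[OF iota_carrier[OF x(1)]] N.one_closed
      by (intro PiE_ext[of _ K "\<lambda>_. carrier G"]) (auto simp del: p'.hom_one)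
    then have "\<iota> (\<rho> j) x = \<one>\<^bsub>N\<^esub>"
      using phi'_bij p'.inj_on_one_iff iota_carrier[OF x(1)] by (auto simp: bij_betw_def simp del: carrier_product_group one_product_group)
    then have "\<iota> (\<rho> j) x (\<rho> j) = \<one>" using rj by simp
    then show ?thesis using rj by (simp add: \<iota>_def)
  qed
  then have "inj_on (\<psi> j) (carrier G)" using h.inj_on_one_iff by blast
  moreover have "\<exists>x\<in>carrier G. \<psi> j x = y" if y: "y \<in> carrier G" for y
  proof -
    have "\<iota> j y \<in> \<phi>' ` carrier N"
      using bij_betw_imp_surj_on[OF phi'_bij] iota_carrier[OF y] by (simp only:)
    then obtain g where g: "\<iota> j y = \<phi>' g" "g \<in> carrier N" by (rule imageE)
    then have "\<psi> j (g (\<rho> j)) = y"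
      using phi'_apply[OF g(2) j] j by (simp add: \<psi>_def g(1)[symmetric]) (simp add: \<iota>_def)
    then show ?thesis using comp_carrier[OF g(2) rj] by (rule bexI)
  qed
  then have "carrier G \<subseteq> \<psi> j ` carrier G" by blast
  ultimately show ?thesis using psi_hom[OF j] h.hom_closed by (auto simp: iso_def bij_betw_def)
qed

end

section \<open>Equality of the Reidemeister numbers of \<open>\<phi>\<close> and
  \<open>\<phi>'\<close>\<close>

context power_automorphism begin

text \<open>Finiteness of the Reidemeister number makes the cokernel of the endomorphism that \<open>1 - f\<close>
  (equivalently \<open>1 - \<phi>\<close>) induces modulo the centre finite, so that its kernel is trivial.\<close>

lemma fixed_point_central:
  assumes f: "f \<in> hom N N" and ef: "\<And>g j a. \<lbrakk>g \<in> carrier N; j \<in> K; a \<in> I\<rbrakk> \<Longrightarrow> e a (f g j) = e a (\<phi> g j)"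
    and fin: "reidemeister N f \<noteq> \<infinity>"
    and c: "c \<in> carrier N" and fx: "\<And>j a. \<lbrakk>j \<in> K; a \<in> I\<rbrakk> \<Longrightarrow> e a (\<phi> c j) = e a (c j)"
  shows "central c"
proof -
  obtain s where s: "\<And>v. s v \<in> carrier N" "\<And>v j a. \<lbrakk>j \<in> K; a \<in> I\<rbrakk> \<Longrightarrow> e a (s v j) = v (j, a)"
    using N_section by metis
  \<comment> \<open>Since \<open>\<phi>\<close> preserves the centre, the exponents of
    \<open>\<phi> g\<close> depend only on those of \<open>g\<close>: \<open>\<phi>\<close> descends
    to exponent vectors.\<close>
  have ker: "e a (\<phi> g j) = e a (\<phi> h j)"
    if gh: "g \<in> carrier N" "h \<in> carrier N" "\<And>j a. \<lbrakk>j \<in> K; a \<in> I\<rbrakk> \<Longrightarrow> e a (g j) = e a (h j)"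
      and ja: "j \<in> K" "a \<in> I" for g h j a
  proof -
    define z where "z = inv\<^bsub>N\<^esub> g \<otimes>\<^bsub>N\<^esub> h"
    have z: "z \<in> carrier N" using gh by (simp only: z_def N.m_closed N.inv_closed)
    have "inv\<^bsub>N\<^esub> g = (\<lambda>i\<in>K. inv (g i))"
      using gh by (intro inv_product_group) (auto simp: group_axioms)
    then have "e a (z j) = 0" if "j \<in> K" "a \<in> I" for j a
      using that gh(3)[OF that] e_mult e_inv comp_carrier[OF gh(1)] comp_carrier[OF gh(2)] by (simp add: z_def)
    then have "central z" using z by (simp add: central_def)
    then have "e a (\<phi> z j) = 0" using central_phi_iff[OF z] ja by (simp add: central_def)
    moreover have "h = g \<otimes>\<^bsub>N\<^esub> z"
      using gh by (simp only: z_def N.m_assoc[symmetric] N.inv_closed N.r_inv N.l_one)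
    ultimately show ?thesis using e_phi_mult[OF gh(1) z ja(1)] by simp
  qed
  \<comment> \<open>The endomorphism \<open>1 - \<phi>\<close> of the lattice indexed by
    \<open>K \<times> I\<close>, computed on the chosen lifts \<open>s v\<close>; \<open>Lg\<close>
    permits any other lift.\<close>
  define L where "L v = (\<lambda>(j, a). e a (s v j) - e a (\<phi> (s v) j))" for v
  have Lg: "L v (j, a) = e a (g j) - e a (\<phi> g j)"
    if "g \<in> carrier N" "j \<in> K" "a \<in> I" "\<And>j a. \<lbrakk>j \<in> K; a \<in> I\<rbrakk> \<Longrightarrow> e a (g j) = v (j, a)" for g v j a
    unfolding L_def using that s ker[OF s(1) that(1)] by simp
  define w where "w = (\<lambda>(j, a). e a (c j))"
  have "w ja = 0" if "ja \<in> K \<times> I" for ja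
    using _ _ _ _ _ that
  proof (rule int_endomorphism_injective[where L = L])
    show "finite (K \<times> I)" using finite_K finite_I by simp
    fix ja assume "ja \<in> K \<times> I"
    then obtain j a where ja: "ja = (j, a)" "j \<in> K" "a \<in> I" by auto
    show "L w ja = 0" using Lg[OF c ja(2,3), of w] fx ja by (simp add: w_def)
    show "L (\<lambda>i. u i + v i) ja = L u ja + L v ja" for u v
    proof -
      have "L (\<lambda>i. u i + v i) (j, a) = e a ((s u \<otimes>\<^bsub>N\<^esub> s v) j) - e a (\<phi> (s u \<otimes>\<^bsub>N\<^esub> s v) j)"
        using s ja e_mult comp_carrier[OF s(1)] by (intro Lg N.m_closed) (auto simp: e_mult)
      also have "\<dots> = L u (j, a) + L v (j, a)"
        using e_phi_mult[OF s(1) s(1) ja(2)] e_mult comp_carrier[OF s(1)] ja by (simp add: L_def)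
      finally show ?thesis using ja by simp
    qed
    show "L u ja = L v ja" if "\<And>i. i \<in> K \<times> I \<Longrightarrow> u i = v i" for u v
      unfolding ja(1) using s ja that by (subst Lg[OF s(1)[of v]]) (auto simp: L_def)
    show "\<exists>m u. m \<noteq> 0 \<and> (\<forall>i\<in>K \<times> I. L u i = (if i = ja then m else 0))"
    proof -
      let ?r = "twisted_conj N f"
      \<comment> \<open>The powers of \<open>x\<close> fall into finitely many classes, so two of
        them, with \<open>n \<noteq> n'\<close>, are twisted conjugate by some \<open>d\<close>.
        Modulo the centre this says that \<open>L\<close> sends the exponents of \<open>d\<close> to
        \<open>n - n'\<close> times the unit vector at \<open>ja\<close>.\<close>
      define x where "x = s (\<lambda>i. if i = ja then 1 else 0)"
      have x: "x \<in> carrier N" "\<And>i b. \<lbrakk>i \<in> K; b \<in> I\<rbrakk> \<Longrightarrow> e b (x i) = (if (i, b) = ja then 1 else 0)"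
        unfolding x_def by (rule s(1)) (rule s(2))
      have xp: "x [^]\<^bsub>N\<^esub> n \<in> carrier N" for n :: nat by (rule N.nat_pow_closed[OF x(1)])
      have ex: "e b ((x [^]\<^bsub>N\<^esub> n) i) = (if (i, b) = ja then int n else 0)" if "i \<in> K" "b \<in> I" for n :: nat and i b
      proof (induction n)
        case 0
        then show ?case using that by (simp add: e_one)
      next
        case (Suc n)
        have "e b ((x [^]\<^bsub>N\<^esub> Suc n) i) = e b ((x [^]\<^bsub>N\<^esub> n) i) + e b (x i)"
          using that e_mult[OF comp_carrier[OF xp] comp_carrier[OF x(1)]] by (simp only: N.nat_pow_Suc comp_mult)
        then show ?case using Suc x(2)[OF that] by simp
      qed
      have "finite (carrier N // ?r)"
        using fin by (simp add: reidemeister_ecard ecard_def split: if_splits)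
      moreover have "range (\<lambda>n::nat. ?r `` {x [^]\<^bsub>N\<^esub> n}) \<subseteq> carrier N // ?r"
        using xp by (auto intro!: quotientI simp del: carrier_product_group)
      ultimately have "\<not> inj (\<lambda>n::nat. ?r `` {x [^]\<^bsub>N\<^esub> n})"
        using finite_imageD finite_subset infinite_UNIV_nat by metis
      then obtain n n' :: nat where n: "n \<noteq> n'" "?r `` {x [^]\<^bsub>N\<^esub> n} = ?r `` {x [^]\<^bsub>N\<^esub> n'}"
        by (auto simp: inj_def)
      then have "(x [^]\<^bsub>N\<^esub> n, x [^]\<^bsub>N\<^esub> n') \<in> ?r"
        using eq_equiv_class_iff[OF N.twisted_conj_equiv[OF f] xp xp] by blast
      then obtain d where d: "d \<in> carrier N" "x [^]\<^bsub>N\<^esub> n = d \<otimes>\<^bsub>N\<^esub> x [^]\<^bsub>N\<^esub> n' \<otimes>\<^bsub>N\<^esub> inv\<^bsub>N\<^esub> f d"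
        unfolding twisted_conj_def by blast
      have fd: "f d \<in> carrier N" using f d(1) by (rule hom_carrier[THEN subsetD, OF _ imageI])
      then have "x [^]\<^bsub>N\<^esub> n \<otimes>\<^bsub>N\<^esub> f d = d \<otimes>\<^bsub>N\<^esub> x [^]\<^bsub>N\<^esub> n'"
        using d xp by (simp only: N.m_assoc N.m_closed N.inv_closed N.l_inv N.r_one)
      then have "(x [^]\<^bsub>N\<^esub> n) i \<otimes> f d i = d i \<otimes> (x [^]\<^bsub>N\<^esub> n') i" if "i \<in> K" for i
        using comp_mult[OF that] by metis
      then have "e b ((x [^]\<^bsub>N\<^esub> n) i) + e b (\<phi> d i) = e b (d i) + e b ((x [^]\<^bsub>N\<^esub> n') i)"
        if "i \<in> K" "b \<in> I" for i b
        using that ef[OF d(1) that] e_mult comp_carrier[OF xp] comp_carrier[OF fd] comp_carrier[OF d(1)] by metis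
      then have "L (\<lambda>(j, a). e a (d j)) (i, b) = (if (i, b) = ja then int n - int n' else 0)"
        if "i \<in> K" "b \<in> I" for i b
        using Lg[OF d(1) that, of "\<lambda>(j, a). e a (d j)"] that ex[OF that] by (force split: if_splits)
      then show ?thesis using n
        by (intro exI[of _ "int n - int n'"] exI[of _ "\<lambda>(j, a). e a (d j)"]) auto
    qed
  qed
  then show ?thesis using c by (auto simp: central_def w_def)
qed

lemma inv_N_apply: "\<lbrakk>c \<in> carrier N; j \<in> K\<rbrakk> \<Longrightarrow> (inv\<^bsub>N\<^esub> c) j = inv (c j)"
  by (subst inv_product_group) (auto simp: group_axioms)

lemma e_inv_N: "\<lbrakk>c \<in> carrier N; j \<in> K\<rbrakk> \<Longrightarrow> e a ((inv\<^bsub>N\<^esub> c) j) = - e a (c j)"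
  by (simp only: inv_N_apply e_inv[OF comp_carrier])

lemma e_mult_N: "\<lbrakk>c \<in> carrier N; d \<in> carrier N; j \<in> K\<rbrakk> \<Longrightarrow> e a ((c \<otimes>\<^bsub>N\<^esub> d) j) = e a (c j) + e a (d j)"
  by (simp only: comp_mult e_mult[OF comp_carrier comp_carrier])

lemma phi'_closed: "g \<in> carrier N \<Longrightarrow> \<phi>' g \<in> carrier N"
  using hom_carrier[OF phi'_hom] by (rule subsetD) (rule imageI)

text \<open>Modulo the centre, twisted conjugation is the same for \<open>\<phi>\<close> and
  \<open>\<phi>'\<close>; all later comparisons of exponents can therefore use
  \<open>\<phi>\<close>.\<close>

lemma e_twist:
  assumes f: "f = \<phi> \<or> f = \<phi>'" and c: "c \<in> carrier N" and b: "b \<in> carrier N" and j: "j \<in> K" and a: "a \<in> I"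
  shows "e a ((c \<otimes>\<^bsub>N\<^esub> b \<otimes>\<^bsub>N\<^esub> inv\<^bsub>N\<^esub> f c) j) = e a (c j) + e a (b j) - e a (\<phi> c j)"
proof -
  have fc: "f c \<in> carrier N" using f p.hom_closed[OF c] phi'_closed[OF c] by (elim disjE) (simp_all only:)
  have "e a (f c j) = e a (\<phi> c j)" using f e_phi'[OF c j a] by (elim disjE) (simp_all only:)
  then show ?thesis
    by (simp only: e_mult_N[OF N.m_closed[OF c b] N.inv_closed[OF fc] j] e_mult_N[OF c b j] e_inv_N[OF fc j])
qed

definition same_image :: "('i \<Rightarrow> 'a) \<Rightarrow> ('i \<Rightarrow> 'a) \<Rightarrow> bool" where
  "same_image g h \<longleftrightarrow> (\<forall>j\<in>K. \<forall>a\<in>I. e a (g j) = e a (h j))"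

text \<open>Twisted conjugacy for the map that \<open>\<phi>\<close> induces modulo the centre,
  expressed by exponents alone.\<close>

definition tw_image :: "('i \<Rightarrow> 'a) \<Rightarrow> ('i \<Rightarrow> 'a) \<Rightarrow> bool" where
  "tw_image g h \<longleftrightarrow> (\<exists>c\<in>carrier N. \<forall>j\<in>K. \<forall>a\<in>I. e a (g j) = e a (c j) + e a (h j) - e a (\<phi> c j))"

lemma tw_image_sym: assumes "tw_image g h" shows "tw_image h g"
proof -
  obtain c where c: "c \<in> carrier N" "\<forall>j\<in>K. \<forall>a\<in>I. e a (g j) = e a (c j) + e a (h j) - e a (\<phi> c j)"
    using assms unfolding tw_image_def ..
  have "e a (h j) = e a ((inv\<^bsub>N\<^esub> c) j) + e a (g j) - e a (\<phi> (inv\<^bsub>N\<^esub> c) j)" if "j \<in> K" "a \<in> I" for j a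
    using c(2) that by (simp only: p.hom_inv[OF c(1)] e_inv_N[OF c(1)] e_inv_N[OF p.hom_closed[OF c(1)]])
  then show ?thesis unfolding tw_image_def by (intro bexI[OF _ N.inv_closed[OF c(1)]] ballI)
qed

lemma tw_image_trans: assumes "tw_image g h" "tw_image h k" shows "tw_image g k"
proof -
  obtain c where c: "c \<in> carrier N" "\<forall>j\<in>K. \<forall>a\<in>I. e a (g j) = e a (c j) + e a (h j) - e a (\<phi> c j)"
    using assms(1) unfolding tw_image_def ..
  obtain d where d: "d \<in> carrier N" "\<forall>j\<in>K. \<forall>a\<in>I. e a (h j) = e a (d j) + e a (k j) - e a (\<phi> d j)"
    using assms(2) unfolding tw_image_def ..
  have "e a (g j) = e a ((c \<otimes>\<^bsub>N\<^esub> d) j) + e a (k j) - e a (\<phi> (c \<otimes>\<^bsub>N\<^esub> d) j)" if "j \<in> K" "a \<in> I" for j a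
    using c(2) d(2) that by (simp only: e_mult_N[OF c(1) d(1)] e_phi_mult[OF c(1) d(1)])
  then show ?thesis unfolding tw_image_def by (intro bexI[OF _ N.m_closed[OF c(1) d(1)]] ballI)
qed

text \<open>Equivalent elements satisfy the same choice predicate, so the choice depends only on the
  class. The chosen function need not lie in \<open>N\<close>; it serves only through its
  exponents.\<close>

definition canon :: "('i \<Rightarrow> 'a) \<Rightarrow> ('i \<Rightarrow> 'a)" where
  "canon g = (SOME h. tw_image g h)"

lemma canon_cong: assumes "tw_image g h" shows "canon g = canon h"
proof -
  have "tw_image g k \<longleftrightarrow> tw_image h k" for k
    using tw_image_trans[OF assms, of k] tw_image_trans[OF tw_image_sym[OF assms], of k] by (rule iffI[rotated])
  then show ?thesis by (simp only: canon_def)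
qed

text \<open>On a set of representatives that are equal modulo the centre as soon as they are equivalent
  modulo the centre, conjugators are central, and there \<open>\<phi>\<close> and \<open>\<phi>'\<close> agree.\<close>

lemma reidemeister_eq_if_no_fixed_points:
  assumes fx: "\<And>c. \<lbrakk>c \<in> carrier N; \<And>j a. \<lbrakk>j \<in> K; a \<in> I\<rbrakk> \<Longrightarrow> e a (\<phi> c j) = e a (c j)\<rbrakk> \<Longrightarrow> central c"
  shows "reidemeister N \<phi> = reidemeister N \<phi>'"
proof -
  define R where "R f = twisted_conj N f" for f
  have R_iff: "(t, u) \<in> R f \<longleftrightarrow> t \<in> carrier N \<and> u \<in> carrier N \<and>
      (\<exists>c\<in>carrier N. t = c \<otimes>\<^bsub>N\<^esub> u \<otimes>\<^bsub>N\<^esub> inv\<^bsub>N\<^esub> f c)" for t u f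
    unfolding R_def twisted_conj_def by (rule HOL.trans[OF mem_Collect_eq]) (simp only: case_prod_conv)
  have eqR: "equiv (carrier N) (R f)" if "f = \<phi> \<or> f = \<phi>'" for f
    unfolding R_def using that N.twisted_conj_equiv[OF p.homh] N.twisted_conj_equiv[OF phi'_hom] by (elim disjE) (simp_all only:)
  have tw: "tw_image t u" if f: "f = \<phi> \<or> f = \<phi>'" and tu: "(t, u) \<in> R f" for f t u
  proof -
    obtain c where c: "u \<in> carrier N" "c \<in> carrier N" "t = c \<otimes>\<^bsub>N\<^esub> u \<otimes>\<^bsub>N\<^esub> inv\<^bsub>N\<^esub> f c"
      using tu unfolding R_iff by (elim conjE bexE)
    have "e a (t j) = e a (c j) + e a (u j) - e a (\<phi> c j)" if "j \<in> K" "a \<in> I" for j a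
      unfolding c(3) by (rule e_twist[OF f c(2,1) that])
    then show ?thesis unfolding tw_image_def by (intro bexI[OF _ c(2)] ballI)
  qed
  \<comment> \<open>Elements of \<open>T\<close> that are equivalent modulo the centre share the
    exponents of one \<open>canon\<close> value.\<close>
  define T where "T = {g \<in> carrier N. same_image g (canon g)}"
  have cov: "\<exists>t\<in>T. (g, t) \<in> R f" if f: "f = \<phi> \<or> f = \<phi>'" and g: "g \<in> carrier N" for f g
  proof -
    have "tw_image g g" using tw[OF f] eqR[OF f] g by (meson equiv_class_self Image_singleton_iff)
    then have gc: "tw_image g (canon g)" unfolding canon_def by (rule someI[of "tw_image g"])
    obtain c where c: "c \<in> carrier N"
      "\<forall>j\<in>K. \<forall>a\<in>I. e a (canon g j) = e a (c j) + e a (g j) - e a (\<phi> c j)"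
      using tw_image_sym[OF gc] unfolding tw_image_def ..
    have fc: "f c \<in> carrier N" using f p.hom_closed[OF c(1)] phi'_closed[OF c(1)] by (elim disjE) (simp_all only:)
    define t where "t = c \<otimes>\<^bsub>N\<^esub> g \<otimes>\<^bsub>N\<^esub> inv\<^bsub>N\<^esub> f c"
    have tN: "t \<in> carrier N"
      unfolding t_def by (rule N.m_closed[OF N.m_closed[OF c(1) g] N.inv_closed[OF fc]])
    have tg: "(t, g) \<in> R f" unfolding R_iff using tN g c(1) t_def by blast
    have "canon t = canon g" by (rule canon_cong[OF tw[OF f tg]])
    moreover have "e a (t j) = e a (canon g j)" if "j \<in> K" "a \<in> I" for j a
      unfolding t_def using e_twist[OF f c(1) g that] c(2) that by simp
    ultimately have "t \<in> T" using tN by (simp add: T_def same_image_def del: carrier_product_group)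
    moreover have "(g, t) \<in> R f" using eqR[OF f] tg by (meson equivE symE)
    ultimately show ?thesis by (intro bexI[of _ t])
  qed
  have same: "(t, u) \<in> R f'" if f: "f = \<phi> \<or> f = \<phi>'" and f': "f' = \<phi> \<or> f' = \<phi>'"
    and t: "t \<in> T" and u: "u \<in> T" and tu: "(t, u) \<in> R f" for f f' t u
  proof -
    obtain c where c: "t \<in> carrier N" "u \<in> carrier N" "c \<in> carrier N" "t = c \<otimes>\<^bsub>N\<^esub> u \<otimes>\<^bsub>N\<^esub> inv\<^bsub>N\<^esub> f c"
      using tu unfolding R_iff by (elim conjE bexE)
    have can: "canon t = canon u" by (rule canon_cong[OF tw[OF f tu]])
    \<comment> \<open>\<open>t\<close> and \<open>u\<close> have equal exponents, so the twisting
      relation leaves a vector fixed by \<open>\<phi>\<close>.\<close>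
    have "central c"
    proof (rule fx[OF c(3)])
      fix j a assume ja: "j \<in> K" "a \<in> I"
      have "e a (t j) = e a (u j)" using t u can ja by (simp add: T_def same_image_def)
      then show "e a (\<phi> c j) = e a (c j)" using e_twist[OF f c(3,2) ja] c(4) by simp
    qed
    then have "f c = f' c" using phi'_central[of c] f f' by (elim disjE) (simp_all only:)
    then show ?thesis unfolding R_iff using c by metis
  qed
  have "ecard (carrier N // R \<phi>) = ecard (carrier N // R \<phi>')"
  proof (rule ecard_quotient_eq[where T = T and f = "\<lambda>x. x"])
    show "(t, u) \<in> R \<phi> \<longleftrightarrow> (t, u) \<in> R \<phi>'" if "t \<in> T" "u \<in> T" for t u
      using same[OF disjI1[OF HOL.refl] disjI2[OF HOL.refl] that] same[OF disjI2[OF HOL.refl] disjI1[OF HOL.refl] that] by (rule iffI)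
    show "(\<lambda>x. x) ` T \<subseteq> carrier N" unfolding T_def by (simp only: image_ident Collect_subset)
    show "T \<subseteq> carrier N" unfolding T_def by (rule Collect_restrict)
    show "equiv (carrier N) (R \<phi>)" by (rule eqR[OF disjI1[OF HOL.refl]])
    show "equiv (carrier N) (R \<phi>')" by (rule eqR[OF disjI2[OF HOL.refl]])
    show "\<exists>t\<in>T. (g, t) \<in> R \<phi>" if "g \<in> carrier N" for g
      by (rule cov[OF disjI1[OF HOL.refl] that])
    show "\<exists>t\<in>T. (g, t) \<in> R \<phi>'" if "g \<in> carrier N" for g
      by (rule cov[OF disjI2[OF HOL.refl] that])
  qed
  then show ?thesis by (simp only: reidemeister_ecard R_def)
qed

text \<open>If one of the two numbers is finite, \<open>fixed_point_central\<close> for that map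
  excludes nonzero fixed vectors of the action modulo the centre, which both maps share.\<close>

lemma reidemeister_eq: "reidemeister N \<phi> = reidemeister N \<phi>'"
proof (cases "reidemeister N \<phi> = \<infinity> \<and> reidemeister N \<phi>' = \<infinity>")
  case False
  then obtain f where f: "f \<in> hom N N" "f = \<phi> \<or> f = \<phi>'" "reidemeister N f \<noteq> \<infinity>"
    using p.homh phi'_hom by blast
  show ?thesis
  proof (rule reidemeister_eq_if_no_fixed_points, rule fixed_point_central[OF f(1) _ f(3)])
    show "e a (f g j) = e a (\<phi> g j)" if "g \<in> carrier N" "j \<in> K" "a \<in> I" for g j a
      using f(2) e_phi'[OF that] by (elim disjE) (simp_all only:)
  qed
qed simp

end

lemma (in complement_connected_group) reidemeister_pow_group_wreath:
  assumes "finite K" "\<phi> \<in> auto (pow_group K)"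
  shows "\<exists>\<rho> \<psi>. \<rho> ` K \<subseteq> K \<and> (\<forall>j\<in>K. \<psi> j \<in> iso G G) \<and>
    reidemeister (pow_group K) \<phi> = reidemeister (pow_group K) (wreath G K \<rho> \<psi>)"
proof -
  have "\<phi> \<in> iso (pow_group K) (pow_group K)"
    using assms(2) by (simp add: group.auto_iff[OF group_pow_group] iso_def del: carrier_product_group)
  then interpret power_automorphism G I D e K \<phi>
    by unfold_locales (use assms(1) in auto)
  show ?thesis
    using rho_bij psi_iso reidemeister_eq unfolding \<phi>'_def bij_betw_def by (metis subset_refl)
qed

lemma (in complement_connected_group) spec_R_pow_group:
  assumes "k \<ge> 1"
  shows "spec_R (pow_group {1..k::nat}) =
    (\<Union>i\<in>{1..k}. {(\<Prod>m\<in>{1..i}. R m) | R. \<forall>m\<in>{1..i}. R m \<in> spec_R G})" (is "_ = ?U")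
proof
  show "spec_R (pow_group {1..k}) \<subseteq> ?U"
  proof
    fix r assume "r \<in> spec_R (pow_group {1..k})"
    then obtain \<phi> where \<phi>: "\<phi> \<in> auto (pow_group {1..k})" "r = reidemeister (pow_group {1..k}) \<phi>"
      unfolding spec_R_def by blast
    obtain \<rho> \<psi> where "\<rho> ` {1..k} \<subseteq> {1..k}" "\<forall>j\<in>{1..k}. \<psi> j \<in> iso G G"
      "r = reidemeister (pow_group {1..k}) (wreath G {1..k} \<rho> \<psi>)"
      using reidemeister_pow_group_wreath[OF finite_atLeastAtMost \<phi>(1)] \<phi>(2) by blast
    then show "r \<in> ?U" using reidemeister_wreath_prod_interval[of \<rho> k \<psi>] assms by blast
  qed
  show "?U \<subseteq> spec_R (pow_group {1..k})"
  proof
    fix r assume "r \<in> ?U"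
    then obtain i R where iR: "i \<in> {1..k}" "r = (\<Prod>m\<in>{1..i}. R m)" "\<forall>m\<in>{1..i}. R m \<in> spec_R G" by blast
    then show "r \<in> spec_R (pow_group {1..k})" using prod_in_spec_R_pow_group[of i k R] by simp
  qed
qed

section \<open>Presented groups\<close>

lemma append_words: "u @ v \<in> words S \<longleftrightarrow> u \<in> words S \<and> v \<in> words S"
  by (simp add: words_def)

lemma Nil_words [simp]: "[] \<in> words S"
  by (simp add: words_def)

lemma Cons_words: "l # w \<in> words S \<longleftrightarrow> fst l \<in> S \<and> w \<in> words S"
  by (cases l) (simp add: words_def)

lemma pres_eqv_words: "(u, v) \<in> pres_eqv S R \<Longrightarrow> u \<in> words S \<and> v \<in> words S"
  by (induction rule: pres_eqv.induct) (auto simp: append_words Cons_words)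

lemma equiv_pres_eqv: "equiv (words S) (pres_eqv S R)"
proof (rule equivI)
  show "pres_eqv S R \<subseteq> words S \<times> words S" using pres_eqv_words by auto
  show "refl_on (words S) (pres_eqv S R)" by (auto simp: refl_on_def intro: pres_eqv.refl)
  show "sym_on UNIV (pres_eqv S R)" by (auto intro: symI pres_eqv.sym)
  show "trans_on UNIV (pres_eqv S R)" by (auto intro: transI pres_eqv.trans)
qed

lemma pres_eqv_append:
  assumes "(u, u') \<in> pres_eqv S R" "(v, v') \<in> pres_eqv S R"
  shows "(u @ v, u' @ v') \<in> pres_eqv S R"
proof -
  have w: "u \<in> words S" "u' \<in> words S" "v \<in> words S" "v' \<in> words S"
    using assms pres_eqv_words by blast+
  have "(u @ v, u' @ v) \<in> pres_eqv S R" using pres_eqv.ctx[OF assms(1) Nil_words w(3)] by simp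
  moreover have "(u' @ v, u' @ v') \<in> pres_eqv S R" using pres_eqv.ctx[OF assms(2) w(2) Nil_words] by simp
  ultimately show ?thesis by (rule pres_eqv.trans)
qed

definition pres_class :: "'g set \<Rightarrow> 'g word set \<Rightarrow> 'g word \<Rightarrow> 'g word set" where
  "pres_class S R w = pres_eqv S R `` {w}"

lemma pres_class_eq_iff:
  "\<lbrakk>u \<in> words S; v \<in> words S\<rbrakk> \<Longrightarrow> pres_class S R u = pres_class S R v \<longleftrightarrow> (u, v) \<in> pres_eqv S R"
  unfolding pres_class_def by (rule eq_equiv_class_iff[OF equiv_pres_eqv])

lemma carrier_presented_group: "carrier (presented_group S R) = pres_class S R ` words S"
  by (auto simp: presented_group_def pres_class_def quotient_def)

lemma one_presented_group: "\<one>\<^bsub>presented_group S R\<^esub> = pres_class S R []"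
  by (simp add: presented_group_def pres_class_def)

lemma mult_presented_group:
  assumes "u \<in> words S" "v \<in> words S"
  shows "pres_class S R u \<otimes>\<^bsub>presented_group S R\<^esub> pres_class S R v = pres_class S R (u @ v)"
proof -
  have "pres_class S R (a @ b) = pres_class S R (u @ v)"
    if "a \<in> pres_class S R u" "b \<in> pres_class S R v" for a b
  proof -
    have "(u @ v, a @ b) \<in> pres_eqv S R"
      using that by (intro pres_eqv_append) (simp_all add: pres_class_def)
    then show ?thesis unfolding pres_class_def by (rule equiv_class_eq[OF equiv_pres_eqv, symmetric])
  qed
  moreover have "u \<in> pres_class S R u" "v \<in> pres_class S R v"
    using assms by (simp_all add: pres_class_def pres_eqv.refl)
  ultimately have "(\<Union>a\<in>pres_class S R u. \<Union>b\<in>pres_class S R v. pres_class S R (a @ b)) =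
      pres_class S R (u @ v)" by blast
  then show ?thesis by (simp add: presented_group_def pres_class_def)
qed

definition inv_word :: "'g word \<Rightarrow> 'g word" where
  "inv_word w = rev (map (\<lambda>(s, b). (s, \<not> b)) w)"

lemma inv_word_words: "w \<in> words S \<Longrightarrow> inv_word w \<in> words S"
  by (auto simp: inv_word_def words_def)

lemma inv_word_cancel: "w \<in> words S \<Longrightarrow> (inv_word w @ w, []) \<in> pres_eqv S R"
proof (induction w)
  case Nil
  then show ?case by (simp add: inv_word_def pres_eqv.refl)
next
  case (Cons l w)
  obtain s b where l: "l = (s, b)" by (cases l)
  have sw: "s \<in> S" "w \<in> words S" using Cons l by (auto simp: Cons_words)
  have "(inv_word w @ [(s, \<not> b), (s, b)] @ w, inv_word w @ [] @ w) \<in> pres_eqv S R"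
    using pres_eqv.cancel[OF sw(1), of "\<not> b" R] sw by (intro pres_eqv.ctx inv_word_words) auto
  then show ?case using Cons.IH[OF sw(2)] l
    by (auto simp: inv_word_def intro: pres_eqv.trans)
qed

lemma group_presented_group: "group (presented_group S R)"
proof (rule groupI)
  let ?P = "presented_group S R"
  show "x \<otimes>\<^bsub>?P\<^esub> y \<in> carrier ?P" if "x \<in> carrier ?P" "y \<in> carrier ?P" for x y
    using that by (auto simp: carrier_presented_group mult_presented_group append_words)
  show "\<one>\<^bsub>?P\<^esub> \<in> carrier ?P" by (auto simp: carrier_presented_group one_presented_group)
  show "x \<otimes>\<^bsub>?P\<^esub> y \<otimes>\<^bsub>?P\<^esub> z = x \<otimes>\<^bsub>?P\<^esub> (y \<otimes>\<^bsub>?P\<^esub> z)"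
    if "x \<in> carrier ?P" "y \<in> carrier ?P" "z \<in> carrier ?P" for x y z
    using that by (auto simp: carrier_presented_group mult_presented_group append_words)
  show "\<one>\<^bsub>?P\<^esub> \<otimes>\<^bsub>?P\<^esub> x = x" if "x \<in> carrier ?P" for x
    using that by (auto simp: carrier_presented_group one_presented_group mult_presented_group)
  show "\<exists>y\<in>carrier ?P. y \<otimes>\<^bsub>?P\<^esub> x = \<one>\<^bsub>?P\<^esub>" if x: "x \<in> carrier ?P" for x
  proof -
    obtain w where w: "w \<in> words S" "x = pres_class S R w" using x by (auto simp: carrier_presented_group)
    have "pres_class S R (inv_word w) \<otimes>\<^bsub>?P\<^esub> x = \<one>\<^bsub>?P\<^esub>"
      using w inv_word_words[OF w(1)] inv_word_cancel[OF w(1)]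
      by (simp add: mult_presented_group one_presented_group pres_class_eq_iff append_words)
    then show ?thesis using inv_word_words[OF w(1)] by (auto simp: carrier_presented_group)
  qed
qed

lemma inv_presented_group:
  assumes "s \<in> S"
  shows "inv\<^bsub>presented_group S R\<^esub> (pres_class S R [(s, False)]) = pres_class S R [(s, True)]"
proof (rule group.inv_equality[OF group_presented_group])
  show "pres_class S R [(s, True)] \<otimes>\<^bsub>presented_group S R\<^esub> pres_class S R [(s, False)] = \<one>\<^bsub>presented_group S R\<^esub>"
    using assms pres_eqv.cancel[OF assms, of True R]
    by (simp add: mult_presented_group one_presented_group pres_class_eq_iff Cons_words)
qed (use assms in \<open>auto simp: carrier_presented_group Cons_words\<close>)

primrec eval_word :: "('a, 'b) monoid_scheme \<Rightarrow> ('g \<Rightarrow> 'a) \<Rightarrow> 'g word \<Rightarrow> 'a" where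
  "eval_word H x [] = \<one>\<^bsub>H\<^esub>"
| "eval_word H x (l # w) = (if snd l then inv\<^bsub>H\<^esub> x (fst l) else x (fst l)) \<otimes>\<^bsub>H\<^esub> eval_word H x w"

context group begin

lemma eval_word_closed: "\<lbrakk>x ` S \<subseteq> carrier G; w \<in> words S\<rbrakk> \<Longrightarrow> eval_word G x w \<in> carrier G"
  by (induction w) (auto simp: Cons_words)

lemma eval_word_append:
  "\<lbrakk>x ` S \<subseteq> carrier G; u \<in> words S; v \<in> words S\<rbrakk> \<Longrightarrow>
    eval_word G x (u @ v) = eval_word G x u \<otimes> eval_word G x v"
proof (induction u)
  case Nil
  then show ?case using eval_word_closed[OF Nil(1,3)] by simp
next
  case (Cons l u)
  have "u \<in> words S" "x (fst l) \<in> carrier G" using Cons.prems by (auto simp: Cons_words)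
  then show ?case
    using Cons eval_word_closed[OF Cons.prems(1) \<open>u \<in> words S\<close>] eval_word_closed[OF Cons.prems(1,3)]
    by (simp add: m_assoc)
qed

lemma eval_word_pres_eqv:
  assumes x: "x ` S \<subseteq> carrier G" and R: "\<And>r. \<lbrakk>r \<in> R; r \<in> words S\<rbrakk> \<Longrightarrow> eval_word G x r = \<one>"
  shows "(u, v) \<in> pres_eqv S R \<Longrightarrow> eval_word G x u = eval_word G x v"
proof (induction rule: pres_eqv.induct)
  case (ctx w w' u v)
  then show ?case using pres_eqv_words[OF ctx(1)]
    by (simp add: eval_word_append[OF x] append_words)
next
  case (cancel s b)
  then show ?case using x by auto
next
  case (rel r)
  then show ?case using R by simp
qed auto

text \<open>The universal property of a presentation: once the relators evaluate to \<one>,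
  evaluation is constant on classes of words.\<close>

lemma presented_group_hom:
  assumes x: "x ` S \<subseteq> carrier G" and R: "\<And>r. \<lbrakk>r \<in> R; r \<in> words S\<rbrakk> \<Longrightarrow> eval_word G x r = \<one>"
  obtains f where "f \<in> hom (presented_group S R) G"
    "\<And>w. w \<in> words S \<Longrightarrow> f (pres_class S R w) = eval_word G x w"
proof -
  define f where "f A = eval_word G x (SOME w. w \<in> A)" for A
  have f: "f (pres_class S R w) = eval_word G x w" if w: "w \<in> words S" for w
  proof -
    have "w \<in> pres_class S R w" using w by (auto simp: pres_class_def intro: pres_eqv.refl)
    then have "(SOME u. u \<in> pres_class S R w) \<in> pres_class S R w" by (rule someI)
    then have "(w, SOME u. u \<in> pres_class S R w) \<in> pres_eqv S R" by (simp add: pres_class_def)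
    then show ?thesis unfolding f_def using eval_word_pres_eqv[OF x R] by (metis (no_types))
  qed
  have "f \<in> hom (presented_group S R) G"
    by (rule homI) (auto simp: carrier_presented_group f mult_presented_group append_words
        eval_word_append[OF x] eval_word_closed[OF x])
  then show ?thesis using f that by blast
qed

text \<open>An additive \<open>h\<close> is a homomorphism from the integers, so a closed formula
  for integer powers needs no induction and no case distinction on signs.\<close>

lemma int_pow_eqI:
  fixes h :: "int \<Rightarrow> 'a"
  assumes h: "\<And>k. h k \<in> carrier G" and add: "\<And>k l. h (k + l) = h k \<otimes> h l"
  shows "h 1 [^] (k::int) = h k"
proof -
  interpret h: group_hom integer_group G h
    by (rule group_hom.intro[OF group_integer_group group_axioms])
      (use h add in \<open>auto simp: group_hom_axioms_def hom_def integer_group_def\<close>)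
  show ?thesis using h.hom_int_pow[of 1 k] by simp
qed

end

section \<open>The Magnus model\<close>

definition nonadj :: "graph \<Rightarrow> nat \<Rightarrow> nat \<Rightarrow> bool" where
  "nonadj \<Gamma> a b \<longleftrightarrow> a < fst \<Gamma> \<and> b < fst \<Gamma> \<and> a \<noteq> b \<and> \<not> snd \<Gamma> a b"

text \<open>The multilinear part of degree at most 2 of the Magnus expansion: \<open>v a\<close> and \<open>y a b\<close> are the coefficients
  of \<open>X\<^sub>a\<close> and \<open>X\<^sub>a X\<^sub>b\<close>, and the condition on \<open>y\<close> is the shuffle relation. No orientation of the
  edges is involved, so graph isomorphisms act on this model by relabelling.\<close>

definition magnus_group :: "graph \<Rightarrow> ((nat \<Rightarrow> int) \<times> (nat \<Rightarrow> nat \<Rightarrow> int)) monoid" where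
  "magnus_group \<Gamma> =
     \<lparr>carrier = {(v, y). (\<forall>a. a \<ge> fst \<Gamma> \<longrightarrow> v a = 0) \<and>
        (\<forall>a b. if nonadj \<Gamma> a b then y a b + y b a = v a * v b else y a b = 0)},
      monoid.mult = (\<lambda>(v, y) (w, z). (\<lambda>a. v a + w a,
        \<lambda>a b. if nonadj \<Gamma> a b then y a b + z a b + v a * w b else 0)),
      one = (\<lambda>_. 0, \<lambda>_ _. 0)\<rparr>"

lemma carrier_magnus: "(v, y) \<in> carrier (magnus_group \<Gamma>) \<longleftrightarrow> (\<forall>a. a \<ge> fst \<Gamma> \<longrightarrow> v a = 0) \<and>
    (\<forall>a b. nonadj \<Gamma> a b \<longrightarrow> y a b + y b a = v a * v b) \<and> (\<forall>a b. \<not> nonadj \<Gamma> a b \<longrightarrow> y a b = 0)"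
  by (auto simp: magnus_group_def)

lemma mult_magnus: "(v, y) \<otimes>\<^bsub>magnus_group \<Gamma>\<^esub> (w, z) =
    (\<lambda>a. v a + w a, \<lambda>a b. if nonadj \<Gamma> a b then y a b + z a b + v a * w b else 0)"
  by (simp add: magnus_group_def)

lemma one_magnus: "\<one>\<^bsub>magnus_group \<Gamma>\<^esub> = (\<lambda>_. 0, \<lambda>_ _. 0)"
  by (simp add: magnus_group_def)

lemma nonadj_sym: "simple_graph \<Gamma> \<Longrightarrow> nonadj \<Gamma> a b \<longleftrightarrow> nonadj \<Gamma> b a"
  by (auto simp: nonadj_def simple_graph_def)

lemma group_magnus:
  assumes sg: "simple_graph \<Gamma>" shows "group (magnus_group \<Gamma>)"
proof (rule groupI)
  let ?M = "magnus_group \<Gamma>"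
  show "g \<otimes>\<^bsub>?M\<^esub> h \<in> carrier ?M" if "g \<in> carrier ?M" "h \<in> carrier ?M" for g h
  proof -
    obtain v y w z where gh: "g = (v, y)" "h = (w, z)" by (metis surj_pair)
    have "(if nonadj \<Gamma> a b then y a b + z a b + v a * w b else 0) +
        (if nonadj \<Gamma> b a then y b a + z b a + v b * w a else 0) = (v a + w a) * (v b + w b)"
      if "nonadj \<Gamma> a b" for a b
    proof -
      have "y a b + y b a = v a * v b" "z a b + z b a = w a * w b"
        using \<open>g \<in> carrier ?M\<close> \<open>h \<in> carrier ?M\<close> that by (simp_all add: gh carrier_magnus)
      moreover have "nonadj \<Gamma> b a" using that nonadj_sym[OF sg] by blast
      ultimately show ?thesis using that by (simp add: algebra_simps)
    qed
    then show ?thesis using that by (simp add: gh mult_magnus carrier_magnus)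
  qed
  show "\<one>\<^bsub>?M\<^esub> \<in> carrier ?M" by (simp add: one_magnus carrier_magnus)
  show "g \<otimes>\<^bsub>?M\<^esub> h \<otimes>\<^bsub>?M\<^esub> k = g \<otimes>\<^bsub>?M\<^esub> (h \<otimes>\<^bsub>?M\<^esub> k)" for g h k
    by (cases g; cases h; cases k) (auto simp: mult_magnus algebra_simps fun_eq_iff)
  show "\<one>\<^bsub>?M\<^esub> \<otimes>\<^bsub>?M\<^esub> g = g" if "g \<in> carrier ?M" for g
    using that by (cases g) (auto simp: mult_magnus one_magnus carrier_magnus fun_eq_iff)
  show "\<exists>h\<in>carrier ?M. h \<otimes>\<^bsub>?M\<^esub> g = \<one>\<^bsub>?M\<^esub>" if g: "g \<in> carrier ?M" for g
  proof -
    obtain v y where vy: "g = (v, y)" by (metis surj_pair)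
    \<comment> \<open>The quadratic part of the inverse is \<open>v a * v b - y a b\<close>, which
      the shuffle relation turns into the transpose of \<open>y\<close>.\<close>
    let ?h = "(\<lambda>a. - v a, \<lambda>a b. if nonadj \<Gamma> a b then y b a else 0)"
    have s: "y a b + y b a = v a * v b" "nonadj \<Gamma> b a" if "nonadj \<Gamma> a b" for a b
      using g that nonadj_sym[OF sg] by (auto simp: vy carrier_magnus)
    have "?h \<in> carrier ?M" using g s by (auto simp: vy carrier_magnus add.commute)
    moreover have "?h \<otimes>\<^bsub>?M\<^esub> g = \<one>\<^bsub>?M\<^esub>"
      using s by (auto simp: vy mult_magnus one_magnus fun_eq_iff add.commute)
    ultimately show ?thesis by blast
  qed
qed

lemma isoI_inverse:
  assumes "f \<in> hom G H" "\<And>y. y \<in> carrier H \<Longrightarrow> g y \<in> carrier G"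
    "\<And>x. x \<in> carrier G \<Longrightarrow> g (f x) = x" "\<And>y. y \<in> carrier H \<Longrightarrow> f (g y) = y"
  shows "G \<cong> H"
proof -
  have "bij_betw f (carrier G) (carrier H)"
    using assms by (intro bij_betw_byWitness[where f' = g]) (auto simp: hom_def)
  then show ?thesis using assms(1) by (auto simp: is_iso_def iso_def)
qed

lemma graph_iso_magnus:
  assumes "graph_iso \<Gamma> \<Delta>" "simple_graph \<Gamma>" "simple_graph \<Delta>"
  shows "magnus_group \<Gamma> \<cong> magnus_group \<Delta>"
proof -
  obtain f where bij: "bij_betw f {0..<fst \<Gamma>} {0..<fst \<Delta>}"
    and adj: "\<And>i j. \<lbrakk>i < fst \<Gamma>; j < fst \<Gamma>\<rbrakk> \<Longrightarrow> snd \<Gamma> i j \<longleftrightarrow> snd \<Delta> (f i) (f j)"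
    using assms(1) unfolding graph_iso_def by blast
  define g where "g = inv_into {0..<fst \<Gamma>} f"
  have f: "f i < fst \<Delta>" if "i < fst \<Gamma>" for i using bij that by (auto simp: bij_betw_def)
  have g: "g i < fst \<Gamma>" if "i < fst \<Delta>" for i
  proof -
    have "g i \<in> {0..<fst \<Gamma>}"
      unfolding g_def using bij that by (intro inv_into_into) (auto simp: bij_betw_def)
    then show ?thesis by simp
  qed
  have gf: "g (f i) = i" if "i < fst \<Gamma>" for i
    using bij that by (simp add: g_def bij_betw_inv_into_left)
  have fg: "f (g i) = i" if "i < fst \<Delta>" for i
    using bij that by (simp add: g_def bij_betw_inv_into_right)
  have nf: "nonadj \<Delta> (f i) (f j) \<longleftrightarrow> nonadj \<Gamma> i j" if "i < fst \<Gamma>" "j < fst \<Gamma>" for i j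
    using that f adj gf unfolding nonadj_def by metis
  have ng: "nonadj \<Gamma> (g i) (g j) \<longleftrightarrow> nonadj \<Delta> i j" if "i < fst \<Delta>" "j < fst \<Delta>" for i j
    using nf[of "g i" "g j"] that g fg by simp
  have nlt: "a < fst \<Theta>" "b < fst \<Theta>" if "nonadj \<Theta> a b" for \<Theta> a b
    using that by (simp_all add: nonadj_def)
  \<comment> \<open>Pullback of both coefficient families along \<open>k\<close>, with zeros
    restored outside the support; one formula serves both directions.\<close>
  define F where "F = (\<lambda>(\<Theta> :: graph, k :: nat \<Rightarrow> nat) (v :: nat \<Rightarrow> int, y :: nat \<Rightarrow> nat \<Rightarrow> int).
    (\<lambda>a. if a < fst \<Theta> then v (k a) else (0 :: int), \<lambda>a b. if nonadj \<Theta> a b then y (k a) (k b) else 0 :: int))"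
  show ?thesis
  proof (rule isoI_inverse[where f = "F (\<Delta>, g)" and g = "F (\<Gamma>, f)"])
    show "F (\<Delta>, g) \<in> hom (magnus_group \<Gamma>) (magnus_group \<Delta>)"
    proof (rule homI)
      show "F (\<Delta>, g) x \<in> carrier (magnus_group \<Delta>)" if "x \<in> carrier (magnus_group \<Gamma>)" for x
        using that nlt[of \<Delta>] nonadj_sym[OF assms(3)] ng by (cases x) (auto simp: F_def carrier_magnus)
      show "F (\<Delta>, g) (x \<otimes>\<^bsub>magnus_group \<Gamma>\<^esub> x') =
          F (\<Delta>, g) x \<otimes>\<^bsub>magnus_group \<Delta>\<^esub> F (\<Delta>, g) x'" for x x'
        using nlt[of \<Delta>] ng by (cases x; cases x') (auto simp: F_def mult_magnus fun_eq_iff)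
    qed
    show "F (\<Gamma>, f) y \<in> carrier (magnus_group \<Gamma>)" if "y \<in> carrier (magnus_group \<Delta>)" for y
      using that nlt[of \<Gamma>] nonadj_sym[OF assms(2)] nf by (cases y) (auto simp: F_def carrier_magnus)
    show "F (\<Gamma>, f) (F (\<Delta>, g) x) = x" if "x \<in> carrier (magnus_group \<Gamma>)" for x
      using that nlt[of \<Gamma>] nf f gf by (cases x) (auto simp: F_def carrier_magnus fun_eq_iff)
    show "F (\<Delta>, g) (F (\<Gamma>, f) x) = x" if "x \<in> carrier (magnus_group \<Delta>)" for x
      using that nlt[of \<Delta>] ng g fg by (cases x) (auto simp: F_def carrier_magnus fun_eq_iff)
  qed
qed

lemma fst_join [simp]: "fst (join \<Gamma> \<Delta>) = fst \<Gamma> + fst \<Delta>"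
  by (simp add: join_def Let_def)

lemma simple_graph_join: "\<lbrakk>simple_graph \<Gamma>; simple_graph \<Delta>\<rbrakk> \<Longrightarrow> simple_graph (join \<Gamma> \<Delta>)"
  unfolding simple_graph_def join_def Let_def fst_conv snd_conv by (intro allI impI) (elim disjE; simp; fastforce)

lemma nonadj_join: "nonadj (join \<Gamma> \<Delta>) a b \<longleftrightarrow>
    nonadj \<Gamma> a b \<or> (a \<ge> fst \<Gamma> \<and> b \<ge> fst \<Gamma> \<and> nonadj \<Delta> (a - fst \<Gamma>) (b - fst \<Gamma>))"
  unfolding nonadj_def join_def Let_def fst_conv snd_conv by (cases "a < fst \<Gamma>"; cases "b < fst \<Gamma>") auto

text \<open>Vertices in different parts of a join are adjacent, so no coefficient
  \<open>y a b\<close> mixes the parts and the model splits into two blocks.\<close>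

lemma magnus_join:
  assumes "simple_graph \<Gamma>" "simple_graph \<Delta>"
  shows "magnus_group (join \<Gamma> \<Delta>) \<cong> magnus_group \<Gamma> \<times>\<times> magnus_group \<Delta>"
proof -
  let ?n = "fst \<Gamma>"
  define f where "f = (\<lambda>(v :: nat \<Rightarrow> int, y :: nat \<Rightarrow> nat \<Rightarrow> int).
    ((\<lambda>a. if a < ?n then v a else 0, \<lambda>a b. if nonadj \<Gamma> a b then y a b else 0),
     (\<lambda>a. v (a + ?n), \<lambda>a b. y (a + ?n) (b + ?n))))"
  define g where "g = (\<lambda>((v :: nat \<Rightarrow> int, y :: nat \<Rightarrow> nat \<Rightarrow> int), (w :: nat \<Rightarrow> int, z :: nat \<Rightarrow> nat \<Rightarrow> int)).
    (\<lambda>a. if a < ?n then v a else w (a - ?n),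
     \<lambda>a b. if a < ?n \<and> b < ?n then y a b else if a \<ge> ?n \<and> b \<ge> ?n then z (a - ?n) (b - ?n) else 0))"
  have s: "nonadj (join \<Gamma> \<Delta>) (a + ?n) (b + ?n) \<longleftrightarrow> nonadj \<Delta> a b" for a b
    by (auto simp: nonadj_join) (simp_all add: nonadj_def)
  have l: "nonadj (join \<Gamma> \<Delta>) a b \<longleftrightarrow> nonadj \<Gamma> a b" if "a < ?n \<or> b < ?n" for a b
    using that by (auto simp: nonadj_join)
  have lt: "a < ?n" "b < ?n" if "nonadj \<Gamma> a b" for a b
    using that by (simp_all add: nonadj_def)
  show ?thesis
  proof (rule isoI_inverse[where f = f and g = g])
    show "f \<in> hom (magnus_group (join \<Gamma> \<Delta>)) (magnus_group \<Gamma> \<times>\<times> magnus_group \<Delta>)"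
    proof (rule homI)
      show "f x \<in> carrier (magnus_group \<Gamma> \<times>\<times> magnus_group \<Delta>)"
        if "x \<in> carrier (magnus_group (join \<Gamma> \<Delta>))" for x
      proof -
        obtain v y where x: "x = (v, y)" by (metis surj_pair)
        have v: "v a = 0" if "a \<ge> ?n + fst \<Delta>" for a
          using that \<open>x \<in> _\<close> by (simp add: x carrier_magnus)
        have y: "y a b + y b a = v a * v b" if "nonadj (join \<Gamma> \<Delta>) a b" for a b
          using that \<open>x \<in> _\<close> by (simp add: x carrier_magnus)
        have y0: "y a b = 0" if "\<not> nonadj (join \<Gamma> \<Delta>) a b" for a b
          using that \<open>x \<in> _\<close> by (simp add: x carrier_magnus)
        show ?thesis
          using v y0 y[of "_ + ?n" "_ + ?n"] y[OF l[THEN iffD2]] nonadj_sym[OF assms(1)]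
          by (auto simp: x f_def carrier_magnus s dest: lt)
      qed
      show "f (x \<otimes>\<^bsub>magnus_group (join \<Gamma> \<Delta>)\<^esub> x') =
          f x \<otimes>\<^bsub>magnus_group \<Gamma> \<times>\<times> magnus_group \<Delta>\<^esub> f x'" for x x'
        using l lt by (cases x; cases x') (auto simp: f_def mult_magnus s fun_eq_iff)
    qed
    show "g y \<in> carrier (magnus_group (join \<Gamma> \<Delta>))"
      if "y \<in> carrier (magnus_group \<Gamma> \<times>\<times> magnus_group \<Delta>)" for y
    proof -
      obtain v y' w z where y: "y = ((v, y'), (w, z))" by (metis surj_pair)
      show ?thesis using that lt
        by (auto simp: y g_def carrier_magnus nonadj_join)
    qed
    show "g (f x) = x" if "x \<in> carrier (magnus_group (join \<Gamma> \<Delta>))" for x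
    proof -
      have cross: "\<not> nonadj (join \<Gamma> \<Delta>) a b" if "(a < ?n) \<noteq> (b < ?n)" for a b
        using that by (auto simp: nonadj_join dest: lt)
      show ?thesis
        using that l cross by (cases x) (auto simp: f_def g_def carrier_magnus fun_eq_iff)
    qed
    show "f (g y) = y" if "y \<in> carrier (magnus_group \<Gamma> \<times>\<times> magnus_group \<Delta>)" for y
    proof -
      obtain v y' w z where y: "y = ((v, y'), (w, z))" by (metis surj_pair)
      show ?thesis using that lt
        by (auto simp: y f_def g_def carrier_magnus fun_eq_iff)
    qed
  qed
qed

section \<open>Collection of words\<close>

context group begin

text \<open>Conjugation by \<open>x\<close> sends \<open>y\<close> to \<open>y \<otimes> c\<close>,
  and powers of \<open>y \<otimes> c\<close> split because \<open>c\<close> is central.\<close>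

lemma commute_conj_int_pow:
  assumes x: "x \<in> carrier G" "y \<in> carrier G" "c \<in> carrier G"
    and c: "\<And>g. g \<in> carrier G \<Longrightarrow> c \<otimes> g = g \<otimes> c" and yx: "y \<otimes> x = x \<otimes> y \<otimes> c"
  shows "y [^] (k::int) \<otimes> x = x \<otimes> y [^] k \<otimes> c [^] k"
proof -
  have "(inv x \<otimes> y [^] (1::int) \<otimes> x) [^] k = inv x \<otimes> y [^] k \<otimes> x"
  proof (rule int_pow_eqI[where h = "\<lambda>k. inv x \<otimes> y [^] k \<otimes> x"])
    show "inv x \<otimes> y [^] (k::int) \<otimes> x \<in> carrier G" for k using x by simp
    fix k l :: int
    have "inv x \<otimes> y [^] k \<otimes> x \<otimes> (inv x \<otimes> y [^] l \<otimes> x) = inv x \<otimes> y [^] k \<otimes> (x \<otimes> inv x) \<otimes> y [^] l \<otimes> x"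
      using x by (simp only: m_assoc m_closed inv_closed int_pow_closed)
    then show "inv x \<otimes> y [^] (k + l) \<otimes> x = inv x \<otimes> y [^] k \<otimes> x \<otimes> (inv x \<otimes> y [^] l \<otimes> x)"
      using x by (simp add: int_pow_mult m_assoc)
  qed
  then have "inv x \<otimes> y [^] k \<otimes> x = (inv x \<otimes> y \<otimes> x) [^] k" using x by (simp add: int_pow_1)
  also have "inv x \<otimes> y \<otimes> x = y \<otimes> c"
  proof -
    have "inv x \<otimes> y \<otimes> x = inv x \<otimes> (x \<otimes> (y \<otimes> c))" using x yx by (simp add: m_assoc)
    also have "\<dots> = y \<otimes> c" using x by (simp add: m_assoc[symmetric])
    finally show ?thesis .
  qed
  also have "(y \<otimes> c) [^] k = y [^] k \<otimes> c [^] k"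
    using x c[of y] by (intro int_pow_mult_distrib) auto
  finally have "x \<otimes> (inv x \<otimes> y [^] k \<otimes> x) = x \<otimes> (y [^] k \<otimes> c [^] k)" by simp
  then show ?thesis using x by (simp add: m_assoc[symmetric])
qed

lemma central_int_pow:
  assumes "c \<in> carrier G" "\<And>g. g \<in> carrier G \<Longrightarrow> c \<otimes> g = g \<otimes> c" "g \<in> carrier G"
  shows "c [^] (k::int) \<otimes> g = g \<otimes> c [^] k"
  using commute_conj_int_pow[OF assms(3,1) one_closed, of k] assms by simp

end

primrec ordered_prod :: "('a, 'b) monoid_scheme \<Rightarrow> (nat \<Rightarrow> 'a) \<Rightarrow> (nat \<Rightarrow> int) \<Rightarrow> nat \<Rightarrow> 'a" where
  "ordered_prod G x v 0 = \<one>\<^bsub>G\<^esub>"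
| "ordered_prod G x v (Suc m) = ordered_prod G x v m \<otimes>\<^bsub>G\<^esub> x m [^]\<^bsub>G\<^esub> v m"

primrec list_prod :: "('a, 'b) monoid_scheme \<Rightarrow> ('p \<Rightarrow> 'a) \<Rightarrow> ('p \<Rightarrow> int) \<Rightarrow> 'p list \<Rightarrow> 'a" where
  "list_prod G c b [] = \<one>\<^bsub>G\<^esub>"
| "list_prod G c b (p # ps) = c p [^]\<^bsub>G\<^esub> b p \<otimes>\<^bsub>G\<^esub> list_prod G c b ps"

text \<open>The setting for collecting words in nilpotency class 2. The map \<open>c\<close> is
  total and trivial off \<open>ps\<close>, so one swap rule covers commuting and noncommuting
  generators.\<close>

locale collection = group G for G (structure) +
  fixes n :: nat and x :: "nat \<Rightarrow> 'a" and c :: "nat \<times> nat \<Rightarrow> 'a" and ps :: "(nat \<times> nat) list"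
  assumes x: "p < n \<Longrightarrow> x p \<in> carrier G"
    and c: "c q \<in> carrier G"
    and c_central: "g \<in> carrier G \<Longrightarrow> c q \<otimes> g = g \<otimes> c q"
    and swap: "\<lbrakk>i < j; j < n\<rbrakk> \<Longrightarrow> x j \<otimes> x i = x i \<otimes> x j \<otimes> c (i, j)"
    and c_one: "q \<notin> set ps \<Longrightarrow> c q = \<one>"
    and distinct_ps: "distinct ps"
begin

abbreviation "XP v m \<equiv> ordered_prod G x v m"
abbreviation "CP b \<equiv> list_prod G c b ps"

definition collected :: "'a set" where
  "collected = {XP v n \<otimes> CP b | v b. True}"

lemma ordered_prod_closed: "m \<le> n \<Longrightarrow> XP v m \<in> carrier G"
  by (induction m) (simp_all add: x)

lemma ordered_prod_cong: "(\<And>i. i < m \<Longrightarrow> v i = w i) \<Longrightarrow> XP v m = XP w m"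
  by (induction m) auto

lemma list_prod_closed: "list_prod G c b qs \<in> carrier G"
  by (induction qs) (auto intro: c)

lemma list_prod_cong: "(\<And>q. q \<in> set qs \<Longrightarrow> b q = d q) \<Longrightarrow> list_prod G c b qs = list_prod G c d qs"
  by (induction qs) auto

lemma list_prod_central: "g \<in> carrier G \<Longrightarrow> list_prod G c b qs \<otimes> g = g \<otimes> list_prod G c b qs"
proof (induction qs)
  case (Cons q qs)
  have C: "c q [^] b q \<otimes> g = g \<otimes> c q [^] b q" by (rule central_int_pow[OF c c_central Cons.prems])
  have "c q [^] b q \<otimes> list_prod G c b qs \<otimes> g = c q [^] b q \<otimes> g \<otimes> list_prod G c b qs"
    using Cons by (simp add: m_assoc c list_prod_closed)
  also have "\<dots> = g \<otimes> (c q [^] b q \<otimes> list_prod G c b qs)"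
    using Cons.prems by (simp add: C m_assoc c list_prod_closed)
  finally show ?case by simp
qed simp

lemma list_prod_step:
  "\<lbrakk>q \<in> set qs; distinct qs\<rbrakk> \<Longrightarrow> c q [^] k \<otimes> list_prod G c b qs = list_prod G c (b(q := b q + k)) qs"
proof (induction qs)
  case (Cons r qs)
  show ?case
  proof (cases "r = q")
    case True
    then have "q \<notin> set qs" using Cons by simp
    then have "list_prod G c (b(q := b q + k)) qs = list_prod G c b qs" by (intro list_prod_cong) auto
    moreover have "c q [^] (b q + k) = c q [^] k \<otimes> c q [^] b q"
      by (subst add.commute) (simp add: int_pow_mult c)
    ultimately show ?thesis using True
      by (simp add: m_assoc c list_prod_closed fun_upd_same del: fun_upd_apply)
  next
    case False
    then have IH: "c q [^] k \<otimes> list_prod G c b qs = list_prod G c (b(q := b q + k)) qs" using Cons by (simp del: fun_upd_apply)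
    have "c q [^] k \<otimes> c r [^] b r = c r [^] b r \<otimes> c q [^] k"
      by (rule central_int_pow[OF c c_central]) (simp_all add: c)
    then have "c q [^] k \<otimes> (c r [^] b r \<otimes> list_prod G c b qs) = c r [^] b r \<otimes> (c q [^] k \<otimes> list_prod G c b qs)"
      by (simp add: m_assoc[symmetric] c list_prod_closed)
    then show ?thesis using False by (simp only: list_prod.simps fun_upd_other IH not_False_eq_True simp_thms)
  qed
qed simp

lemma c_pow_collected: "\<exists>d. c q [^] (k::int) \<otimes> CP b = CP d"
proof (cases "q \<in> set ps")
  case True
  then show ?thesis using list_prod_step[OF True distinct_ps] by blast
next
  case False
  then show ?thesis by (auto simp: c_one list_prod_closed)
qed

lemma collected_c: assumes "g \<in> collected" shows "g \<otimes> c q [^] (k::int) \<in> collected"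
proof -
  obtain v b where g: "g = XP v n \<otimes> CP b" using assms by (auto simp: collected_def)
  obtain d where d: "c q [^] k \<otimes> CP b = CP d" using c_pow_collected by blast
  have "CP b \<otimes> c q [^] k = CP d" using d list_prod_central[of "c q [^] k" b ps] c by simp
  then have "g \<otimes> c q [^] k = XP v n \<otimes> CP d"
    unfolding g by (simp add: m_assoc list_prod_closed ordered_prod_closed c)
  then show ?thesis unfolding collected_def by blast
qed

text \<open>The factor \<open>x p [^] k\<close> is moved left to its place; passing
  \<open>x m [^] v m\<close> with \<open>m > p\<close> costs the central factor
  \<open>c (p, m) [^] (k * v m)\<close>.\<close>

lemma ordered_prod_step:
  assumes "p < m" "m \<le> n"
  shows "\<exists>b. XP v m \<otimes> x p [^] (k::int) = XP (v(p := v p + k)) m \<otimes> CP b"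
  using assms
proof (induction m)
  case (Suc m)
  have xm: "x m \<in> carrier G" and X: "XP w m \<in> carrier G" for w
    using Suc x ordered_prod_closed by auto
  have xp: "x p \<in> carrier G" using Suc x by simp
  have one: "\<exists>b. CP b = \<one>"
  proof -
    have "list_prod G c (\<lambda>_. 0) qs = \<one>" for qs by (induction qs) (simp_all add: c)
    then show ?thesis by blast
  qed
  show ?case
  proof (cases "p = m")
    case True
    obtain b where b: "CP b = \<one>" using one by blast
    have "XP (v(p := v p + k)) m = XP v m" using True by (intro ordered_prod_cong) auto
    then have "XP v (Suc m) \<otimes> x p [^] k = XP (v(p := v p + k)) (Suc m) \<otimes> CP b"
      using True b xm X by (simp add: m_assoc int_pow_mult)
    then show ?thesis by blast
  next
    case False
    then have pm: "p < m" using Suc by simp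
    obtain b where b: "XP v m \<otimes> x p [^] k = XP (v(p := v p + k)) m \<otimes> CP b"
      using Suc.IH[OF pm Suc_leD[OF Suc.prems(2)]] by blast
    \<comment> \<open>\<open>commute_conj_int_pow\<close> raises only the left factor to a power. So
      the swap rule is reversed, with the inverse of \<open>c (p, m)\<close>, to get a power of
      \<open>x p\<close>, and then turned back so that \<open>x m\<close> can be raised.\<close>
    have s: "x m \<otimes> x p [^] k = x p [^] k \<otimes> x m \<otimes> c (p, m) [^] k"
    proof -
      have "x p \<otimes> x m = x m \<otimes> x p \<otimes> inv c (p, m)"
        using swap[of p m] pm Suc xp xm c[of "(p, m)"] by (simp add: m_assoc)
      moreover have "inv c (p, m) \<otimes> g = g \<otimes> inv c (p, m)" if "g \<in> carrier G" for g
        using c_central[OF that, of "(p, m)"] c that by (metis inv_closed inv_solve_left inv_solve_right m_assoc m_closed)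
      ultimately have "x p [^] k \<otimes> x m = x m \<otimes> x p [^] k \<otimes> inv c (p, m) [^] k"
        using commute_conj_int_pow[OF xm xp inv_closed[OF c]] by blast
      then show ?thesis using xp xm c[of "(p, m)"] by (simp add: m_assoc int_pow_inv)
    qed
    define d where "d = c (p, m) [^] k"
    have d: "d \<in> carrier G" by (simp add: d_def c)
    have dc: "d \<otimes> g = g \<otimes> d" if "g \<in> carrier G" for g
      unfolding d_def by (rule central_int_pow[OF c c_central that])
    have xpk: "x p [^] k \<in> carrier G" using xp by simp
    have "x m [^] v m \<otimes> x p [^] k = x p [^] k \<otimes> x m [^] v m \<otimes> d [^] v m"
      by (rule commute_conj_int_pow[OF xpk xm d dc]) (use s d_def in auto)
    then have "XP v (Suc m) \<otimes> x p [^] k = XP v m \<otimes> x p [^] k \<otimes> x m [^] v m \<otimes> d [^] v m"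
      using X xm xpk d by (simp add: m_assoc)
    also have "\<dots> = XP (v(p := v p + k)) m \<otimes> (CP b \<otimes> x m [^] v m) \<otimes> d [^] v m"
      using X xm d unfolding b by (simp add: m_assoc list_prod_closed)
    also have "\<dots> = XP (v(p := v p + k)) m \<otimes> x m [^] v m \<otimes> (CP b \<otimes> d [^] v m)"
      using X xm d list_prod_central[of "x m [^] v m" b ps] by (simp add: m_assoc list_prod_closed)
    also have "d [^] v m = c (p, m) [^] (k * v m)" by (simp add: d_def int_pow_pow c)
    also have "CP b \<otimes> c (p, m) [^] (k * v m) = c (p, m) [^] (k * v m) \<otimes> CP b"
      by (rule list_prod_central) (simp add: c)
    finally show ?thesis using c_pow_collected[of "(p, m)" "k * v m" b] False by auto
  qed
qed simp

lemma collected_x: assumes "g \<in> collected" "p < n" shows "g \<otimes> x p [^] (k::int) \<in> collected"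
proof -
  obtain v b where g: "g = XP v n \<otimes> CP b" using assms by (auto simp: collected_def)
  have xk: "x p [^] k \<in> carrier G" using x assms by simp
  obtain d where d: "XP v n \<otimes> x p [^] k = XP (v(p := v p + k)) n \<otimes> CP d"
    using ordered_prod_step[OF assms(2), of v k] by auto
  have "CP d \<otimes> CP b = CP (\<lambda>q. d q + b q)"
  proof -
    have "list_prod G c d qs \<otimes> list_prod G c b qs = list_prod G c (\<lambda>q. d q + b q) qs" for qs
    proof (induction qs)
      case (Cons q qs)
      have "c q [^] d q \<otimes> list_prod G c d qs \<otimes> (c q [^] b q \<otimes> list_prod G c b qs)
        = c q [^] d q \<otimes> (list_prod G c d qs \<otimes> c q [^] b q) \<otimes> list_prod G c b qs"
        by (simp add: m_assoc c list_prod_closed)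
      also have "\<dots> = c q [^] d q \<otimes> (c q [^] b q \<otimes> list_prod G c d qs) \<otimes> list_prod G c b qs"
        using list_prod_central[of "c q [^] b q" d qs] c by simp
      also have "\<dots> = (c q [^] d q \<otimes> c q [^] b q) \<otimes> (list_prod G c d qs \<otimes> list_prod G c b qs)"
        by (simp add: m_assoc c list_prod_closed)
      finally show ?case using Cons by (simp add: int_pow_mult c)
    qed simp
    then show ?thesis .
  qed
  moreover have "g \<otimes> x p [^] k = XP (v(p := v p + k)) n \<otimes> (CP d \<otimes> CP b)"
  proof -
    have "g \<otimes> x p [^] k = XP v n \<otimes> x p [^] k \<otimes> CP b"
      unfolding g using xk list_prod_central[OF xk, of b ps]
      by (simp add: m_assoc list_prod_closed ordered_prod_closed)
    then show ?thesis unfolding d by (simp add: m_assoc list_prod_closed ordered_prod_closed)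
  qed
  ultimately show ?thesis unfolding collected_def by auto
qed

lemma one_collected: "\<one> \<in> collected"
proof -
  have "list_prod G c (\<lambda>_. 0) qs = \<one>" for qs by (induction qs) (simp_all add: c)
  moreover have "m \<le> n \<Longrightarrow> XP (\<lambda>_. 0) m = \<one>" for m by (induction m) (simp_all add: x)
  ultimately have "\<one> = XP (\<lambda>_. 0) n \<otimes> CP (\<lambda>_. 0)" by simp
  then show ?thesis unfolding collected_def by blast
qed

end

section \<open>The group of a graph is its Magnus model\<close>

context group begin

lemma commutator_eq_iff:
  assumes "a \<in> carrier G" "b \<in> carrier G" "c \<in> carrier G"
  shows "inv a \<otimes> (inv b \<otimes> (a \<otimes> b)) = c \<longleftrightarrow> a \<otimes> b = b \<otimes> a \<otimes> c"
proof -
  have "a \<otimes> b = (b \<otimes> a) \<otimes> (inv a \<otimes> (inv b \<otimes> (a \<otimes> b)))"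
  proof -
    have "(b \<otimes> a) \<otimes> (inv a \<otimes> (inv b \<otimes> (a \<otimes> b))) = b \<otimes> (a \<otimes> inv a) \<otimes> inv b \<otimes> (a \<otimes> b)"
      using assms by (simp only: m_assoc m_closed inv_closed)
    then show ?thesis using assms by simp
  qed
  then show ?thesis using assms by (metis inv_closed l_cancel m_closed)
qed

lemma eval_comm_word:
  assumes "x a \<in> carrier G" "x b \<in> carrier G"
  shows "eval_word G x (comm_word a b) = \<one> \<longleftrightarrow> x a \<otimes> x b = x b \<otimes> x a"
  using commutator_eq_iff[OF assms one_closed] assms
  by (simp add: comm_word_def letter_def inv_letter_def)

lemma eval_comm_word_inv_letter:
  assumes "x a \<in> carrier G" "x b \<in> carrier G" "x c \<in> carrier G"
  shows "eval_word G x (comm_word a b @ inv_letter c) = \<one> \<longleftrightarrow> x a \<otimes> x b = x b \<otimes> x a \<otimes> x c"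
proof -
  have "eval_word G x (comm_word a b @ inv_letter c) = inv x a \<otimes> (inv x b \<otimes> (x a \<otimes> x b)) \<otimes> inv x c"
    using assms by (simp add: comm_word_def letter_def inv_letter_def m_assoc)
  also have "\<dots> = \<one> \<longleftrightarrow> inv x a \<otimes> (inv x b \<otimes> (x a \<otimes> x b)) = x c"
    using assms by (metis inv_closed inv_equality inv_inv m_closed r_inv)
  finally show ?thesis using commutator_eq_iff[OF assms] by simp
qed

lemma commute_inv:
  assumes "d \<in> carrier G" "g \<in> carrier G" "d \<otimes> g = g \<otimes> d"
  shows "d \<otimes> inv g = inv g \<otimes> d"
proof -
  have "inv g \<otimes> (d \<otimes> g) \<otimes> inv g = inv g \<otimes> (g \<otimes> d) \<otimes> inv g" using assms by simp
  moreover have "inv g \<otimes> (d \<otimes> g) \<otimes> inv g = inv g \<otimes> d" using assms(1,2) by (simp add: m_assoc)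
  moreover have "inv g \<otimes> (g \<otimes> d) \<otimes> inv g = d \<otimes> inv g"
    using assms(1,2) by (simp add: m_assoc[symmetric])
  ultimately show ?thesis by simp
qed

lemma commute_mult:
  assumes "d \<in> carrier G" "g \<in> carrier G" "h \<in> carrier G" "d \<otimes> g = g \<otimes> d" "d \<otimes> h = h \<otimes> d"
  shows "d \<otimes> (g \<otimes> h) = g \<otimes> h \<otimes> d"
  using assms by (metis m_assoc)

end

locale simple_graph_group =
  fixes \<Gamma> :: graph
  assumes sg: "simple_graph \<Gamma>"
begin

abbreviation "n \<equiv> fst \<Gamma>"
abbreviation "S \<equiv> gamma_gens \<Gamma>"
abbreviation "R \<equiv> gamma_rels \<Gamma>"
abbreviation P where "P \<equiv> G_graph \<Gamma>"
abbreviation M where "M \<equiv> magnus_group \<Gamma>"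

sublocale P: group P unfolding G_graph_def by (rule group_presented_group)
sublocale M: group M by (rule group_magnus[OF sg])

definition lt :: "gen \<Rightarrow> gen word set" where "lt s = pres_class S R [(s, False)]"

text \<open>Edges of the complement of \<open>\<Gamma>\<close>, as increasing pairs: the index pairs
  of the generators \<open>GY i j\<close>.\<close>

definition edge :: "nat \<times> nat \<Rightarrow> bool" where "edge q \<longleftrightarrow> fst q < snd q \<and> nonadj \<Gamma> (fst q) (snd q)"

definition cg :: "nat \<times> nat \<Rightarrow> gen word set" where
  "cg q = (if edge q then lt (GY (fst q) (snd q)) else \<one>\<^bsub>P\<^esub>)"

lemma GX_S: "GX p \<in> S \<longleftrightarrow> p < n"
  by (auto simp: gamma_gens_def)

lemma GY_S: "GY i j \<in> S \<longleftrightarrow> edge (i, j)"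
  by (auto simp: gamma_gens_def edge_def nonadj_def)

lemma lt_closed: "s \<in> S \<Longrightarrow> lt s \<in> carrier P"
  by (auto simp: lt_def G_graph_def carrier_presented_group Cons_words)

lemma cg_closed: "cg q \<in> carrier P"
  by (simp add: cg_def lt_closed GY_S)

lemma pres_class_eval: "w \<in> words S \<Longrightarrow> pres_class S R w = eval_word P lt w"
proof (induction w)
  case Nil
  then show ?case by (simp add: G_graph_def one_presented_group)
next
  case (Cons l w)
  obtain s b where l: "l = (s, b)" by (cases l)
  have sw: "s \<in> S" "w \<in> words S" using Cons l by (auto simp: Cons_words)
  have "pres_class S R (l # w) = pres_class S R [l] \<otimes>\<^bsub>P\<^esub> pres_class S R w"
    unfolding G_graph_def using sw l by (subst mult_presented_group) (auto simp: Cons_words)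
  moreover have "pres_class S R [l] = (if b then inv\<^bsub>P\<^esub> (lt s) else lt s)"
    using inv_presented_group[OF sw(1), of R] by (simp add: l lt_def G_graph_def)
  ultimately show ?case using Cons.IH[OF sw(2)] l by simp
qed

lemma rel_eval: "\<lbrakk>r \<in> R; r \<in> words S\<rbrakk> \<Longrightarrow> eval_word P lt r = \<one>\<^bsub>P\<^esub>"
  using pres_class_eval[of r] pres_eqv.rel[of r R S] pres_class_eq_iff[of r S "[]" R]
  by (simp add: G_graph_def one_presented_group)

lemma comm_word_words: "comm_word a b \<in> words S \<longleftrightarrow> a \<in> S \<and> b \<in> S"
  by (auto simp: comm_word_def letter_def inv_letter_def Cons_words)

lemma X_swap:
  assumes "i < j" "j < n"
  shows "lt (GX j) \<otimes>\<^bsub>P\<^esub> lt (GX i) = lt (GX i) \<otimes>\<^bsub>P\<^esub> lt (GX j) \<otimes>\<^bsub>P\<^esub> cg (i, j)"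
proof (cases "snd \<Gamma> i j")
  case True
  then have "comm_word (GX j) (GX i) \<in> R" using assms unfolding gamma_rels_def by blast
  then have "eval_word P lt (comm_word (GX j) (GX i)) = \<one>\<^bsub>P\<^esub>"
    using assms by (intro rel_eval) (simp_all add: comm_word_words GX_S)
  then show ?thesis
    using assms True P.eval_comm_word[of lt "GX j" "GX i"] by (simp add: lt_closed GX_S cg_def edge_def nonadj_def)
next
  case False
  then have "comm_word (GX j) (GX i) @ inv_letter (GY i j) \<in> R" using assms unfolding gamma_rels_def by blast
  moreover have e: "edge (i, j)" using assms False by (simp add: edge_def nonadj_def)
  ultimately have "eval_word P lt (comm_word (GX j) (GX i) @ inv_letter (GY i j)) = \<one>\<^bsub>P\<^esub>"
    using assms by (intro rel_eval) (simp_all add: append_words comm_word_words GX_S GY_S inv_letter_def Cons_words)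
  then show ?thesis
    using assms e P.eval_comm_word_inv_letter[of lt "GX j" "GX i" "GY i j"]
    by (simp add: lt_closed GX_S GY_S cg_def)
qed

lemma cg_commute_X:
  assumes "p < n" shows "cg q \<otimes>\<^bsub>P\<^esub> lt (GX p) = lt (GX p) \<otimes>\<^bsub>P\<^esub> cg q"
proof (cases "edge q")
  case True
  obtain i j where q: "q = (i, j)" by (cases q)
  have "comm_word (GX p) (GY i j) \<in> R"
    using True assms unfolding gamma_rels_def q edge_def nonadj_def by auto
  then have "eval_word P lt (comm_word (GX p) (GY i j)) = \<one>\<^bsub>P\<^esub>"
    using assms True q by (intro rel_eval) (simp_all add: comm_word_words GX_S GY_S)
  then show ?thesis
    using assms True q P.eval_comm_word[of lt "GX p" "GY i j"] by (simp add: lt_closed GX_S GY_S cg_def)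
next
  case False
  then show ?thesis using assms by (simp add: cg_def lt_closed GX_S)
qed

text \<open>No relation involves two \<open>GY\<close> generators. They commute because
  \<open>GY i j\<close> is a commutator of \<open>GX\<close> generators, with which every
  \<open>cg q\<close> commutes.\<close>

lemma cg_commute_Y:
  assumes "edge (i, j)" shows "cg q \<otimes>\<^bsub>P\<^esub> lt (GY i j) = lt (GY i j) \<otimes>\<^bsub>P\<^esub> cg q"
proof -
  have ij: "i < j" "j < n" "i < n" using assms by (auto simp: edge_def nonadj_def)
  let ?x = "lt (GX i)" and ?y = "lt (GX j)"
  have xy: "?x \<in> carrier P" "?y \<in> carrier P" using ij by (simp_all add: lt_closed GX_S)
  have "lt (GY i j) = inv\<^bsub>P\<^esub> ?y \<otimes>\<^bsub>P\<^esub> (inv\<^bsub>P\<^esub> ?x \<otimes>\<^bsub>P\<^esub> (?y \<otimes>\<^bsub>P\<^esub> ?x))"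
    using P.commutator_eq_iff[OF xy(2,1) cg_closed[of "(i, j)"]] X_swap[OF ij(1,2)] assms by (simp add: cg_def)
  then show ?thesis
    using xy cg_closed[of q] cg_commute_X[OF ij(2), of q] cg_commute_X[OF ij(3), of q]
    by (simp add: P.commute_mult P.commute_inv)
qed

text \<open>Integer exponents treat letters and inverse letters together and match the steps
  \<open>collected_x\<close> and \<open>collected_c\<close>.\<close>

lemma word_induct [consumes 1, case_names Nil X Y]:
  assumes g: "g \<in> carrier P" and "Q \<one>\<^bsub>P\<^esub>"
    and X: "\<And>g p k. \<lbrakk>g \<in> carrier P; Q g; p < n\<rbrakk> \<Longrightarrow> Q (g \<otimes>\<^bsub>P\<^esub> lt (GX p) [^]\<^bsub>P\<^esub> (k::int))"
    and Y: "\<And>g q k. \<lbrakk>g \<in> carrier P; Q g; edge q\<rbrakk> \<Longrightarrow> Q (g \<otimes>\<^bsub>P\<^esub> cg q [^]\<^bsub>P\<^esub> (k::int))"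
  shows "Q g"
proof -
  have sub: "lt ` S \<subseteq> carrier P" using lt_closed by blast
  have "Q (eval_word P lt w)" if "w \<in> words S" for w
    using that
  proof (induction w rule: rev_induct)
    case Nil
    then show ?case using assms(2) by simp
  next
    case (snoc l w)
    obtain s b where l: "l = (s, b)" by (cases l)
    have sw: "s \<in> S" "w \<in> words S" using snoc l by (auto simp: append_words Cons_words)
    have wc: "eval_word P lt w \<in> carrier P" by (rule P.eval_word_closed[OF sub sw(2)])
    have "eval_word P lt (w @ [l]) = eval_word P lt w \<otimes>\<^bsub>P\<^esub> eval_word P lt [l]"
      by (rule P.eval_word_append[OF sub sw(2)]) (simp add: l sw Cons_words)
    also have "eval_word P lt [l] = lt s [^]\<^bsub>P\<^esub> (if b then -1 else 1 :: int)"
      using lt_closed[OF sw(1)] by (simp add: l P.int_pow_neg P.int_pow_1)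
    finally show ?case
      using X[OF wc snoc.IH[OF sw(2)]] Y[OF wc snoc.IH[OF sw(2)]] sw(1)
      by (cases s) (auto simp: GX_S GY_S cg_def)
  qed
  moreover obtain w where "w \<in> words S" "g = pres_class S R w"
    using g by (auto simp: G_graph_def carrier_presented_group)
  ultimately show ?thesis using pres_class_eval by simp
qed

lemma cg_central:
  assumes "g \<in> carrier P" shows "cg q \<otimes>\<^bsub>P\<^esub> g = g \<otimes>\<^bsub>P\<^esub> cg q"
  using assms
proof (induction rule: word_induct)
  case Nil
  then show ?case using cg_closed by simp
next
  case (X g p k)
  have "lt (GX p) [^]\<^bsub>P\<^esub> k \<otimes>\<^bsub>P\<^esub> cg q = cg q \<otimes>\<^bsub>P\<^esub> lt (GX p) [^]\<^bsub>P\<^esub> k"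
    using P.commute_conj_int_pow[of "cg q" "lt (GX p)" "\<one>\<^bsub>P\<^esub>" k] cg_closed[of q] lt_closed cg_commute_X[OF \<open>p < n\<close>, of q] \<open>p < n\<close>
    by (simp add: GX_S)
  then show ?case using X cg_closed[of q] lt_closed by (intro P.commute_mult) (simp_all add: GX_S)
next
  case (Y g r k)
  have "cg q \<otimes>\<^bsub>P\<^esub> lt (GY (fst r) (snd r)) = lt (GY (fst r) (snd r)) \<otimes>\<^bsub>P\<^esub> cg q"
    using cg_commute_Y[of "fst r" "snd r" q] \<open>edge r\<close> by simp
  then have "cg q \<otimes>\<^bsub>P\<^esub> cg r = cg r \<otimes>\<^bsub>P\<^esub> cg q"
    using \<open>edge r\<close> by (simp add: cg_def[of r])
  then have "cg r [^]\<^bsub>P\<^esub> k \<otimes>\<^bsub>P\<^esub> cg q = cg q \<otimes>\<^bsub>P\<^esub> cg r [^]\<^bsub>P\<^esub> k"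
    using P.commute_conj_int_pow[of "cg q" "cg r" "\<one>\<^bsub>P\<^esub>" k] cg_closed by simp
  then show ?case using Y cg_closed by (intro P.commute_mult) simp_all
qed

definition edges :: "(nat \<times> nat) list" where
  "edges = (SOME qs. distinct qs \<and> set qs = {q. edge q})"

lemma edges: "distinct edges" "set edges = {q. edge q}"
proof -
  have "finite {q. edge q}"
    by (rule finite_subset[of _ "{..<n} \<times> {..<n}"]) (auto simp: edge_def nonadj_def)
  then have "\<exists>qs. distinct qs \<and> set qs = {q. edge q}" using finite_distinct_list by blast
  then have "distinct edges \<and> set edges = {q. edge q}" unfolding edges_def by (rule someI_ex)
  then show "distinct edges" "set edges = {q. edge q}" by auto
qed

sublocale collection P n "\<lambda>p. lt (GX p)" cg edges
proof unfold_locales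
  show "\<And>p. p < n \<Longrightarrow> lt (GX p) \<in> carrier P" by (simp add: lt_closed GX_S)
  show "\<And>q. q \<notin> set edges \<Longrightarrow> cg q = \<one>\<^bsub>P\<^esub>" by (simp add: edges cg_def)
qed (fact cg_closed cg_central X_swap edges)+

lemma carrier_collected: "g \<in> carrier P \<Longrightarrow> g \<in> collected"
  by (induction rule: word_induct) (auto intro: one_collected collected_x collected_c)

section \<open>The comparison map from the presentation to the Magnus model\<close>

definition mx :: "nat \<Rightarrow> (nat \<Rightarrow> int) \<times> (nat \<Rightarrow> nat \<Rightarrow> int)" where
  "mx p = (\<lambda>a. if a = p then 1 else 0, \<lambda>_ _. 0)"

text \<open>The commutator of \<open>mx j\<close> and \<open>mx i\<close>: the order
  \<open>j\<close>, \<open>i\<close> contributes 1 at the entry \<open>(j, i)\<close>, the opposite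
  order contributes -1 at \<open>(i, j)\<close>.\<close>

definition my :: "nat \<Rightarrow> nat \<Rightarrow> (nat \<Rightarrow> int) \<times> (nat \<Rightarrow> nat \<Rightarrow> int)" where
  "my i j = (\<lambda>_. 0, \<lambda>a b. if a = j \<and> b = i then 1 else if a = i \<and> b = j then -1 else 0)"

definition mgen :: "gen \<Rightarrow> (nat \<Rightarrow> int) \<times> (nat \<Rightarrow> nat \<Rightarrow> int)" where
  "mgen s = (case s of GX p \<Rightarrow> mx p | GY i j \<Rightarrow> my i j)"

lemma mgen_simps: "mgen (GX p) = mx p" "mgen (GY i j) = my i j"
  by (simp_all add: mgen_def)

lemma nonadj_irrefl: "\<not> nonadj \<Gamma> a a" by (simp add: nonadj_def)

lemma edgeD: "edge (i, j) \<Longrightarrow> i < j \<and> nonadj \<Gamma> i j \<and> nonadj \<Gamma> j i"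
  using nonadj_sym[OF sg] by (auto simp: edge_def)

lemma mgen_closed: "mgen ` S \<subseteq> carrier M"
proof
  fix g assume "g \<in> mgen ` S"
  then obtain s where s: "s \<in> S" "g = mgen s" by blast
  show "g \<in> carrier M"
  proof (cases s)
    case (GX p)
    then show ?thesis using s nonadj_irrefl by (auto simp: mgen_def mx_def carrier_magnus GX_S)
  next
    case (GY i j)
    then show ?thesis using s edgeD[of i j] by (auto simp: mgen_def my_def carrier_magnus GY_S)
  qed
qed

lemma mgen_rel: "\<lbrakk>r \<in> R; r \<in> words S\<rbrakk> \<Longrightarrow> eval_word M mgen r = \<one>\<^bsub>M\<^esub>"
proof -
  assume r: "r \<in> R" and w: "r \<in> words S"
  have cl: "mgen s \<in> carrier M" if "s \<in> S" for s using mgen_closed that by blast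
  consider (adj) i j where "i < j" "j < n" "snd \<Gamma> i j" "r = comm_word (GX j) (GX i)"
    | (nadj) i j where "i < j" "j < n" "\<not> snd \<Gamma> i j" "r = comm_word (GX j) (GX i) @ inv_letter (GY i j)"
    | (central) p i j where "p < n" "i < j" "j < n" "\<not> snd \<Gamma> i j" "r = comm_word (GX p) (GY i j)"
    using r unfolding gamma_rels_def by blast
  then show ?thesis
  proof cases
    case adj
    then have "\<not> nonadj \<Gamma> i j" "\<not> nonadj \<Gamma> j i" using sg by (auto simp: nonadj_def simple_graph_def)
    then have "mx j \<otimes>\<^bsub>M\<^esub> mx i = mx i \<otimes>\<^bsub>M\<^esub> mx j" by (auto simp: mx_def mult_magnus fun_eq_iff)
    then show ?thesis using adj cl[of "GX j"] cl[of "GX i"] M.eval_comm_word[of mgen "GX j" "GX i"] by (simp add: GX_S mgen_simps)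
  next
    case nadj
    then have e: "edge (i, j)" by (simp add: edge_def nonadj_def)
    then have "mx j \<otimes>\<^bsub>M\<^esub> mx i = mx i \<otimes>\<^bsub>M\<^esub> mx j \<otimes>\<^bsub>M\<^esub> my i j"
      using edgeD[OF e] by (auto simp: mx_def my_def mult_magnus fun_eq_iff)
    then show ?thesis
      using nadj e cl[of "GX j"] cl[of "GX i"] cl[of "GY i j"] M.eval_comm_word_inv_letter[of mgen "GX j" "GX i" "GY i j"] by (simp add: GX_S GY_S mgen_simps)
  next
    case central
    then have e: "edge (i, j)" by (simp add: edge_def nonadj_def)
    have "mx p \<otimes>\<^bsub>M\<^esub> my i j = my i j \<otimes>\<^bsub>M\<^esub> mx p" by (auto simp: mx_def my_def mult_magnus fun_eq_iff)
    then show ?thesis using central e cl[of "GX p"] cl[of "GY i j"] M.eval_comm_word[of mgen "GX p" "GY i j"] by (simp add: GX_S GY_S mgen_simps)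
  qed
qed

lemma mx_pow: assumes "p < n" shows "mx p [^]\<^bsub>M\<^esub> (k::int) = (\<lambda>a. if a = p then k else 0, \<lambda>_ _. 0)"
  unfolding mx_def
  by (rule M.int_pow_eqI[where h = "\<lambda>k. (\<lambda>a. if a = p then k else 0, \<lambda>_ _. 0)"])
    (use assms nonadj_irrefl in \<open>auto simp: carrier_magnus mult_magnus fun_eq_iff\<close>)

lemma my_pow:
  assumes "edge (i, j)"
  shows "my i j [^]\<^bsub>M\<^esub> (k::int) =
    (\<lambda>_. 0, \<lambda>a b. if a = j \<and> b = i then k else if a = i \<and> b = j then - k else 0)"
  unfolding my_def
  by (rule M.int_pow_eqI[where h = "\<lambda>k. (\<lambda>_. 0, \<lambda>a b. if a = j \<and> b = i then k else if a = i \<and> b = j then - k else 0)"])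
    (use edgeD[OF assms] in \<open>auto simp: carrier_magnus mult_magnus fun_eq_iff\<close>)

text \<open>Collection brings every element into a normal form, and the image in the model reveals
  its exponents; hence injectivity. Conversely, every element of the model prescribes a normal form
  that maps to it.\<close>

lemma G_graph_magnus: "P \<cong> M"
proof -
  obtain f where f: "f \<in> hom P M" "\<And>w. w \<in> words S \<Longrightarrow> f (pres_class S R w) = eval_word M mgen w"
    using M.presented_group_hom[OF mgen_closed mgen_rel] unfolding G_graph_def by blast
  interpret f: group_hom P M f
    using f(1) by (simp add: group_hom_def group_hom_axioms_def P.group_axioms M.group_axioms)
  have f_lt: "f (lt s) = mgen s" if "s \<in> S" for s
    using f(2)[of "[(s, False)]"] that mgen_closed by (auto simp: lt_def Cons_words)
  have fx: "f (lt (GX p)) = mx p" if "p < n" for p using f_lt[of "GX p"] that by (simp add: GX_S mgen_def)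
  have fc: "f (cg (i, j)) = my i j" if "edge (i, j)" for i j
    using f_lt[of "GY i j"] that by (simp add: GY_S mgen_def cg_def)
  \<comment> \<open>In a product with increasing indices the generator \<open>a\<close> stands
    before \<open>b\<close> exactly for \<open>a < b\<close>, so only these pairs
    contribute.\<close>
  have fXP: "f (XP v m) = (\<lambda>a. if a < m then v a else 0,
      \<lambda>a b. if nonadj \<Gamma> a b \<and> a < b \<and> b < m then v a * v b else 0)" if "m \<le> n" for v m
    using that
  proof (induction m)
    case 0
    then show ?case by (simp add: one_magnus)
  next
    case (Suc m)
    have xc: "lt (GX m) \<in> carrier P" using Suc by (simp add: lt_closed GX_S)
    have "f (XP v (Suc m)) = f (XP v m) \<otimes>\<^bsub>M\<^esub> mx m [^]\<^bsub>M\<^esub> v m"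
      using Suc xc ordered_prod_closed[of m v] fx[of m] by (simp add: f.hom_int_pow)
    also have "\<dots> = (\<lambda>a. if a < Suc m then v a else 0,
      \<lambda>a b. if nonadj \<Gamma> a b \<and> a < b \<and> b < Suc m then v a * v b else 0)"
      using Suc by (auto simp: mx_pow mult_magnus fun_eq_iff less_Suc_eq)
    finally show ?case .
  qed
  have fCP: "f (list_prod P cg b qs) = (\<lambda>_. 0, \<lambda>a a'. if nonadj \<Gamma> a a'
      then if (a', a) \<in> set qs then b (a', a) else if (a, a') \<in> set qs then - b (a, a') else 0 else 0)"
    if "set qs \<subseteq> {q. edge q}" "distinct qs" for b qs
    using that
  proof (induction qs)
    case Nil
    then show ?case by (simp add: one_magnus fun_eq_iff)
  next
    case (Cons q qs)
    obtain i j where q: "q = (i, j)" by (cases q)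
    have e: "edge (i, j)" using Cons q by simp
    have ne: "(j, i) \<notin> set qs" using Cons.prems(1) edgeD[OF e] edgeD[of j i] by auto
    have "f (list_prod P cg b (q # qs)) = my i j [^]\<^bsub>M\<^esub> b (i, j) \<otimes>\<^bsub>M\<^esub> f (list_prod P cg b qs)"
      using fc[OF e] cg_closed[of q] list_prod_closed[of b qs] q by (simp add: f.hom_int_pow)
    also have "\<dots> = (\<lambda>_. 0, \<lambda>a a'. if nonadj \<Gamma> a a'
      then if (a', a) \<in> set (q # qs) then b (a', a) else if (a, a') \<in> set (q # qs) then - b (a, a') else 0 else 0)"
      using Cons ne q edgeD[OF e] by (auto simp: my_pow[OF e] mult_magnus fun_eq_iff)
    finally show ?case .
  qed
  \<comment> \<open>For \<open>a' < a\<close> the coefficient is \<open>b (a', a)\<close> itself,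
    and the transposed entry is then forced by the shuffle relation. This dictates the witness
    \<open>b (i, j) = y j i\<close> for surjectivity below.\<close>
  have fcoll: "f (XP v n \<otimes>\<^bsub>P\<^esub> CP b) = (\<lambda>a. if a < n then v a else 0,
      \<lambda>a a'. if nonadj \<Gamma> a a' then if a' < a then b (a', a) else v a * v a' - b (a, a') else 0)" for v b
  proof -
    have "edge (a, a') \<longleftrightarrow> a < a'" "edge (a', a) \<longleftrightarrow> a' < a" "a < n" "a' < n" "a \<noteq> a'" if "nonadj \<Gamma> a a'" for a a'
      using that nonadj_sym[OF sg] by (auto simp: edge_def nonadj_def)
    then show ?thesis
      using ordered_prod_closed[of n v] list_prod_closed[of b edges] edges
      by (simp add: fXP fCP) (auto simp: mult_magnus fun_eq_iff nonadj_irrefl)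
  qed
  have "inj_on f (carrier P)"
    unfolding f.inj_on_one_iff
  proof (intro allI impI)
    fix g assume g: "g \<in> carrier P" "f g = \<one>\<^bsub>M\<^esub>"
    obtain v b where vb: "g = XP v n \<otimes>\<^bsub>P\<^esub> CP b" using carrier_collected[OF g(1)] by (auto simp: collected_def)
    have 0: "(if a < n then v a else 0) = 0"
      "(if nonadj \<Gamma> a a' then if a' < a then b (a', a) else v a * v a' - b (a, a') else 0) = 0" for a a'
      using g(2) fcoll[of v b] by (auto simp: vb one_magnus fun_eq_iff)
    have v: "v a = 0" if "a < n" for a using 0(1)[of a] that by simp
    have b: "b q = 0" if "edge q" for q
      using 0(2)[of "snd q" "fst q"] that edgeD[of "fst q" "snd q"] by simp
    have "XP v n = XP (\<lambda>_. 0) n" by (rule ordered_prod_cong) (simp add: v)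
    moreover have "CP b = CP (\<lambda>_. 0)" by (rule list_prod_cong) (simp add: b edges)
    moreover have "list_prod P cg (\<lambda>_. 0) qs = \<one>\<^bsub>P\<^esub>" for qs by (induction qs) (simp_all add: cg_closed)
    moreover have "m \<le> n \<Longrightarrow> XP (\<lambda>_. 0) m = \<one>\<^bsub>P\<^esub>" for m by (induction m) (simp_all add: lt_closed GX_S)
    ultimately show "g = \<one>\<^bsub>P\<^esub>" by (simp add: vb)
  qed
  moreover have "h \<in> f ` carrier P" if h: "h \<in> carrier M" for h
  proof -
    obtain v y where vy: "h = (v, y)" by (metis surj_pair)
    have s: "y a b + y b a = v a * v b" if "nonadj \<Gamma> a b" for a b using h that by (simp add: vy carrier_magnus)
    have "f (XP v n \<otimes>\<^bsub>P\<^esub> CP (\<lambda>(i, j). y j i)) = h"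
      using h s by (auto simp: fcoll vy carrier_magnus fun_eq_iff algebra_simps)
    moreover have "XP v n \<otimes>\<^bsub>P\<^esub> CP (\<lambda>(i, j). y j i) \<in> carrier P"
      by (simp add: ordered_prod_closed list_prod_closed)
    ultimately show ?thesis by blast
  qed
  then have "carrier M \<subseteq> f ` carrier P" by blast
  ultimately have "bij_betw f (carrier P) (carrier M)" by (auto simp: bij_betw_def)
  then have "f \<in> iso P M" using f(1) by (simp add: iso_def)
  then show ?thesis unfolding is_iso_def by blast
qed

end

section \<open>Indecomposable graphs and joins\<close>

lemma induced_subgraph:
  assumes sg: "simple_graph \<Gamma>"
  shows "simple_graph (card C, \<lambda>i j. i < card C \<and> j < card C \<and>
    snd \<Gamma> (inv_into C f i) (inv_into C f j))"
  using sg by (auto simp: simple_graph_def)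

text \<open>A union of components of the complement graph splits off as a factor of a join.\<close>

lemma nonadj_connected:
  assumes sg: "simple_graph \<Gamma>" and ind: "\<not> join_decomposable \<Gamma>"
    and C: "C \<subseteq> {0..<fst \<Gamma>}" "C \<noteq> {}" and closed: "\<And>a b. nonadj \<Gamma> a b \<Longrightarrow> a \<in> C \<longleftrightarrow> b \<in> C"
  shows "C = {0..<fst \<Gamma>}"
proof (rule ccontr)
  assume ne: "C \<noteq> {0..<fst \<Gamma>}"
  let ?V = "{0..<fst \<Gamma>}"
  define B where "B = ?V - C"
  have fin: "finite C" "finite B" using C finite_subset by (auto simp: B_def)
  obtain f where f: "bij_betw f C {0..<card C}" using ex_bij_betw_finite_nat[OF fin(1)] by blast
  obtain g where g: "bij_betw g B {0..<card B}" using ex_bij_betw_finite_nat[OF fin(2)] by blast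
  define \<Gamma>1 where "\<Gamma>1 = (card C, \<lambda>i j. i < card C \<and> j < card C \<and> snd \<Gamma> (inv_into C f i) (inv_into C f j))"
  define \<Gamma>2 where "\<Gamma>2 = (card B, \<lambda>i j. i < card B \<and> j < card B \<and> snd \<Gamma> (inv_into B g i) (inv_into B g j))"
  \<comment> \<open>Vertices of \<open>C\<close> are numbered first and those of \<open>B\<close>
    after them, as in the vertex order of \<open>join\<close>.\<close>
  define h where "h a = (if a \<in> C then f a else g a + card C)" for a
  have fl: "f a < card C" "inv_into C f (f a) = a" if "a \<in> C" for a
    using f that by (auto simp: bij_betw_def)
  have gl: "g a < card B" "inv_into B g (g a) = a" if "a \<in> B" for a
    using g that by (auto simp: bij_betw_def)
  have VB: "a \<in> B \<longleftrightarrow> a < fst \<Gamma> \<and> a \<notin> C" for a by (auto simp: B_def)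
  have "bij_betw h ?V {0..<fst (join \<Gamma>1 \<Gamma>2)}"
  proof (rule bij_betw_imageI)
    show inj: "inj_on h ?V"
    proof (rule inj_onI)
      fix a b assume ab: "a \<in> ?V" "b \<in> ?V" "h a = h b"
      show "a = b"
      proof (cases "a \<in> C"; cases "b \<in> C")
        assume "a \<in> C" "b \<in> C"
        then show ?thesis using ab(3) fl(2) by (simp add: h_def) metis
      next
        assume "a \<in> C" "b \<notin> C"
        then show ?thesis using ab(3) fl(1)[of a] by (simp add: h_def)
      next
        assume "a \<notin> C" "b \<in> C"
        then show ?thesis using ab(3) fl(1)[of b] by (simp add: h_def)
      next
        assume "a \<notin> C" "b \<notin> C"
        then have "g a = g b" "a \<in> B" "b \<in> B" using ab by (simp_all add: h_def B_def)
        then show ?thesis using gl(2) by metis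
      qed
    qed
    have "h ` ?V \<subseteq> {0..<card C + card B}"
      using fl(1) gl(1) VB by (fastforce simp: h_def)
    moreover have "card C + card B = fst \<Gamma>"
      using C fin by (simp add: B_def card_Diff_subset card_mono[of ?V C, simplified])
    ultimately show "h ` ?V = {0..<fst (join \<Gamma>1 \<Gamma>2)}"
      using inj by (intro card_subset_eq) (auto simp: \<Gamma>1_def \<Gamma>2_def card_image)
  qed
  moreover have "snd \<Gamma> a b \<longleftrightarrow> snd (join \<Gamma>1 \<Gamma>2) (h a) (h b)" if ab: "a < fst \<Gamma>" "b < fst \<Gamma>" for a b
  proof -
    \<comment> \<open>A nonadjacent pair across \<open>C\<close> and its complement would contradict
      closedness; a join needs all these edges.\<close>
    have adj: "snd \<Gamma> a b" if "(a \<in> C) \<noteq> (b \<in> C)"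
      using closed[of a b] that ab by (auto simp: nonadj_def)
    have inB: "x \<in> B" if "x \<notin> C" "x < fst \<Gamma>" for x using that by (simp add: B_def)
    have sj: "snd (join \<Gamma>1 \<Gamma>2) i j \<longleftrightarrow>
        (i < card C \<and> j < card C \<and> snd \<Gamma> (inv_into C f i) (inv_into C f j)) \<or>
        (card C \<le> i \<and> card C \<le> j \<and> i < card C + card B \<and> j < card C + card B \<and>
          snd \<Gamma> (inv_into B g (i - card C)) (inv_into B g (j - card C))) \<or>
        (i < card C \<and> card C \<le> j \<and> j < card C + card B) \<or>
        (j < card C \<and> card C \<le> i \<and> i < card C + card B)" for i j
      unfolding join_def Let_def \<Gamma>1_def \<Gamma>2_def fst_conv snd_conv by linarith
    show ?thesis
    proof (cases "a \<in> C"; cases "b \<in> C")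
      assume "a \<in> C" "b \<in> C"
      then show ?thesis using fl[of a] fl[of b] by (simp add: sj h_def)
    next
      assume c: "a \<in> C" "b \<notin> C"
      then have "b \<in> B" using inB ab by blast
      then show ?thesis using c fl(1)[of a] gl(1)[of b] adj by (simp add: sj h_def)
    next
      assume c: "a \<notin> C" "b \<in> C"
      then have "a \<in> B" using inB ab by blast
      then show ?thesis using c fl(1)[of b] gl(1)[of a] adj by (simp add: sj h_def)
    next
      assume c: "a \<notin> C" "b \<notin> C"
      then have "a \<in> B" "b \<in> B" using inB ab by blast+
      then show ?thesis using c gl[of a] gl[of b] by (simp add: sj h_def)
    qed
  qed
  ultimately have "graph_iso \<Gamma> (join \<Gamma>1 \<Gamma>2)" unfolding graph_iso_def by blast
  moreover have "simple_graph \<Gamma>1" "simple_graph \<Gamma>2"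
    unfolding \<Gamma>1_def \<Gamma>2_def by (rule induced_subgraph[OF sg])+
  moreover have "fst \<Gamma>1 > 0" using C fin by (simp add: \<Gamma>1_def card_gt_0_iff)
  moreover have "fst \<Gamma>2 > 0" using C ne fin by (auto simp: \<Gamma>2_def B_def card_gt_0_iff)
  ultimately show False using ind unfolding join_decomposable_def by blast
qed

text \<open>In class 2 a commutator depends only on the linear parts, through their alternating form
  on nonadjacent pairs; the choice of \<open>y\<close> and \<open>z\<close> is free.\<close>

lemma magnus_commutator:
  assumes sg: "simple_graph \<Gamma>" and g: "(v, y) \<in> carrier (magnus_group \<Gamma>)" and h: "(w, z) \<in> carrier (magnus_group \<Gamma>)"
  shows "(\<lambda>_. 0, \<lambda>a b. if nonadj \<Gamma> a b then v a * w b - w a * v b else 0) \<in>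
    derived (magnus_group \<Gamma>) (carrier (magnus_group \<Gamma>))"
proof -
  let ?M = "magnus_group \<Gamma>"
  interpret M: group ?M by (rule group_magnus[OF sg])
  let ?k = "(\<lambda>_. 0, \<lambda>a b. if nonadj \<Gamma> a b then v a * w b - w a * v b else 0)"
  have k: "?k \<in> carrier ?M"
    using nonadj_sym[OF sg] by (auto simp: carrier_magnus)
  \<comment> \<open>Verifying that \<open>gh\<close> equals \<open>k\<close> times \<open>hg\<close>
    in coordinates avoids computing inverses.\<close>
  have "(v, y) \<otimes>\<^bsub>?M\<^esub> (w, z) = ?k \<otimes>\<^bsub>?M\<^esub> ((w, z) \<otimes>\<^bsub>?M\<^esub> (v, y))"
    by (auto simp: mult_magnus fun_eq_iff)
  then have "(v, y) \<otimes>\<^bsub>?M\<^esub> (w, z) \<otimes>\<^bsub>?M\<^esub> inv\<^bsub>?M\<^esub> (v, y) \<otimes>\<^bsub>?M\<^esub> inv\<^bsub>?M\<^esub> (w, z) =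
      ?k \<otimes>\<^bsub>?M\<^esub> (((w, z) \<otimes>\<^bsub>?M\<^esub> (v, y)) \<otimes>\<^bsub>?M\<^esub> inv\<^bsub>?M\<^esub> ((w, z) \<otimes>\<^bsub>?M\<^esub> (v, y)))"
    using k g h by (simp only: M.inv_mult_group M.m_assoc M.m_closed M.inv_closed)
  also have "\<dots> = ?k" using k g h by (simp only: M.r_inv M.r_one M.m_closed)
  finally have "?k \<in> derived_set ?M (carrier ?M)" using g h by (intro UN_I) (rule g, rule h, simp)
  then show ?thesis unfolding derived_def by (rule generate.incl)
qed

text \<open>A central element is peeled off vertex by vertex: the coordinates \<open>y a b\<close> with
  \<open>min a b = m\<close> come from a single commutator with the \<open>m\<close>-th generator.\<close>

lemma magnus_derived:
  assumes sg: "simple_graph \<Gamma>" and c: "(v, y) \<in> carrier (magnus_group \<Gamma>)" and v: "\<And>a. a < fst \<Gamma> \<Longrightarrow> v a = 0"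
  shows "(v, y) \<in> derived (magnus_group \<Gamma>) (carrier (magnus_group \<Gamma>))"
proof -
  let ?M = "magnus_group \<Gamma>"
  interpret M: group ?M by (rule group_magnus[OF sg])
  have v0: "v = (\<lambda>_. 0)"
  proof
    show "v a = 0" for a using v[of a] c by (cases "a < fst \<Gamma>") (auto simp: carrier_magnus)
  qed
  have y: "y a b + y b a = 0" "y a b = - y b a" if "nonadj \<Gamma> a b" for a b
    using c that v0 by (auto simp: carrier_magnus) (metis add.inverse_unique add.commute)
  have y0: "y a b = 0" if "\<not> nonadj \<Gamma> a b" for a b using c that by (auto simp: carrier_magnus)
  have sub: "subgroup (derived ?M (carrier ?M)) ?M" by (rule M.derived_is_subgroup) simp
  have "(\<lambda>_. 0, \<lambda>a b. if a < m \<or> b < m then y a b else 0) \<in> derived ?M (carrier ?M)" if "m \<le> fst \<Gamma>" for m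
    using that
  proof (induction m)
    case 0
    then show ?case using subgroup.one_closed[OF sub] by (simp add: one_magnus)
  next
    case (Suc m)
    \<comment> \<open>\<open>w\<close> is row \<open>m\<close> of \<open>y\<close> to the right of
      the diagonal, so the commutator of the \<open>m\<close>-th generator with an element of linear
      part \<open>w\<close> has exactly the entries to be added; \<open>z\<close> completes
      \<open>w\<close> to an element of the group.\<close>
    define w where "w b = (if b > m then y m b else 0)" for b
    define z where "z a b = (if nonadj \<Gamma> a b \<and> a < b then w a * w b else 0)" for a b
    let ?x = "(\<lambda>a. if a = m then 1 else 0 :: int, \<lambda>_ _. 0 :: int)"
    have x: "?x \<in> carrier ?M" using Suc by (auto simp: carrier_magnus nonadj_def)
    have "w a = 0" if "a \<ge> fst \<Gamma>" for a
      using that y0[of m a] by (simp add: w_def nonadj_def)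
    then have wz: "(w, z) \<in> carrier ?M"
      using nonadj_sym[OF sg] by (auto simp: carrier_magnus z_def) (auto simp: nonadj_def)
    let ?k = "(\<lambda>_. 0, \<lambda>a b. if nonadj \<Gamma> a b
      then (if a = m then 1 else 0) * w b - w a * (if b = m then 1 else 0) else 0)"
    have "?k \<in> derived ?M (carrier ?M)" by (rule magnus_commutator[OF sg x wz])
    then have "(\<lambda>_. 0, \<lambda>a b. if a < m \<or> b < m then y a b else 0) \<otimes>\<^bsub>?M\<^esub> ?k \<in> derived ?M (carrier ?M)"
      using Suc by (intro subgroup.m_closed[OF sub]) auto
    also have "(\<lambda>_. 0, \<lambda>a b. if a < m \<or> b < m then y a b else 0) \<otimes>\<^bsub>?M\<^esub> ?k =
        (\<lambda>_. 0, \<lambda>a b. if a < Suc m \<or> b < Suc m then y a b else 0)"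
    proof -
      have "(if nonadj \<Gamma> a b then (if a < m \<or> b < m then y a b else 0) +
          (if nonadj \<Gamma> a b then (if a = m then 1 else 0) * w b - w a * (if b = m then 1 else 0) else 0) else 0)
        = (if a < Suc m \<or> b < Suc m then y a b else 0)" for a b
      proof (cases "nonadj \<Gamma> a b")
        case True
        then have "a \<noteq> b" by (simp add: nonadj_def)
        then show ?thesis using True y(2)[OF True] by (auto simp: w_def less_Suc_eq)
      next
        case False
        then show ?thesis using y0 by simp
      qed
      then show ?thesis by (simp only: mult_magnus add_0 mult_zero_left add_0_right)
    qed
    finally show ?case .
  qed
  from this[of "fst \<Gamma>"] have "(\<lambda>_. 0, \<lambda>a b. if a < fst \<Gamma> \<or> b < fst \<Gamma> then y a b else 0) \<in> derived ?M (carrier ?M)"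
    by simp
  also have "(\<lambda>a b. if a < fst \<Gamma> \<or> b < fst \<Gamma> then y a b else 0) = y"
    using y0 by (auto simp: fun_eq_iff nonadj_def)
  finally show ?thesis by (simp add: v0)
qed

lemma complement_connected_magnus:
  assumes sg: "simple_graph \<Gamma>" and ind: "\<not> join_decomposable \<Gamma>" and two: "fst \<Gamma> \<ge> 2"
  shows "complement_connected_group (magnus_group \<Gamma>) {0..<fst \<Gamma>} (nonadj \<Gamma>) (\<lambda>a g. fst g a)"
proof (rule complement_connected_group.intro[OF group_magnus[OF sg]], unfold_locales)
  let ?M = "magnus_group \<Gamma>"
  show "finite {0..<fst \<Gamma>}" "{0..<fst \<Gamma>} \<noteq> {}" using two by auto
  show "\<not> nonadj \<Gamma> a a" for a by (simp add: nonadj_def)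
  show "a \<in> {0..<fst \<Gamma>} \<and> b \<in> {0..<fst \<Gamma>}" if "nonadj \<Gamma> a b" for a b using that by (simp add: nonadj_def)
  show "\<exists>b. nonadj \<Gamma> a b" if a: "a \<in> {0..<fst \<Gamma>}" for a
  proof (rule ccontr)
    assume no: "\<not> ?thesis"
    \<comment> \<open>A vertex without neighbours in the complement is a closed set by itself, hence
      would be the only vertex.\<close>
    have "{a} = {0..<fst \<Gamma>}"
      using no a nonadj_sym[OF sg] by (intro nonadj_connected[OF sg ind]) auto
    then have "card {0..<fst \<Gamma>} = 1" by (metis card.empty card_insert_disjoint empty_iff finite.emptyI One_nat_def)
    then show False using two by simp
  qed
  show "C = {0..<fst \<Gamma>}"
    if "C \<subseteq> {0..<fst \<Gamma>}" "C \<noteq> {}" "\<And>a b. nonadj \<Gamma> a b \<Longrightarrow> (a \<in> C) = (b \<in> C)" for C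
    by (rule nonadj_connected[OF sg ind that])
  show "fst (g \<otimes>\<^bsub>?M\<^esub> h) a = fst g a + fst h a" for g h a
    by (cases g; cases h) (simp add: mult_magnus)
  show "\<exists>g\<in>carrier ?M. \<forall>a\<in>{0..<fst \<Gamma>}. fst g a = v a" for v
  proof
    let ?v = "\<lambda>a. if a < fst \<Gamma> then v a else 0"
    show "(?v, \<lambda>a b. if nonadj \<Gamma> a b \<and> a < b then ?v a * ?v b else 0) \<in> carrier ?M"
      using nonadj_sym[OF sg] by (auto simp: carrier_magnus) (auto simp: nonadj_def)
  qed simp
  show "g \<otimes>\<^bsub>?M\<^esub> h = h \<otimes>\<^bsub>?M\<^esub> g \<longleftrightarrow>
      (\<forall>a b. nonadj \<Gamma> a b \<longrightarrow> fst g a * fst h b = fst g b * fst h a)" for g h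
  proof -
    have "x = y \<longleftrightarrow> (y :: int) = x" for x y by auto
    then show ?thesis by (cases g; cases h) (auto simp: mult_magnus fun_eq_iff mult.commute)
  qed
  show "g \<in> derived ?M (carrier ?M)" if "g \<in> carrier ?M" "\<And>a. a \<in> {0..<fst \<Gamma>} \<Longrightarrow> fst g a = 0" for g
    using that magnus_derived[OF sg, of "fst g" "snd g"] by simp
qed

lemma group_G_graph: "group (G_graph \<Gamma>)"
  unfolding G_graph_def by (rule group_presented_group)

lemma G_graph_iso_magnus: "simple_graph \<Gamma> \<Longrightarrow> G_graph \<Gamma> \<cong> magnus_group \<Gamma>"
  by (rule simple_graph_group.G_graph_magnus) (simp add: simple_graph_group_def)

lemma product_group_insert:
  assumes "i \<notin> I" and G: "\<And>j. j \<in> insert i I \<Longrightarrow> group (G j)"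
  shows "G i \<times>\<times> product_group I G \<cong> product_group (insert i I) G"
proof (rule isoI_inverse[where f = "\<lambda>(x, h). h(i := x)" and g = "\<lambda>h. (h i, restrict h I)"])
  show "(\<lambda>(x, h). h(i := x)) \<in> hom (G i \<times>\<times> product_group I G) (product_group (insert i I) G)"
    using assms(1) by (intro homI) (auto simp: PiE_iff extensional_def fun_eq_iff)
qed (use assms(1) in \<open>auto simp: PiE_iff extensional_def fun_eq_iff\<close>)

lemma simple_graph_join_list: "(\<And>\<Gamma>. \<Gamma> \<in> set \<Gamma>s \<Longrightarrow> simple_graph \<Gamma>) \<Longrightarrow> simple_graph (join_list \<Gamma>s)"
  by (induction \<Gamma>s) (simp_all add: simple_graph_join, simp add: simple_graph_def)

lemma magnus_join_list:
  assumes "distinct is" "\<And>i. i \<in> set is \<Longrightarrow> simple_graph (\<Gamma> i)"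
  shows "magnus_group (join_list (map \<Gamma> is)) \<cong> product_group (set is) (\<lambda>i. magnus_group (\<Gamma> i))"
  using assms
proof (induction "is")
  case Nil
  let ?T = "magnus_group (0, \<lambda>_ _. False)"
  have "?T \<cong> product_group {} (\<lambda>i. magnus_group (\<Gamma> i))"
  proof (rule isoI_inverse[where f = "\<lambda>_ _. undefined" and g = "\<lambda>_. \<one>\<^bsub>?T\<^esub>"])
    show "(\<lambda>_ _. undefined) \<in> hom ?T (product_group {} (\<lambda>i. magnus_group (\<Gamma> i)))"
      by (rule homI) auto
    show "\<one>\<^bsub>?T\<^esub> \<in> carrier ?T" by (simp add: one_magnus carrier_magnus)
    show "\<one>\<^bsub>?T\<^esub> = x" if "x \<in> carrier ?T" for x
      using that by (cases x) (auto simp: carrier_magnus one_magnus nonadj_def fun_eq_iff)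
  qed auto
  then show ?case by simp
next
  case (Cons i "is")
  have sgl: "simple_graph (join_list (map \<Gamma> is))" using Cons.prems by (intro simple_graph_join_list) auto
  have sgi: "simple_graph (\<Gamma> i)" using Cons.prems by simp
  have gr: "group (magnus_group (\<Gamma> j))" if "j \<in> insert i (set is)" for j
    using Cons.prems that by (intro group_magnus) auto
  have "magnus_group (join (\<Gamma> i) (join_list (map \<Gamma> is))) \<cong>
      magnus_group (\<Gamma> i) \<times>\<times> magnus_group (join_list (map \<Gamma> is))"
    by (rule magnus_join[OF sgi sgl])
  also have "magnus_group (\<Gamma> i) \<times>\<times> magnus_group (join_list (map \<Gamma> is)) \<cong>
      magnus_group (\<Gamma> i) \<times>\<times> product_group (set is) (\<lambda>i. magnus_group (\<Gamma> i))"
    using Cons.IH Cons.prems gr[of i] by (intro group.DirProd_iso_trans iso_refl) auto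
  also have "\<dots> \<cong> product_group (insert i (set is)) (\<lambda>i. magnus_group (\<Gamma> i))"
    using product_group_insert[OF _ gr] Cons.prems by auto
  finally show ?case by simp
qed

theorem theorem5p11:
  fixes k :: nat and \<Gamma> :: "nat \<Rightarrow> graph"
  assumes "k \<ge> 1"
    and "\<And>i. i \<in> {1..k} \<Longrightarrow> simple_graph (\<Gamma> i)"
    and "\<And>i j. i \<in> {1..k} \<Longrightarrow> j \<in> {1..k} \<Longrightarrow> graph_iso (\<Gamma> i) (\<Gamma> j)"
    and "\<And>i. i \<in> {1..k} \<Longrightarrow> fst (\<Gamma> i) \<ge> 2"
    and "\<And>i. i \<in> {1..k} \<Longrightarrow> \<not> join_decomposable (\<Gamma> i)"
  shows "spec_R (G_graph (join_list (map \<Gamma> [1..<k+1])))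
           = spec_R (product_group {1..k} (\<lambda>i. G_graph (\<Gamma> i)))
       \<and> spec_R (product_group {1..k} (\<lambda>i. G_graph (\<Gamma> i)))
           = (\<Union>i\<in>{1..k}. {(\<Prod>m\<in>{1..i}. R m) | R.
                 \<forall>m\<in>{1..i}. R m \<in> spec_R (G_graph (\<Gamma> 1))})"
proof -
  let ?J = "join_list (map \<Gamma> [1..<k+1])" and ?PG = "product_group {1..k} (\<lambda>i. G_graph (\<Gamma> i))"
  let ?PM = "product_group {1..k} (\<lambda>i. magnus_group (\<Gamma> i))" and ?M = "magnus_group (\<Gamma> 1)"
  let ?N = "product_group {1..k} (\<lambda>_. ?M)"
  have sg: "simple_graph (\<Gamma> i)" if "i \<in> {1..k}" for i using assms(2) that by blast
  have set_k: "set [1..<k+1] = {1..k}" by auto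
  have 1: "1 \<in> {1..k}" using assms(1) by simp
  interpret M: complement_connected_group ?M "{0..<fst (\<Gamma> 1)}" "nonadj (\<Gamma> 1)" "\<lambda>a g. fst g a"
    by (rule complement_connected_magnus[OF sg[OF 1] assms(5)[OF 1] assms(4)[OF 1]])
  have grM: "group (magnus_group (\<Gamma> i))" if "i \<in> {1..k}" for i by (rule group_magnus[OF sg[OF that]])
  have grPM: "group ?PM" by (rule product_group) (rule grM)
  have grPG: "group ?PG" by (rule product_group) (rule group_G_graph)
  have sgJ: "simple_graph ?J" using sg set_k by (intro simple_graph_join_list) auto
  have J: "spec_R (G_graph ?J) = spec_R ?PM"
  proof -
    have "magnus_group ?J \<cong> product_group (set [1..<k+1]) (\<lambda>i. magnus_group (\<Gamma> i))"
      by (rule magnus_join_list[OF distinct_upt]) (simp only: set_k sg)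
    then have "magnus_group ?J \<cong> ?PM" unfolding set_k .
    then have "G_graph ?J \<cong> ?PM" using G_graph_iso_magnus[OF sgJ] iso_trans by blast
    then show ?thesis by (rule spec_R_iso[OF group_G_graph grPM])
  qed
  have P: "spec_R ?PG = spec_R ?PM"
    using sg by (intro spec_R_iso[OF grPG grPM] iso_product_groupI G_graph_iso_magnus group_G_graph grM)
  \<comment> \<open>The graphs are only isomorphic; relabelling in the model turns the product into
    an honest power of one group.\<close>
  have "?PM \<cong> ?N"
    using sg assms(3) 1 by (intro iso_product_groupI graph_iso_magnus grM) auto
  then have N: "spec_R ?PM = spec_R ?N"
    by (rule spec_R_iso[OF grPM M.group_pow_group])
  have "spec_R (G_graph (\<Gamma> 1)) = spec_R ?M"
    by (rule spec_R_iso[OF group_G_graph grM[OF 1] G_graph_iso_magnus[OF sg[OF 1]]])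
  then show ?thesis using J P N M.spec_R_pow_group[OF assms(1)] by simp
qed

end
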